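(* Let $k \geqslant 4$, let $d_0 > 2$ be an integer, and let $n = \sum_{i=1}^{k-2}(2^{d_i}-1)$ with positive integers $d_1 > d_2 > \dots > d_{k-3} \geqslant d_{k-2} = d \geqslant d_0$. Put $m = \sum_{i=1}^{k-3}(2^{d_i-d}-1)$. Suppose $\mathcal B \subset \mathsf{PInc}_k^{d_0}$ is compatible with $(k-2)|^{d_0}$. Then the classes in $QP_k$ of the polynomials $$X_{(\mathcal I,\mathcal J)}\,(X_{i,j})^{2^d-2^{d_0}}\,\big(f_{(i,j)}(y)\big)^{2^d},\qquad (\mathcal I,\mathcal J)\in\mathcal B,\ i=\min\mathcal I,\ j = \min\mathcal J,\ y \in B_{k-2}(m),$$ span a subspace of $(QP_k)_n$ containing $\mathrm{Ker}\big((\widetilde{Sq}^0_* )_{(k,n)}\big)$ (i.e. they form a generating set of this kernel). Consequently $\dim \mathrm{Ker}\big((\widetilde{Sq}^0_* )_{(k,n)}\big) \leqslant |\mathcal B|\cdot\dim (QP_{k-2})_m$.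
   Context: $P_k=\mathbb F_2[x_1,\dots,x_k]$ ($\deg x_i=1$) is a module over the mod-2 Steenrod algebra $\mathcal A$; $\mathcal A^+$ is the augmentation ideal; $QP_k = P_k/\mathcal A^+P_k$; $f\equiv g$ means $f+g\in\mathcal A^+P_k$; $(P_k)_n$ and $(QP_k)_n$ denote degree-$n$ parts. Kameko's operation $(\widetilde{Sq}^0_* )_{(k,n)}:(QP_k)_n\to(QP_k)_{(n-k)/2}$ is induced by the linear map sending a monomial $x_1\cdots x_k y^2$ to $y$ and every other monomial to $0$. For $a\ge 0$ let $\alpha_i(a)$ be the $i$-th binary digit of $a$. For a monomial $x = x_1^{a_1}\cdots x_k^{a_k}$, the weight vector is $\omega(x) = (\omega_1(x),\omega_2(x),\dots)$ with $\omega_i(x) = \sum_{j}\alpha_{i-1}(a_j)$, and the exponent vector is $\sigma(x) = (a_1,\dots,a_k)$; both are ordered left-lexicographically. For a weight vector $\omega$, $\deg\omega = \sum_i 2^{i-1}\omega_i$; $P_k^-(\omega)$ is spanned by monomials $y$ with $\deg y=\deg\omega$ and $\omega(y)<\omega$. $(k-2)|^{d}$ denotes the weight vector whose first $d$ entries are $k-2$ and the rest $0$. For monomials of equal degree, $x<y$ means $\omega(x)<\omega(y)$, or $\omega(x)=\omega(y)$ and $\sigma(x)<\sigma(y)$. A monomial $x$ is inadmissible if $x\equiv \sum_j y_j$ for some monomials $y_j<x$, and admissible otherwise. $B_{k-2}(m)$ is the set of admissible monomials of degree $m$ in $P_{k-2}$. $\mathcal A(s-1)$ is the sub-Hopf algebra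 generated by $Sq^i$, $0\le i<2^s$, and $\mathcal A(s-1)^+ = \mathcal A^+\cap\mathcal A(s-1)$. Minimal spike: if $\mu(n)$, the least $r$ with $n = \sum_{i=1}^r(2^{u_i}-1)$, $u_i>0$, equals $s$, then $n=\sum_{i=1}^s(2^{e_i}-1)$ for unique $e_1>\dots>e_{s-1}\ge e_s>0$ and the minimal spike of degree $n$ is $z=\prod_{i=1}^s x_i^{2^{e_i}-1}$. $\mathcal P_{(k,n)}$ is the subspace spanned by monomials $x$ of degree $n$ for which $\sum_{j=1}^h 2^{j-1}\omega_j(x) < \sum_{j=1}^h 2^{j-1}\omega_j(z)$ for some $h\ge1$. $X_{i,j} = \prod_{l\in\{1,\dots,k\}\setminus\{i,j\}}x_l$. $\mathsf{PSeq}_k^{e}$ is the set of pairs $(\mathcal I,\mathcal J)$ of sequences $\mathcal I=(i_1,\dots,i_e)$, $\mathcal J=(j_1,\dots,j_e)$ with $1\le i_t<j_t\le k$; $\mathsf{PInc}_k^e$ is the subset where $i_1\le\dots\le i_e$ and $j_1\le\dots\le j_e$. For such a pair, $X_{(\mathcal I,\mathcal J)} = \prod_{t=1}^e X_{i_t,j_t}^{2^{e-t}}$. For a finite sequence $S=(s_0)|^{c_0}|(s_1)|^{c_1}|\cdots|(s_r)|^{c_r}$ (blocks of $c_i$ equal entries $s_i$, with $s_{i+1}\ne s_i$), the reduced length is $\mathrm{rl}(S) = c_1+\dots+c_r$. A subset $\mathcal B\subset\mathsf{PInc}_k^{d_0}$ ($d_0>2$) is compatible with $(k-2)|^{d_0}$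 if (i) $\mathrm{rl}(\mathcal I)\le d_0-2$ and $\mathrm{rl}(\mathcal J)\le d_0-2$ for all $(\mathcal I,\mathcal J)\in\mathcal B$; and (ii) for every $(\mathcal H,\mathcal K)\in\mathsf{PSeq}_k^{d_0}$ there are subsets $\mathcal B_u\subset\mathcal B$ ($\min\mathcal H<u\le\min\mathcal K$) consisting of pairs $(\mathcal I,\mathcal J)$ with $\min\mathcal I=\min\mathcal H$ and $\min\mathcal J=u$ such that $X_{(\mathcal H,\mathcal K)} + \sum_{u=\min\mathcal H+1}^{\min\mathcal K}\sum_{(\mathcal I,\mathcal J)\in\mathcal B_u}X_{(\mathcal I,\mathcal J)} \in \mathcal A(d_0-1)^+P_k + P_k^-((k-2)|^{d_0}) + \mathcal P_{(k,n_{d_0})}$, where $n_{d_0}=(k-2)(2^{d_0}-1)$. For $1\le i<j\le k$, $f_{(i,j)}:P_{k-2}\to P_k$ is the algebra homomorphism sending $x_1,\dots,x_{k-2}$, in order, to the variables $x_l$, $l\notin\{i,j\}$, in increasing order of $l$. *)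

theory Defs
  imports Main
begin

(* Polynomials over F_2 in k variables.
   A monomial x_1^{a_1}...x_k^{a_k} is its exponent list [a_1,...,a_k];
   a polynomial is the finite set of monomials with coefficient 1. *)

type_synonym mono = "nat list"
type_synonym poly = "nat list set"

definition polys :: "nat \<Rightarrow> poly set" where
  "polys k = {P. finite P \<and> (\<forall>a\<in>P. length a = k)}"

definition polys_deg :: "nat \<Rightarrow> nat \<Rightarrow> poly set" where
  "polys_deg k n = {f \<in> polys k. \<forall>a\<in>f. sum_list a = n}"

definition padd :: "poly \<Rightarrow> poly \<Rightarrow> poly" where
  "padd A B = (A - B) \<union> (B - A)"

definition Psum :: "('i \<Rightarrow> poly) \<Rightarrow> 'i set \<Rightarrow> poly" where
  "Psum F S = {m. odd (card {s\<in>S. m \<in> F s})}"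

definition f2span :: "poly set \<Rightarrow> poly set" where
  "f2span S = {Psum id T | T. finite T \<and> T \<subseteq> S}"

definition ssum :: "poly set \<Rightarrow> poly set \<Rightarrow> poly set" where
  "ssum V W = {padd a b | a b. a \<in> V \<and> b \<in> W}"

(* Sq^i on a monomial (Cartan formula): Sq^i(x^a) = sum over i_1+..+i_k=i of
   prod_j binom(a_j,i_j) x^{a+i} *)
definition Sq_mono :: "nat \<Rightarrow> mono \<Rightarrow> poly" where
  "Sq_mono i a = {b. length b = length a \<and>
      (\<forall>j<length a. a!j \<le> b!j \<and> odd ((a!j) choose (b!j - a!j))) \<and>
      sum_list b = sum_list a + i}"

definition Sq :: "nat \<Rightarrow> poly \<Rightarrow> poly" where
  "Sq i f = Psum (Sq_mono i) f"

definition hit :: "nat \<Rightarrow> poly set" where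
  "hit k = f2span {Sq i f | i f. 0 < i \<and> f \<in> polys k}"

(* A(s-1)^+ P_k, A(s-1) generated by Sq^i, 0 \<le> i < 2^s *)
definition hitA :: "nat \<Rightarrow> nat \<Rightarrow> poly set" where
  "hitA s k = f2span {Sq i f | i f. 0 < i \<and> i < 2^s \<and> f \<in> polys k}"

(* weight vector, omega_i for i \<ge> 1 *)
definition weight :: "mono \<Rightarrow> nat \<Rightarrow> nat" where
  "weight a i = (\<Sum>j<length a. ((a!j) div 2^(i-1)) mod 2)"

definition wlt :: "(nat \<Rightarrow> nat) \<Rightarrow> (nat \<Rightarrow> nat) \<Rightarrow> bool" where
  "wlt w v = (\<exists>i\<ge>1. (\<forall>j. 1 \<le> j \<and> j < i \<longrightarrow> w j = v j) \<and> w i < v i)"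

definition wdeg :: "(nat \<Rightarrow> nat) \<Rightarrow> nat" where
  "wdeg w = (\<Sum>i\<in>{i. 1 \<le> i \<and> w i \<noteq> 0}. 2^(i-1) * w i)"

definition cw :: "nat \<Rightarrow> nat \<Rightarrow> nat \<Rightarrow> nat" where
  "cw c d i = (if 1 \<le> i \<and> i \<le> d then c else 0)"

definition Pminus :: "nat \<Rightarrow> (nat \<Rightarrow> nat) \<Rightarrow> poly set" where
  "Pminus k w = f2span {{y} | y. length y = k \<and> sum_list y = wdeg w \<and> wlt (weight y) w}"

definition mu :: "nat \<Rightarrow> nat" where
  "mu n = (LEAST r. \<exists>u. length u = r \<and> (\<forall>x\<in>set u. 0 < x) \<and>
             n = sum_list (map (\<lambda>e. 2^e - 1) u))"

definition minspike_exps :: "nat \<Rightarrow> nat list" where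
  "minspike_exps n = (THE es. length es = mu n \<and> (\<forall>x\<in>set es. 0 < x) \<and>
      n = sum_list (map (\<lambda>e. 2^e - 1) es) \<and>
      (\<forall>i. i + 1 < length es \<longrightarrow> es!(i+1) \<le> es!i) \<and>
      (\<forall>i. i + 2 < length es \<longrightarrow> es!(i+1) < es!i))"

(* the minimal spike z of degree n (exponent list; trailing zero exponents do
   not affect the weight vector) *)
definition minspike :: "nat \<Rightarrow> mono" where
  "minspike n = map (\<lambda>e. 2^e - 1) (minspike_exps n)"

definition Pcal :: "nat \<Rightarrow> nat \<Rightarrow> poly set" where
  "Pcal k n = f2span {{x} | x. length x = k \<and> sum_list x = n \<and>
      (\<exists>h\<ge>1. (\<Sum>j=1..h. 2^(j-1) * weight x j) < (\<Sum>j=1..h. 2^(j-1) * weight (minspike n) j))}"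

definition Xij :: "nat \<Rightarrow> nat \<Rightarrow> nat \<Rightarrow> mono" where
  "Xij k i j = map (\<lambda>l. if l = i \<or> l = j then 0 else 1) [1..<k+1]"

(* X_{(I,J)} = prod_t X_{i_t,j_t}^{2^{e-t}} *)
definition XIJ :: "nat \<Rightarrow> nat list \<Rightarrow> nat list \<Rightarrow> mono" where
  "XIJ k I J = map (\<lambda>l. \<Sum>t<length I. (if l = I!t \<or> l = J!t then 0 else 1) * 2^(length I - 1 - t))
                 [1..<k+1]"

definition PSeq :: "nat \<Rightarrow> nat \<Rightarrow> (nat list \<times> nat list) set" where
  "PSeq k e = {(I,J). length I = e \<and> length J = e \<and>
                 (\<forall>t<e. 1 \<le> I!t \<and> I!t < J!t \<and> J!t \<le> k)}"

definition PInc :: "nat \<Rightarrow> nat \<Rightarrow> (nat list \<times> nat list) set" where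
  "PInc k e = {(I,J)\<in>PSeq k e. sorted I \<and> sorted J}"

definition rl :: "nat list \<Rightarrow> nat" where
  "rl S = length S - length (takeWhile (\<lambda>x. x = hd S) S)"

definition compatible :: "nat \<Rightarrow> nat \<Rightarrow> (nat list \<times> nat list) set \<Rightarrow> bool" where
  "compatible k d0 B \<longleftrightarrow>
     B \<subseteq> PInc k d0 \<and>
     (\<forall>(I,J)\<in>B. rl I \<le> d0 - 2 \<and> rl J \<le> d0 - 2) \<and>
     (\<forall>(H,K)\<in>PSeq k d0. \<exists>Bu :: nat \<Rightarrow> (nat list \<times> nat list) set.
        (\<forall>u\<in>{Min (set H)<..Min (set K)}. Bu u \<subseteq> B \<and>
            (\<forall>(I,J)\<in>Bu u. Min (set I) = Min (set H) \<and> Min (set J) = u)) \<and>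
        padd {XIJ k H K}
          (Psum (\<lambda>u. Psum (\<lambda>(I,J). {XIJ k I J}) (Bu u)) {Min (set H)<..Min (set K)})
        \<in> ssum (ssum (hitA d0 k) (Pminus k (cw (k-2) d0))) (Pcal k ((k-2) * (2^d0 - 1))))"

definition kameko :: "poly \<Rightarrow> poly" where
  "kameko f = Psum (\<lambda>a. if (\<forall>e\<in>set a. odd e) then {map (\<lambda>e. (e - 1) div 2) a} else {}) f"

definition mless :: "mono \<Rightarrow> mono \<Rightarrow> bool" where
  "mless x y = (wlt (weight x) (weight y) \<or>
      (weight x = weight y \<and> (\<exists>i<length x. take i x = take i y \<and> x!i < y!i)))"

definition inadmissible :: "nat \<Rightarrow> mono \<Rightarrow> bool" where
  "inadmissible k x = (\<exists>T. finite T \<and>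
      (\<forall>y\<in>T. length y = k \<and> sum_list y = sum_list x \<and> mless y x) \<and>
      padd {x} (Psum (\<lambda>y. {y}) T) \<in> hit k)"

definition admissible_set :: "nat \<Rightarrow> nat \<Rightarrow> mono set" where
  "admissible_set k m = {x. length x = k \<and> sum_list x = m \<and> \<not> inadmissible k x}"

definition fij :: "nat \<Rightarrow> nat \<Rightarrow> nat \<Rightarrow> mono \<Rightarrow> mono" where
  "fij k i j y = map (\<lambda>l. if l = i \<or> l = j then 0
       else y ! (l - 1 - (if i < l then 1 else 0) - (if j < l then 1 else 0))) [1..<k+1]"

definition gen :: "nat \<Rightarrow> nat \<Rightarrow> nat \<Rightarrow> nat list \<Rightarrow> nat list \<Rightarrow> mono \<Rightarrow> mono" where
  "gen k d0 d I J y = (let i = Min (set I); j = Min (set J) in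
      map (\<lambda>l. XIJ k I J ! l + (2^d - 2^d0) * Xij k i j ! l + 2^d * fij k i j y ! l) [0..<k])"

(* dimension of the image of a subspace V in P/W: minimal size of a generating set *)
definition qdim :: "poly set \<Rightarrow> poly set \<Rightarrow> nat" where
  "qdim V W = (LEAST c. \<exists>S. finite S \<and> card S = c \<and> S \<subseteq> V \<and> V \<subseteq> ssum (f2span S) W)"

end

theory Submission
  imports Defs "HOL-Library.Poly_Mapping" "HOL-Library.Z2" "HOL-Library.Product_Plus" "HOL-Library.Multiset"
begin

text \<open>
  Put s = k - 2 and let N e be the degree that is left when d - e levels of weight s are stripped
  off a monomial of degree n. If N e is not a sum of fewer than s numbers 2^u - 1, then the
  chi-trick u Sq^i v = chi(Sq^i)(u) v modulo hit polynomials shows that a product of fewer than s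
  variables times a square is hit in degree N e, and that X y^2 is hit whenever X is a product of s
  variables and y is hit. Weights larger than s can only be s + 2, after which the partial weights
  exceed their minimal values by exactly one unit until they return or drop below; monomials of the
  last kind are hit because they can be written with a control on the first two terms of
  the relation obtained by adjoining one more variable. This replaces Silverman's excess theorem.

  Modulo hit polynomials the kernel of Kameko's map is then spanned by the monomials
  X_(H,K) g^(2^d0). Compatibility replaces (H,K) by members (I,J) of B; since the two topmost
  entries of I and of J coincide, Sq^1 trades a factor x_i or x_j of g for another variable,
  changing the topmost pair only. Each such step decreases (min H, min K, deg_i g + deg_j g)
  lexicographically, so g may be assumed free of x_i and x_j, and in the remaining s variables
  Kameko's map is an isomorphism down to degree m.
\<close>

section \<open>Polynomials over the field with two elements\<close>

text \<open>The conjugate total square is multiplicative and sends a variable x to x + x^2 + x^4 +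
  ..., so on a product of r variables its part of index i can be nonzero only if i + r is a sum of r
  powers of two, that is, if i is a sum of r numbers 2^u - 1. All conditions on degrees come from
  this.

  There are two obstacles. That s - 1 such numbers never add up to N e holds for positive e but
  fails for N 0 = m, which is by definition such a sum. And the monomials discarded by compatibility
  are measured against the minimal spike of degree s (2^d0 - 1), which for s at least 3 is not the
  product of s equal powers; hence their partial weights may rise above those of (s, s, ...) before
  they fall below. A monomial of excess one leaves a tail of degree N e - 1, which has the right
  degree only after multiplication by one more variable w. Keeping the coefficients of w and w^2 in
  the squares of w f controls such tails without leaving the k variables.\<close>

abbreviation "lookup \<equiv> Poly_Mapping.lookup"
abbreviation "keys \<equiv> Poly_Mapping.keys"

type_synonym f2poly = "(nat \<Rightarrow>\<^sub>0 nat) \<Rightarrow>\<^sub>0 bit"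

lemma f2_add_self [simp]: "(v::'a \<Rightarrow>\<^sub>0 bit) + v = 0"
  by (rule poly_mapping_eqI) (simp add: lookup_add)

lemma f2_add_self_left [simp]: "(v::'a \<Rightarrow>\<^sub>0 bit) + (v + w) = w"
  by (simp flip: add.assoc)

lemma f2_minus [simp]: "- (v::'a \<Rightarrow>\<^sub>0 bit) = v"
  by (rule minus_unique) simp

lemma f2_diff [simp]: "(v::'a \<Rightarrow>\<^sub>0 bit) - w = v + w"
  using diff_conv_add_uminus[of v w] by simp

lemma f2_two [simp]: "(2::f2poly) = 0"
  unfolding one_add_one[symmetric] by (rule f2_add_self)

lemma f2_square_add: "((v::f2poly) + w)^2 = v^2 + w^2"
  by (simp add: power2_sum)

lemma f2_square_sum: "(\<Sum>i\<in>I. f i :: f2poly)^2 = (\<Sum>i\<in>I. (f i)^2)"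
  by (induction I rule: infinite_finite_induct) (auto simp: f2_square_add)

text \<open>Over the field with two elements the additive closure is already the linear span.
  Arbitrary additive monoids are allowed because pairs of polynomials are spanned as well.\<close>

inductive_set aspan :: "'a::comm_monoid_add set \<Rightarrow> 'a set" for S where
  aspan_zero: "0 \<in> aspan S"
| aspan_step: "s \<in> S \<Longrightarrow> v \<in> aspan S \<Longrightarrow> s + v \<in> aspan S"

lemma aspan_base: "s \<in> S \<Longrightarrow> s \<in> aspan S"
  using aspan_step[OF _ aspan_zero] by fastforce

lemma aspan_add: "v \<in> aspan S \<Longrightarrow> w \<in> aspan S \<Longrightarrow> v + w \<in> aspan S"
  by (induction v rule: aspan.induct) (auto simp: add.assoc intro: aspan.intros)

lemma aspan_sum: "(\<And>i. i \<in> I \<Longrightarrow> f i \<in> aspan S) \<Longrightarrow> sum f I \<in> aspan S"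
  by (induction I rule: infinite_finite_induct) (auto intro: aspan_zero aspan_add)

lemma aspan_sum_list: "(\<And>i. i \<in> set xs \<Longrightarrow> f i \<in> aspan S) \<Longrightarrow> sum_list (map f xs) \<in> aspan S"
  by (induction xs) (auto intro: aspan_zero aspan_add)

lemma aspan_image:
  assumes "v \<in> aspan S" "\<phi> 0 = 0" "\<And>v w. \<phi> (v + w) = \<phi> v + \<phi> w" "\<And>s. s \<in> S \<Longrightarrow> \<phi> s \<in> aspan T"
  shows "\<phi> v \<in> aspan T"
  using assms(1) by induction (auto simp: assms(2,3) intro: aspan_zero aspan_add assms(4))

lemma aspan_closed:
  assumes "v \<in> aspan S" "0 \<in> T" "\<And>v w. v \<in> T \<Longrightarrow> w \<in> T \<Longrightarrow> v + w \<in> T" "\<And>s. s \<in> S \<Longrightarrow> s \<in> T"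
  shows "v \<in> T"
  using assms(1) by induction (auto simp: assms)

lemma aspan_mono: "S \<subseteq> T \<Longrightarrow> aspan S \<subseteq> aspan T"
  by (auto elim!: aspan_closed intro: aspan_zero aspan_add aspan_base)

abbreviation mon :: "'a \<Rightarrow> 'a \<Rightarrow>\<^sub>0 bit" where "mon a \<equiv> Poly_Mapping.single a 1"

lemma f2_expand: "(v::'a \<Rightarrow>\<^sub>0 bit) = (\<Sum>a\<in>keys v. mon a)"
proof (rule poly_mapping_eqI)
  fix b
  have "lookup (\<Sum>a\<in>keys v. mon a) b = (\<Sum>a\<in>keys v. if a = b then 1 else 0)"
    by (simp add: lookup_sum lookup_single when_def)
  also have "\<dots> = (if b \<in> keys v then 1 else 0)"
    by simp
  also have "\<dots> = lookup v b"
  proof (cases "lookup v b = 0")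
    case True then show ?thesis by (simp add: in_keys_iff)
  next
    case False
    then have "b \<in> keys v" by (simp only: in_keys_iff not_False_eq_True)
    moreover have "lookup v b = 1" using False by simp
    ultimately show ?thesis by simp
  qed
  finally show "lookup v b = lookup (\<Sum>a\<in>keys v. mon a) b" by simp
qed

lemma f2_induct [case_names zero add]:
  assumes "P 0" "\<And>a v. P v \<Longrightarrow> P (mon a + v)"
  shows "P (v::'a \<Rightarrow>\<^sub>0 bit)"
proof -
  have "P (\<Sum>a\<in>A. mon a)" if "finite A" for A
    using that by induction (auto intro: assms)
  then show ?thesis by (subst f2_expand) simp
qed

lemma keys_f2_add: "keys ((u::'a \<Rightarrow>\<^sub>0 bit) + v) = (keys u - keys v) \<union> (keys v - keys u)"
proof -
  have "lookup (u + v) a \<noteq> 0 \<longleftrightarrow> (lookup u a \<noteq> 0) \<noteq> (lookup v a \<noteq> 0)" for a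
    by (cases "lookup u a = 0"; cases "lookup v a = 0") (simp_all add: lookup_add)
  then show ?thesis unfolding set_eq_iff Un_iff Diff_iff in_keys_iff by blast
qed

definition lext :: "('a \<Rightarrow> ('b \<Rightarrow>\<^sub>0 bit)) \<Rightarrow> ('a \<Rightarrow>\<^sub>0 bit) \<Rightarrow> ('b \<Rightarrow>\<^sub>0 bit)" where
  "lext F v = (\<Sum>a\<in>keys v. F a)"

lemma sum_sym_diff:
  fixes F :: "'a \<Rightarrow> ('b \<Rightarrow>\<^sub>0 bit)"
  assumes "finite A" "finite B"
  shows "sum F ((A - B) \<union> (B - A)) = sum F A + sum F B"
proof -
  have "sum F ((A - B) \<union> (B - A)) = sum F (A - B) + sum F (B - A)"
    using assms by (intro sum.union_disjoint) auto
  also have "sum F (A - B) = sum F A + sum F (A \<inter> B)"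
    using sum.Int_Diff[OF assms(1), of F B] by (simp add: add.left_commute add.commute)
  also have "sum F (B - A) = sum F B + sum F (A \<inter> B)"
    using sum.Int_Diff[OF assms(2), of F A] by (simp add: Int_commute add.left_commute add.commute)
  finally show ?thesis by (simp add: add.left_commute add.commute)
qed

lemma lext_zero [simp]: "lext F 0 = 0" by (simp add: lext_def)

lemma lext_add: "lext F (u + v) = lext F u + lext F v"
  by (simp add: lext_def keys_f2_add sum_sym_diff)

lemma lext_mon [simp]: "lext F (mon a) = F a"
  by (simp add: lext_def)

section \<open>Steenrod squares\<close>

definition dg :: "(nat \<Rightarrow>\<^sub>0 nat) \<Rightarrow> nat" where "dg a = (\<Sum>j\<in>keys a. lookup a j)"

lemma dg_alt: "finite A \<Longrightarrow> keys a \<subseteq> A \<Longrightarrow> dg a = (\<Sum>j\<in>A. lookup a j)"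
  unfolding dg_def by (rule sum.mono_neutral_left) (auto simp: in_keys_iff)

lemma dg_add [simp]: "dg (a + b) = dg a + dg b"
proof -
  have 1: "finite (keys a \<union> keys b)" by simp
  have "keys (a + b) \<subseteq> keys a \<union> keys b" by (rule keys_add)
  then show ?thesis
    by (simp add: dg_alt[OF 1] sum.distrib lookup_add)
qed

lemma dg_zero [simp]: "dg 0 = 0" by (simp add: dg_def)
lemma dg_single [simp]: "dg (Poly_Mapping.single l c) = c"
  by (simp add: dg_def)

text \<open>Exponents of the monomials in Sq^i of the monomial with exponent \<open>a\<close>. By
  the Cartan formula each of them arises from exactly one choice of increments, so a set suffices
  and no multiplicities have to be kept.\<close>

definition sqexp :: "nat \<Rightarrow> (nat \<Rightarrow>\<^sub>0 nat) \<Rightarrow> (nat \<Rightarrow>\<^sub>0 nat) set" where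
  "sqexp i a = {b. (\<forall>j. lookup a j \<le> lookup b j \<and> odd (lookup a j choose (lookup b j - lookup a j))) \<and> dg b = dg a + i}"

lemma sqexp_keys: "b \<in> sqexp i a \<Longrightarrow> keys b = keys a"
proof -
  assume b: "b \<in> sqexp i a"
  have "lookup a j = 0 \<longleftrightarrow> lookup b j = 0" for j
  proof -
    have "lookup a j \<le> lookup b j" "odd (lookup a j choose (lookup b j - lookup a j))"
      using b by (auto simp: sqexp_def)
    then show ?thesis by (metis binomial_eq_0 diff_zero dvd_0_right le_zero_eq neq0_conv)
  qed
  then show ?thesis by (auto simp: in_keys_iff)
qed

lemma finite_sqexp [simp]: "finite (sqexp i a)"
proof -
  \<comment> \<open>One more than the largest variable of the support. Squares preserve the support,
    so the first \<open>M\<close> values determine an exponent.\<close>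
  define M where "M = (if keys a = {} then 0 else Suc (Max (keys a)))"
  have M: "j < M" if "j \<in> keys a" for j
    using that by (auto simp: M_def less_Suc_eq_le)
  let ?f = "\<lambda>b. map (lookup b) [0..<M]"
  have "inj_on ?f (sqexp i a)"
  proof (rule inj_onI)
    fix b c assume b: "b \<in> sqexp i a" and c: "c \<in> sqexp i a" and eq: "?f b = ?f c"
    show "b = c"
    proof (rule poly_mapping_eqI)
      fix j
      show "lookup b j = lookup c j"
      proof (cases "j < M")
        case True then show ?thesis using eq by (auto simp: map_eq_conv)
      next
        case False
        then have "j \<notin> keys a" using M by auto
        then have "j \<notin> keys b" "j \<notin> keys c" using sqexp_keys b c by auto
        then show ?thesis by (simp add: in_keys_iff)
      qed
    qed
  qed
  moreover have "?f ` sqexp i a \<subseteq> {xs. set xs \<subseteq> {0..dg a + i} \<and> length xs = M}"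
  proof -
    have "lookup b j \<le> dg a + i" if "b \<in> sqexp i a" for b j
    proof (cases "j \<in> keys b")
      case True
      then have "lookup b j \<le> dg b" unfolding dg_def by (intro member_le_sum) auto
      then show ?thesis using that by (simp add: sqexp_def)
    qed (simp add: in_keys_iff)
    then show ?thesis by auto
  qed
  ultimately show ?thesis
    by (rule inj_on_finite) (rule finite_lists_length_eq, simp)
qed

definition sq :: "nat \<Rightarrow> f2poly \<Rightarrow> f2poly" where
  "sq i = lext (\<lambda>a. \<Sum>b\<in>sqexp i a. mon b)"

lemma sq_zero [simp]: "sq i 0 = 0" by (simp add: sq_def)
lemma sq_add: "sq i (u + v) = sq i u + sq i v" by (simp add: sq_def lext_add)
lemma sq_mon: "sq i (mon a) = (\<Sum>b\<in>sqexp i a. mon b)" by (simp add: sq_def)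
lemma sq_sum: "sq i (\<Sum>j\<in>I. f j) = (\<Sum>j\<in>I. sq i (f j))"
  by (induction I rule: infinite_finite_induct) (auto simp: sq_add)

definition x :: "nat \<Rightarrow> f2poly" where "x l = mon (Poly_Mapping.single l 1)"

lemma mon_mult: "mon a * mon b = (mon (a + b) :: f2poly)"
  by (simp add: mult_single)

lemma x_mon: "x l * mon a = mon (Poly_Mapping.single l 1 + a)"
  by (simp add: x_def mon_mult)

lemma sqexp_zero: "sqexp 0 a = {a}"
proof -
  have "b = a" if "b \<in> sqexp 0 a" for b
  proof -
    have le: "lookup a j \<le> lookup b j" for j using that by (auto simp: sqexp_def)
    have k: "keys b = keys a" using that by (rule sqexp_keys)
    have "(\<Sum>j\<in>keys a. lookup b j) = (\<Sum>j\<in>keys a. lookup a j)"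
      using that k by (simp add: sqexp_def dg_def)
    then have "\<forall>j\<in>keys a. lookup b j = lookup a j"
      by (metis (mono_tags, lifting) finite_keys le sum_mono_inv)
    then show ?thesis using k by (metis in_keys_iff poly_mapping_eqI)
  qed
  moreover have "a \<in> sqexp 0 a" by (auto simp: sqexp_def)
  ultimately show ?thesis by auto
qed

lemma sq_0 [simp]: "sq 0 v = v"
  by (induction v rule: f2_induct) (auto simp: sq_add sq_mon sqexp_zero)

lemma sq_one: "0 < i \<Longrightarrow> sq i 1 = 0"
proof -
  assume i: "0 < i"
  have "sqexp i 0 = {}"
  proof -
    have False if "b \<in> sqexp i 0" for b
    proof -
      have "keys b = {}" using sqexp_keys[OF that] by simp
      then have "dg b = 0" by (simp add: dg_def)
      with that i show False by (simp add: sqexp_def)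
    qed
    then show ?thesis by auto
  qed
  then show ?thesis using sq_mon[of i 0] by simp
qed

text \<open>Pascal's rule modulo 2 in the variable \<open>l\<close>: binom(a + 1, c) is odd iff
  exactly one of binom(a, c) and binom(a, c - 1) is odd. The symmetric difference is the sum over
  the two-element field.\<close>

lemma sqexp_x_split:
  fixes a l defines "e \<equiv> Poly_Mapping.single l (1::nat)"
  shows "sqexp (Suc i) (e + a) =
    (((+) e ` sqexp (Suc i) a) - ((+) (e + e) ` sqexp i a)) \<union> (((+) (e + e) ` sqexp i a) - ((+) e ` sqexp (Suc i) a))"
    (is "?L = (?A - ?B) \<union> (?B - ?A)")
proof -
  have le: "lookup e j = (if j = l then 1 else 0)" for j
    by (auto simp: e_def lookup_single)
  have dge: "dg e = 1" by (simp add: e_def)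
  have sp: "(\<forall>j. R j) \<longleftrightarrow> R l \<and> (\<forall>j. j \<noteq> l \<longrightarrow> R j)" for R :: "nat \<Rightarrow> bool" by metis
  have key: "b \<in> ?L \<longleftrightarrow> (b \<in> ?A) \<noteq> (b \<in> ?B)" for b
  proof (cases "lookup b l > lookup a l")
    case False
    have "b \<notin> ?L" "b \<notin> ?A" "b \<notin> ?B"
      using False by (auto simp: sqexp_def lookup_add le dest!: spec[of _ l])
    then show ?thesis by simp
  next
    case True
    define c where "c = lookup b l - lookup a l - 1"
    have bc: "lookup b l = lookup a l + 1 + c" using True by (simp add: c_def)
    define b1 where "b1 = b - e"
    have b1: "b = e + b1"
      unfolding b1_def by (rule poly_mapping_eqI) (use True in \<open>auto simp: lookup_add lookup_minus le\<close>)
    have lb1: "lookup b j = lookup b1 j + (if j = l then 1 else 0)" for j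
      by (subst b1) (simp add: lookup_add le)
    have lb1l: "lookup b1 l = lookup a l + c" using lb1[of l] bc by simp
    define Q where "Q \<longleftrightarrow> (\<forall>j. j \<noteq> l \<longrightarrow> lookup a j \<le> lookup b j \<and> odd (lookup a j choose (lookup b j - lookup a j))) \<and> dg b = dg a + Suc (Suc i)"
    have L: "b \<in> ?L \<longleftrightarrow> Q \<and> odd (Suc (lookup a l) choose c)"
    proof -
      have "b \<in> ?L \<longleftrightarrow> (\<forall>j. lookup (e+a) j \<le> lookup b j \<and> odd (lookup (e+a) j choose (lookup b j - lookup (e+a) j))) \<and> dg b = Suc (Suc (dg a + i))"
        by (simp add: sqexp_def dge)
      also have "\<dots> \<longleftrightarrow> Q \<and> odd (Suc (lookup a l) choose c)"
        unfolding Q_def by (auto simp: lookup_add le bc split: if_splits)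
      finally show ?thesis .
    qed
    have A: "b \<in> ?A \<longleftrightarrow> Q \<and> odd (lookup a l choose c)"
    proof -
      have "b \<in> ?A \<longleftrightarrow> b1 \<in> sqexp (Suc i) a" using b1 by auto
      also have "\<dots> \<longleftrightarrow> (\<forall>j. lookup a j \<le> lookup b1 j \<and> odd (lookup a j choose (lookup b1 j - lookup a j))) \<and> dg b = Suc (Suc (dg a + i))"
        using arg_cong[OF b1, of dg] dge by (simp add: sqexp_def)
      also have "\<dots> \<longleftrightarrow> Q \<and> odd (lookup a l choose c)"
        unfolding Q_def sp[where R = "\<lambda>j. lookup a j \<le> lookup b1 j \<and> odd (lookup a j choose (lookup b1 j - lookup a j))"]
        by (auto simp: lb1 lb1l)
      finally show ?thesis .
    qed
    have B: "b \<in> ?B \<longleftrightarrow> c > 0 \<and> Q \<and> odd (lookup a l choose (c - 1))"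
    proof (cases "c > 0")
      case False
      then have "b \<notin> ?B" using bc by (auto simp: sqexp_def lookup_add le dest!: spec[of _ l])
      with False show ?thesis by simp
    next
      case c: True
      define b2 where "b2 = b1 - e"
      have b2: "b1 = e + b2"
        unfolding b2_def by (rule poly_mapping_eqI) (use c lb1l in \<open>auto simp: lookup_add lookup_minus le\<close>)
      have lb2: "lookup b j = lookup b2 j + (if j = l then 2 else 0)" for j
        unfolding lb1 by (subst b2) (simp add: lookup_add le)
      have lb2l: "lookup b2 l = lookup a l + (c - 1)" using lb2[of l] bc c by simp
      have bb: "b = (e + e) + b2" using b1 b2 by (simp add: add.assoc)
      have "b \<in> ?B \<longleftrightarrow> b2 \<in> sqexp i a" using bb by auto
      also have "\<dots> \<longleftrightarrow> (\<forall>j. lookup a j \<le> lookup b2 j \<and> odd (lookup a j choose (lookup b2 j - lookup a j))) \<and> dg b = Suc (Suc (dg a + i))"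
        using arg_cong[OF bb, of dg] dge by (simp add: sqexp_def)
      also have "\<dots> \<longleftrightarrow> Q \<and> odd (lookup a l choose (c - 1))"
        unfolding Q_def sp[where R = "\<lambda>j. lookup a j \<le> lookup b2 j \<and> odd (lookup a j choose (lookup b2 j - lookup a j))"]
        by (auto simp: lb2 lb2l)
      finally show ?thesis using c by simp
    qed
    show ?thesis unfolding L A B by (cases c) auto
  qed
  then show ?thesis by blast
qed

lemma sq_x: "sq (Suc i) (x l * v) = x l * sq (Suc i) v + (x l)^2 * sq i v"
proof (induction v rule: f2_induct)
  case (add a v)
  define e where "e = Poly_Mapping.single l (1::nat)"
  have inj: "inj_on ((+) c) A" for c :: "nat \<Rightarrow>\<^sub>0 nat" and A by (auto simp: inj_on_def)
  have "sq (Suc i) (x l * mon a) = (\<Sum>b\<in>sqexp (Suc i) (e + a). mon b)"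
    by (simp add: x_mon sq_mon e_def)
  also have "\<dots> = (\<Sum>b\<in>(+) e ` sqexp (Suc i) a. mon b) + (\<Sum>b\<in>(+) (e + e) ` sqexp i a. mon b)"
    unfolding e_def sqexp_x_split by (intro sum_sym_diff) auto
  also have "(\<Sum>b\<in>(+) e ` sqexp (Suc i) a. mon b) = x l * sq (Suc i) (mon a)"
    by (simp add: sum.reindex[OF inj] sq_mon sum_distrib_left x_def e_def mon_mult)
  also have "(\<Sum>b\<in>(+) (e + e) ` sqexp i a. mon b) = (x l)^2 * sq i (mon a)"
    by (simp add: sum.reindex[OF inj] sq_mon sum_distrib_left x_def e_def mon_mult power2_eq_square)
  finally show ?case using add by (simp add: sq_add distrib_left algebra_simps)
qed simp

text \<open>The total square of x^(2^u) is x^(2^u) + x^(2^(u+1)): when the power is doubled by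
  multiplying it with itself, the two cross terms cancel in characteristic two.\<close>

lemma sq_x_power:
  "sq i (x l ^ (2 ^ u) * v) = x l ^ (2 ^ u) * sq i v + (if 2 ^ u \<le> i then x l ^ (2 ^ Suc u) * sq (i - 2 ^ u) v else 0)"
proof (induction u arbitrary: i v)
  case 0
  then show ?case by (cases i) (auto simp: sq_x)
next
  case (Suc u)
  let ?y = "x l ^ (2 ^ u)"
  have yy: "x l ^ (2 ^ Suc u) = ?y * ?y" by (simp add: power_add[symmetric] mult_2)
  have y4: "x l ^ (2 ^ Suc (Suc u)) = ?y * ?y * (?y * ?y)" by (simp add: power_add[symmetric] mult_2)
  have *: "sq i (?y * w) = ?y * sq i w + (if 2 ^ u \<le> i then ?y * ?y * sq (i - 2 ^ u) w else 0)" for i w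
    using Suc[of i w] unfolding yy .
  have "sq i (x l ^ (2 ^ Suc u) * v) = sq i (?y * (?y * v))" by (simp only: yy mult.assoc)
  also have "\<dots> = ?y * ?y * sq i v + (if 2 ^ Suc u \<le> i then ?y * ?y * (?y * ?y) * sq (i - 2 ^ Suc u) v else 0)"
    unfolding * by (auto simp: distrib_left mult.assoc ac_simps mult_2)
  finally show ?case unfolding yy y4 .
qed

lemma exp_induct [case_names zero add]:
  assumes "P 0" "\<And>l a. P a \<Longrightarrow> P (Poly_Mapping.single l (1::nat) + a)"
  shows "P (a :: nat \<Rightarrow>\<^sub>0 nat)"
proof (induction "dg a" arbitrary: a)
  case 0
  then have "lookup a j = 0" for j by (cases "j \<in> keys a") (auto simp: dg_def in_keys_iff)
  then have "a = 0" by (intro poly_mapping_eqI) simp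
  then show ?case using assms(1) by simp
next
  case (Suc n)
  then have "keys a \<noteq> {}" by (auto simp: dg_def)
  then obtain l where l: "l \<in> keys a" by blast
  define b where "b = a - Poly_Mapping.single l 1"
  have a: "a = Poly_Mapping.single l 1 + b"
    unfolding b_def using l
    by (intro poly_mapping_eqI) (auto simp: lookup_add lookup_minus lookup_single when_def in_keys_iff)
  have "dg a = Suc (dg b)" using arg_cong[OF a, of dg] by simp
  then have "P b" using Suc(1)[of b] Suc(2) by linarith
  then show ?case by (subst a) (rule assms(2))
qed

text \<open>The total square is a ring homomorphism, hence commutes with squaring. This doubles the
  indices of squares, and the vanishing of the odd ones later makes second coordinates of hit pairs
  zero.\<close>

lemma sq_square: "sq i (v^2) = (if even i then (sq (i div 2) v)^2 else 0)"
proof (induction v rule: f2_induct)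
  case zero
  then show ?case by simp
next
  case (add a v)
  have "sq i ((mon a)^2) = (if even i then (sq (i div 2) (mon a))^2 else 0)"
  proof (induction a arbitrary: i rule: exp_induct)
    case zero
    then show ?case by (cases "i = 0") (auto simp: sq_one)
  next
    case (add l a)
    have "sq i ((x l * mon a)^2) = sq i (x l ^ 2 ^ 1 * (mon a)^2)" by (simp add: power_mult_distrib)
    also have "\<dots> = (x l)^2 * sq i ((mon a)^2) + (if 2 \<le> i then (x l)^4 * sq (i - 2) ((mon a)^2) else 0)"
      by (subst sq_x_power) simp
    also have "\<dots> = (if even i then (sq (i div 2) (x l * mon a))^2 else 0)"
    proof (cases "even i")
      case False then show ?thesis using add by auto
    next
      case True
      then obtain j where j: "i = 2 * j" by blast
      show ?thesis unfolding j add
        by (cases j) (auto simp: sq_x f2_square_add power_mult_distrib)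
    qed
    finally show ?case by (simp only: x_mon)
  qed
  then show ?case using add by (auto simp: f2_square_add sq_add)
qed

section \<open>Homogeneous polynomials in k variables and instability of the squares\<close>

definition hom :: "nat \<Rightarrow> nat \<Rightarrow> f2poly set" where
  "hom k d = {v. \<forall>a\<in>keys v. keys a \<subseteq> {..<k} \<and> dg a = d}"

lemma hom_zero [simp]: "0 \<in> hom k d" by (simp add: hom_def)
lemma hom_add: "u \<in> hom k d \<Longrightarrow> v \<in> hom k d \<Longrightarrow> u + v \<in> hom k d"
  unfolding hom_def mem_Collect_eq keys_f2_add by blast
lemma hom_sum: "(\<And>i. i \<in> I \<Longrightarrow> f i \<in> hom k d) \<Longrightarrow> sum f I \<in> hom k d"
  by (induction I rule: infinite_finite_induct) (auto intro: hom_add)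
lemma hom_mon [simp]: "mon a \<in> hom k d \<longleftrightarrow> keys a \<subseteq> {..<k} \<and> dg a = d"
  by (auto simp: hom_def)
lemma hom_mult: "u \<in> hom k d \<Longrightarrow> v \<in> hom k e \<Longrightarrow> u * v \<in> hom k (d + e)"
proof -
  assume u: "u \<in> hom k d" and v: "v \<in> hom k e"
  show ?thesis
    unfolding hom_def mem_Collect_eq
  proof
    fix a assume "a \<in> keys (u * v)"
    then obtain b c where bc: "a = b + c" "b \<in> keys u" "c \<in> keys v"
      using keys_mult[of u v] by (auto simp: subset_iff)
    have "keys b \<subseteq> {..<k} \<and> dg b = d" "keys c \<subseteq> {..<k} \<and> dg c = e"
      using u v bc(2,3) by (auto simp only: hom_def mem_Collect_eq)
    moreover have "keys a \<subseteq> keys b \<union> keys c" unfolding bc(1) by (rule keys_add)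
    moreover have "dg a = dg b + dg c" unfolding bc(1) by simp
    ultimately show "keys a \<subseteq> {..<k} \<and> dg a = d + e" by auto
  qed
qed
lemma hom_one [simp]: "1 \<in> hom k 0" by (simp add: hom_def)
lemma hom_power: "u \<in> hom k d \<Longrightarrow> u ^ n \<in> hom k (n * d)"
  by (induction n) (auto dest: hom_mult)
lemma hom_x [simp]: "l < k \<Longrightarrow> x l \<in> hom k 1" by (simp add: x_def)
lemma hom_expand:
  assumes "v \<in> hom k d" shows "v \<in> aspan {mon a |a. keys a \<subseteq> {..<k} \<and> dg a = d}"
proof (subst f2_expand, rule aspan_sum)
  fix a assume "a \<in> keys v"
  with assms show "mon a \<in> aspan {mon a |a. keys a \<subseteq> {..<k} \<and> dg a = d}"
    by (intro aspan_base) (auto simp: hom_def)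
qed

lemma hom_sq:
  assumes "v \<in> hom k d" shows "sq i v \<in> hom k (d + i)"
  using hom_expand[OF assms]
proof induction
  case (aspan_step s v)
  then obtain a where a: "s = mon a" "keys a \<subseteq> {..<k}" "dg a = d" by auto
  have "mon b \<in> hom k (d + i)" if "b \<in> sqexp i a" for b
    using that a sqexp_keys[OF that] by (auto simp: sqexp_def)
  then have "sq i s \<in> hom k (d + i)" unfolding a(1) sq_mon by (intro hom_sum)
  then show ?case using aspan_step by (simp add: sq_add hom_add)
qed simp

lemma sq_top: assumes "v \<in> hom k d" shows "sq d v = v^2"
proof -
  \<comment> \<open>Vanishing above the degree has to be carried along: multiplication by
    \<open>x l\<close> at the top index brings in the square of \<open>mon a\<close> one step beyond
    the degree of \<open>a\<close>.\<close>
  have *: "sq (dg a) (mon a) = (mon a)^2 \<and> (\<forall>i>dg a. sq i (mon a) = 0)" for a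
  proof (induction a rule: exp_induct)
    case zero
    then show ?case by (auto simp: sq_one)
  next
    case (add l a)
    have "sq i (x l * mon a) = 0" if i: "i > Suc (dg a)" for i
    proof -
      obtain j where "i = Suc j" "j > dg a" using i by (metis Suc_lessE)
      then show ?thesis using add by (simp add: sq_x)
    qed
    moreover have "sq (Suc (dg a)) (x l * mon a) = (x l * mon a)^2"
      using add by (simp add: sq_x power_mult_distrib)
    ultimately have "sq (Suc (dg a)) (x l * mon a) = (x l * mon a)^2 \<and> (\<forall>i>Suc (dg a). sq i (x l * mon a) = 0)"
      by blast
    then show ?case by (simp add: x_mon)
  qed
  show ?thesis
    using hom_expand[OF assms]
    by (induction v rule: aspan.induct) (auto simp: sq_add f2_square_add *)
qed

lemma f2_power_add: "((v::f2poly) + w) ^ (2 ^ m) = v ^ (2 ^ m) + w ^ (2 ^ m)"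
proof (induction m)
  case (Suc m)
  have p: "u ^ (2 ^ Suc m) = (u ^ (2 ^ m))^2" for u :: f2poly by (simp add: power_mult[symmetric] mult.commute)
  show ?case unfolding p Suc f2_square_add ..
qed simp

text \<open>On a 2^m-th power the first positive square that can be nonzero has index 2^m. Thus an
  element of A(d0 - 1)^+ P_k stays hit after multiplication by any
  \<open>g ^ (2 ^ d0)\<close>.\<close>

lemma sq_mult_power: "i < 2 ^ m \<Longrightarrow> sq i (h * g ^ (2 ^ m)) = sq i h * g ^ (2 ^ m)"
proof (induction g rule: f2_induct)
  case zero
  then show ?case by (simp add: power_0_left)
next
  case (add a v)
  have "sq i (h * mon a ^ (2 ^ m)) = sq i h * mon a ^ (2 ^ m)"
  proof (induction a rule: exp_induct)
    case (add l a)
    have "sq i (h * (x l * mon a) ^ (2 ^ m)) = sq i (x l ^ (2 ^ m) * (h * mon a ^ (2 ^ m)))"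
      by (simp add: power_mult_distrib ac_simps)
    also have "\<dots> = sq i h * (x l * mon a) ^ (2 ^ m)"
      unfolding sq_x_power using add \<open>i < 2 ^ m\<close> by (simp add: power_mult_distrib ac_simps)
    finally show ?case by (simp only: x_mon)
  qed simp
  then show ?case using add by (simp add: f2_power_add distrib_left sq_add)
qed

section \<open>Conjugate squares\<close>

lemma pow2_le_pos: "2 ^ u \<le> (i::nat) \<Longrightarrow> 0 < i"
  by (rule order.strict_trans2[of _ "2 ^ u"]) simp_all

text \<open>
  conj_sq L i v is chi(Sq^i)(p) v, where p is the product of the x_l^(2^u) with (l,u) in L: the
  conjugate total square maps a variable y to the sum of all y^(2^u).
\<close>

function conj_sq :: "(nat \<times> nat) list \<Rightarrow> nat \<Rightarrow> f2poly \<Rightarrow> f2poly" where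
  "conj_sq [] i v = (if i = 0 then v else 0)"
| "conj_sq ((l,u) # L) i v = x l ^ (2 ^ u) * conj_sq L i v +
     (if 2 ^ u \<le> i then conj_sq ((l, Suc u) # L) (i - 2 ^ u) v else 0)"
  by pat_completeness auto
termination
  by (relation "measures [\<lambda>(L,i,v). length L, \<lambda>(L,i,v). i]") 
    (auto intro!: diff_less dest: pow2_le_pos)

declare conj_sq.simps(2) [simp del]

definition xpows :: "(nat \<times> nat) list \<Rightarrow> f2poly" where
  "xpows L = prod_list (map (\<lambda>(l,u). x l ^ (2 ^ u)) L)"

text \<open>Formally Sq(chi(Sq)(p) v) = Sq(chi(Sq)(p)) Sq(v) = p Sq(v). One factor is added at a
  time, and within a factor y = x^(2^u) the recursion chi(y) = y + chi(y^2) is followed.\<close>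

lemma conj_sq_identity: "xpows L * sq i v = (\<Sum>a\<le>i. sq a (conj_sq L (i - a) v))"
proof (induction "length L" arbitrary: L i)
  case 0
  then have "(\<Sum>a\<le>i. sq a (conj_sq L (i - a) v)) = (\<Sum>a\<le>i. if a = i then sq i v else 0)"
    by (intro sum.cong) auto
  then show ?case using 0 by (simp add: xpows_def)
next
  case (Suc n)
  obtain l L' where L: "\<exists>u. L = (l,u) # L'" and len: "length L' = n"
    using Suc(2) by (cases L) auto
  have IH: "xpows L' * sq i v = (\<Sum>a\<le>i. sq a (conj_sq L' (i - a) v))" for i
    using Suc(1) len by blast
  have "xpows ((l,u) # L') * sq i v = (\<Sum>a\<le>i. sq a (conj_sq ((l,u) # L') (i - a) v))" for u
  proof (induction i arbitrary: u rule: less_induct)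
    case (less i)
    let ?y = "x l ^ (2 ^ u)" and ?z = "x l ^ (2 ^ Suc u)"
    have 1: "(\<Sum>a\<le>i. sq a (?y * conj_sq L' (i - a) v)) = ?y * (xpows L' * sq i v) +
       (if 2 ^ u \<le> i then ?z * (xpows L' * sq (i - 2 ^ u) v) else 0)"
    proof -
      have "(\<Sum>a\<le>i. sq a (?y * conj_sq L' (i - a) v)) =
         (\<Sum>a\<le>i. ?y * sq a (conj_sq L' (i - a) v)) + (\<Sum>a\<le>i. if 2 ^ u \<le> a then ?z * sq (a - 2 ^ u) (conj_sq L' (i - a) v) else 0)"
        by (simp add: sq_x_power sum.distrib)
      also have "(\<Sum>a\<le>i. if 2 ^ u \<le> a then ?z * sq (a - 2 ^ u) (conj_sq L' (i - a) v) else 0) =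
         (if 2 ^ u \<le> i then ?z * (xpows L' * sq (i - 2 ^ u) v) else 0)"
      proof (cases "2 ^ u \<le> i")
        case True
        have "(\<Sum>a\<le>i. if 2 ^ u \<le> a then ?z * sq (a - 2 ^ u) (conj_sq L' (i - a) v) else 0) =
          (\<Sum>a\<in>{2 ^ u..i}. ?z * sq (a - 2 ^ u) (conj_sq L' (i - a) v))"
          by (simp flip: sum.inter_filter add: Collect_conj_eq) (rule sum.cong, auto)
        also have "\<dots> = (\<Sum>a\<le>i - 2 ^ u. ?z * sq a (conj_sq L' (i - 2 ^ u - a) v))"
          by (rule sum.reindex_bij_witness[of _ "\<lambda>a. a + 2 ^ u" "\<lambda>a. a - 2 ^ u"]) (use True in auto)
        finally show ?thesis using True by (simp add: IH sum_distrib_left)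
      next
        case False
        then show ?thesis by (auto intro!: sum.neutral)
      qed
      finally show ?thesis by (simp add: IH sum_distrib_left)
    qed
    have 2: "(\<Sum>a\<le>i. sq a (if 2 ^ u \<le> i - a then conj_sq ((l, Suc u) # L') (i - a - 2 ^ u) v else 0)) =
       (if 2 ^ u \<le> i then ?z * (xpows L' * sq (i - 2 ^ u) v) else 0)"
    proof (cases "2 ^ u \<le> i")
      case True
      have "(\<Sum>a\<le>i. sq a (if 2 ^ u \<le> i - a then conj_sq ((l, Suc u) # L') (i - a - 2 ^ u) v else 0)) =
        (\<Sum>a\<le>i - 2 ^ u. sq a (if 2 ^ u \<le> i - a then conj_sq ((l, Suc u) # L') (i - a - 2 ^ u) v else 0))"
        using True by (intro sum.mono_neutral_right) auto
      also have "\<dots> = (\<Sum>a\<le>i - 2 ^ u. sq a (conj_sq ((l, Suc u) # L') (i - 2 ^ u - a) v))"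
        using True by (intro sum.cong) (auto simp: add.commute)
      also have "\<dots> = xpows ((l, Suc u) # L') * sq (i - 2 ^ u) v"
        using less(1)[of "i - 2 ^ u" "Suc u"] True pow2_le_pos[OF True] by (simp add: diff_less)
      finally show ?thesis using True by (simp add: xpows_def mult.assoc)
    next
      case False
      then show ?thesis by (auto intro!: sum.neutral)
    qed
    have "(\<Sum>a\<le>i. sq a (conj_sq ((l,u) # L') (i - a) v)) =
       (\<Sum>a\<le>i. sq a (?y * conj_sq L' (i - a) v)) +
       (\<Sum>a\<le>i. sq a (if 2 ^ u \<le> i - a then conj_sq ((l, Suc u) # L') (i - a - 2 ^ u) v else 0))"
      by (subst conj_sq.simps) (simp add: sq_add sum.distrib)
    also have "\<dots> = ?y * (xpows L' * sq i v)"
      unfolding 1 2 by (simp add: add.assoc)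
    finally show ?case by (simp add: xpows_def mult.assoc)
  qed
  then show ?case using L by auto
qed

lemma conj_sq_zero [simp]: "conj_sq L i 0 = 0"
proof -
  have "v = 0 \<Longrightarrow> conj_sq L i v = 0" for v
    by (induction L i v rule: conj_sq.induct) (auto simp: conj_sq.simps(2))
  then show ?thesis by simp
qed

text \<open>Zero summands 2^0 - 1 are allowed, so the predicate is monotone in r.\<close>

definition rep :: "nat \<Rightarrow> nat \<Rightarrow> bool" where
  "rep n r \<longleftrightarrow> (\<exists>us. length us = r \<and> n + r = sum_list (map (\<lambda>u. 2 ^ u) us))"

text \<open>Each summand of chi(Sq^i) on the product replaces every factor x^(2^u) by a 2-power of
  the same variable with at least this exponent; comparing degrees gives the sum of powers of
  two.\<close>

lemma conj_sq_nonzero: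
  "conj_sq L i v \<noteq> 0 \<Longrightarrow> \<exists>us. length us = length L \<and> i + sum_list (map (\<lambda>(l,u). 2 ^ u) L) = sum_list (map (\<lambda>u. 2 ^ u) us)"
proof (induction L i v rule: conj_sq.induct)
  case (1 i v)
  then show ?case by (auto split: if_splits)
next
  case (2 l u L i v)
  show ?case
  proof (cases "conj_sq L i v = 0")
    case False
    then obtain us where "length us = length L" "i + sum_list (map (\<lambda>(l,u). 2 ^ u) L) = sum_list (map (\<lambda>u. 2 ^ u) us)"
      using 2(1) by blast
    then show ?thesis by (intro exI[of _ "u # us"]) auto
  next
    case True
    have "2 ^ u \<le> i \<and> conj_sq ((l, Suc u) # L) (i - 2 ^ u) v \<noteq> 0"
      using 2(3) unfolding conj_sq.simps(2)[of l u] True by (auto split: if_splits)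
    then have "2 ^ u \<le> i" "conj_sq ((l, Suc u) # L) (i - 2 ^ u) v \<noteq> 0" by auto
    then obtain us where "length us = length ((l, Suc u) # L)" "i - 2 ^ u + sum_list (map (\<lambda>(l,u). 2 ^ u) ((l, Suc u) # L)) = sum_list (map (\<lambda>u. 2 ^ u) us)"
      using 2(2) by blast
    then show ?thesis using \<open>2 ^ u \<le> i\<close> by (intro exI[of _ us]) auto
  qed
qed

section \<open>Conjugate squares on products of variables\<close>

abbreviation lin :: "nat list \<Rightarrow> (nat \<times> nat) list" where "lin L \<equiv> map (\<lambda>l. (l, 0)) L"
definition xl :: "nat list \<Rightarrow> f2poly" where "xl L = prod_list (map x L)"

lemma xl_Nil [simp]: "xl [] = 1" by (simp add: xl_def)
lemma xl_Cons [simp]: "xl (l # L) = x l * xl L" by (simp add: xl_def)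
lemma xpows_lin: "xpows (lin L) = xl L" by (induction L) (auto simp: xpows_def)

lemma conj_sq_rep: "conj_sq (lin L) i v \<noteq> 0 \<Longrightarrow> rep i (length L)"
  by (drule conj_sq_nonzero) (auto simp: rep_def o_def sum_list_triv)

lemma hom_xl: "set L \<subseteq> {..<k} \<Longrightarrow> xl L \<in> hom k (length L)"
  by (induction L) (auto dest: hom_mult[OF hom_x])

lemma hom_conj_sq: "v \<in> hom k d \<Longrightarrow> fst ` set L \<subseteq> {..<k} \<Longrightarrow> e = d + i + sum_list (map (\<lambda>(l,u). 2 ^ u) L)
   \<Longrightarrow> conj_sq L i v \<in> hom k e"
proof (induction L i v arbitrary: e rule: conj_sq.induct)
  case (1 i v)
  then show ?case by auto
next
  case (2 l u L i v)
  have "x l ^ (2 ^ u) * conj_sq L i v \<in> hom k (2 ^ u * 1 + (d + i + sum_list (map (\<lambda>(l,u). 2 ^ u) L)))"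
    by (intro hom_mult hom_power hom_x 2(1)) (use 2 in auto)
  moreover have "conj_sq ((l, Suc u) # L) (i - 2 ^ u) v \<in> hom k e" if "2 ^ u \<le> i"
    by (rule 2(2)) (use 2 that in auto)
  ultimately show ?case using 2(5) by (subst conj_sq.simps) (auto intro!: hom_add simp: ac_simps)
qed

fun splits :: "'a list \<Rightarrow> ('a list \<times> 'a list) list" where
  "splits [] = [([], [])]"
| "splits (l # L) = map (\<lambda>(E, Z). (E, l # Z)) (splits L) @ map (\<lambda>(E, Z). (l # E, Z)) (splits L)"

lemma splits_length: "(E, Z) \<in> set (splits L) \<Longrightarrow> length E + length Z = length L"
  by (induction L arbitrary: E Z) auto
lemma splits_set: "(E, Z) \<in> set (splits L) \<Longrightarrow> set E \<union> set Z \<subseteq> set L"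
  by (induction L arbitrary: E Z) fastforce+

definition half_if :: "nat \<Rightarrow> nat \<Rightarrow> (nat \<Rightarrow> f2poly) \<Rightarrow> f2poly" where
  "half_if c i G = (if c \<le> i \<and> even (i - c) then (G ((i - c) div 2))^2 else 0)"

text \<open>For one variable chi(Sq)(x) = x + (chi(Sq)(x))^2. When the product over \<open>L\<close>
  is expanded, \<open>Z\<close> collects the variables that contribute x and \<open>E\<close> those
  that contribute the square. Of the index \<open>i\<close>, the variables of \<open>E\<close> use
  up \<open>length E\<close>, and half of the rest is the index inside the square.\<close>

lemma conj_sq_square:
  "conj_sq (lin L) i (h^2) = (\<Sum>(E,Z)\<leftarrow>splits L. xl Z * half_if (length E) i (\<lambda>j. conj_sq (lin E) j h))"
proof (induction L arbitrary: i)
  case Nil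
  then show ?case by (auto simp: half_if_def)
next
  case (Cons l L)
  \<comment> \<open>If the leading factor is already the square x^(2^(u+1)), it always belongs to
    the squared part, so only the remaining list is split.\<close>
  have *: "conj_sq ((l, Suc u) # lin L) i (h^2) =
     (\<Sum>(E,Z)\<leftarrow>splits L. xl Z * half_if (length E) i (\<lambda>j. conj_sq ((l,u) # lin E) j h))" for i u
  proof (induction i arbitrary: u rule: less_induct)
    case (less i)
    have split: "half_if c i (\<lambda>j. conj_sq ((l,u) # lin E) j h) = x l ^ (2 ^ Suc u) * half_if c i (\<lambda>j. conj_sq (lin E) j h) +
       (if 2 ^ Suc u \<le> i then half_if c (i - 2 ^ Suc u) (\<lambda>j. conj_sq ((l,Suc u) # lin E) j h) else 0)" for c E
    proof (cases "c \<le> i \<and> even (i - c)")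
      case False
      then have "\<not> (2 ^ Suc u \<le> i \<and> c \<le> i - 2 ^ Suc u \<and> even (i - 2 ^ Suc u - c))" by auto
      then show ?thesis using False by (auto simp: half_if_def)
    next
      case True
      then obtain m where m: "i = c + 2 * m" by (metis evenE le_add_diff_inverse)
      have "2 ^ Suc u \<le> i \<and> c \<le> i - 2 ^ Suc u \<and> even (i - 2 ^ Suc u - c) \<longleftrightarrow> 2 ^ u \<le> m"
        unfolding m by auto
      moreover have "(i - 2 ^ Suc u - c) div 2 = m - 2 ^ u" unfolding m by simp
      moreover have "(x l ^ 2 ^ u)\<^sup>2 = x l ^ (2 ^ Suc u)" by (simp add: power_mult[symmetric] mult.commute)
      ultimately show ?thesis using True
        by (subst conj_sq.simps) (auto simp: half_if_def m f2_square_add power_mult_distrib simp del: power_Suc)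
    qed
    have "conj_sq ((l, Suc u) # lin L) i (h^2) = x l ^ (2 ^ Suc u) * conj_sq (lin L) i (h^2) +
      (if 2 ^ Suc u \<le> i then conj_sq ((l, Suc (Suc u)) # lin L) (i - 2 ^ Suc u) (h^2) else 0)" by (rule conj_sq.simps)
    also have "\<dots> = (\<Sum>(E,Z)\<leftarrow>splits L. xl Z * half_if (length E) i (\<lambda>j. conj_sq ((l,u) # lin E) j h))"
    proof (cases "2 ^ Suc u \<le> i")
      case True
      then have "conj_sq ((l, Suc (Suc u)) # lin L) (i - 2 ^ Suc u) (h^2) =
        (\<Sum>(E,Z)\<leftarrow>splits L. xl Z * half_if (length E) (i - 2 ^ Suc u) (\<lambda>j. conj_sq ((l,Suc u) # lin E) j h))"
        using pow2_le_pos[OF True] by (intro less) simp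
      then show ?thesis using True unfolding split Cons
        by (simp add: sum_list_const_mult[symmetric] sum_list_addf[symmetric] case_prod_unfold distrib_left mult.left_commute del: power_Suc)
    next
      case False
      then show ?thesis unfolding split Cons
        by (simp add: sum_list_const_mult[symmetric] case_prod_unfold mult.left_commute del: power_Suc)
    qed
    finally show ?case .
  qed
  have h1: "half_if (Suc c) i G = (if 1 \<le> i then half_if c (i - 1) G else 0)" for c G
    by (auto simp: half_if_def)
  show ?case
    using *[of 0 "i - 1"] conj_sq.simps(2)[of l 0 "lin L" i "h^2"]
    by (auto simp: Cons h1 case_prod_unfold o_def sum_list_const_mult[symmetric] mult.assoc)
qed

section \<open>Hit polynomials\<close>

definition hits :: "nat \<Rightarrow> nat \<Rightarrow> f2poly set" where
  "hits k N = aspan {sq i f | i f m. 0 < i \<and> f \<in> hom k m \<and> m + i = N}"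

text \<open>
  For a new variable w, Sq^(i+1) (w f) = w Sq^(i+1) f + w^2 Sq^i f: a pair holds the coefficients
  of w and w^2.
\<close>

definition hit_pairs :: "nat \<Rightarrow> nat \<Rightarrow> (f2poly \<times> f2poly) set" where
  "hit_pairs k N = aspan {(sq (Suc i) f, sq i f) | i f m. f \<in> hom k m \<and> m + Suc i = N}"

text \<open>Remainders of the chi-trick. The list \<open>Z\<close> may repeat variables; a
  repetition can only lower the number of odd exponents, see \<open>xl_square_ml\<close>.\<close>

definition lows :: "nat \<Rightarrow> nat \<Rightarrow> nat \<Rightarrow> f2poly set" where
  "lows k c N = aspan {xl Z * F^2 | Z F d. set Z \<subseteq> {..<k} \<and> length Z < c \<and> F \<in> hom k d \<and> length Z + 2 * d = N}"

lemma hits_zero [simp]: "0 \<in> hits k N" by (simp add: hits_def aspan_zero)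
lemma hits_add: "u \<in> hits k N \<Longrightarrow> v \<in> hits k N \<Longrightarrow> u + v \<in> hits k N"
  unfolding hits_def by (rule aspan_add)
lemma hits_sum_list: "(\<And>i. i \<in> set xs \<Longrightarrow> f i \<in> hits k N) \<Longrightarrow> sum_list (map f xs) \<in> hits k N"
  unfolding hits_def by (rule aspan_sum_list)
lemma hits_cancel: "u + v \<in> hits k N \<Longrightarrow> v \<in> hits k N \<Longrightarrow> u \<in> hits k N"
  using hits_add[of "u + v" k N v] by (simp add: add.assoc)
lemma hits_sq: "0 < i \<Longrightarrow> f \<in> hom k m \<Longrightarrow> m + i = N \<Longrightarrow> sq i f \<in> hits k N"
  unfolding hits_def by (rule aspan_base) blast

lemma hit_pairs_fst: "p \<in> hit_pairs k N \<Longrightarrow> fst p \<in> hits k N"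
  unfolding hit_pairs_def
  by (induction rule: aspan.induct) (auto intro!: hits_add hits_sq)

lemma hit_pairs_add: "p \<in> hit_pairs k N \<Longrightarrow> q \<in> hit_pairs k N \<Longrightarrow> p + q \<in> hit_pairs k N"
  unfolding hit_pairs_def by (rule aspan_add)

lemma lows_add: "u \<in> lows k c N \<Longrightarrow> v \<in> lows k c N \<Longrightarrow> u + v \<in> lows k c N"
  unfolding lows_def by (rule aspan_add)

text \<open>The identities of \<open>conj_sq_identity\<close> for \<open>Suc i\<close> and for
  \<open>i\<close> involve the same polynomials \<open>w a\<close>, with the index of the outer
  square shifted by one; the surplus term of the former is \<open>conj_sq (lin L) (Suc i) v\<close>.
  Hence both coordinates come from one family of generators.\<close>

lemma hit_pair_conj:
  assumes v: "v \<in> hom k d" and L: "set L \<subseteq> {..<k}" and N: "N = length L + d + Suc i"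
  shows "(xl L * sq (Suc i) v + conj_sq (lin L) (Suc i) v, xl L * sq i v) \<in> hit_pairs k N"
proof -
  define w where "w a = conj_sq (lin L) (i - a) v" for a
  have id: "xl L * sq j v = (\<Sum>a\<le>j. sq a (conj_sq (lin L) (j - a) v))" for j
    using conj_sq_identity[of "lin L" j v] by (simp only: xpows_lin)
  have "xl L * sq (Suc i) v + conj_sq (lin L) (Suc i) v = (\<Sum>a\<le>i. sq (Suc a) (w a))"
    unfolding id by (simp add: sum.atMost_Suc_shift w_def add.commute del: sum.atMost_Suc)
  moreover have "xl L * sq i v = (\<Sum>a\<le>i. sq a (w a))"
    unfolding id w_def ..
  ultimately have "(xl L * sq (Suc i) v + conj_sq (lin L) (Suc i) v, xl L * sq i v) = (\<Sum>a\<le>i. (sq (Suc a) (w a), sq a (w a)))"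
    by (simp add: prod_eq_iff fst_sum snd_sum)
  also have "\<dots> \<in> hit_pairs k N"
    unfolding hit_pairs_def
  proof (rule aspan_sum, rule aspan_base)
    fix a assume a: "a \<in> {..i}"
    have "w a \<in> hom k (d + (i - a) + length L)"
      unfolding w_def by (rule hom_conj_sq[OF v]) (use L in \<open>auto simp: o_def sum_list_triv\<close>)
    moreover have "d + (i - a) + length L + Suc a = N" using a N by auto
    ultimately show "(sq (Suc a) (w a), sq a (w a)) \<in> {(sq (Suc i) f, sq i f) |i f m. f \<in> hom k m \<and> m + Suc i = N}"
      by blast
  qed
  finally show ?thesis .
qed

lemma hit_conj:
  assumes v: "v \<in> hom k d" and L: "set L \<subseteq> {..<k}" and N: "N = length L + d + i"
  shows "xl L * sq i v + conj_sq (lin L) i v \<in> hits k N"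
proof (cases i)
  case 0
  then show ?thesis using conj_sq_identity[of "lin L" 0 v] by (simp add: xpows_lin)
next
  case (Suc j)
  then show ?thesis using hit_pairs_fst[OF hit_pair_conj[OF v L, of N j]] N by simp
qed

text \<open>The square \<open>F^2\<close> is the top square Sq^d F. The chi-trick moves Sq^d to the
  product over \<open>Z\<close>, where it vanishes by degree arithmetic.\<close>

lemma hit_of_not_rep:
  assumes Z: "set Z \<subseteq> {..<k}" and F: "F \<in> hom k d" and nr: "\<not> rep d (length Z)" and N: "N = length Z + 2 * d"
  shows "xl Z * F^2 \<in> hits k N"
proof -
  have "conj_sq (lin Z) d F = 0" using conj_sq_rep nr by blast
  then show ?thesis
    using hit_conj[OF F Z, of N d] N by (simp add: sq_top[OF F])
qed

text \<open>Raising every exponent by one turns 2^u - 1 into 2 (2^u - 1) + 1.\<close>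

lemma rep_double: "rep n r \<Longrightarrow> rep (2 * n + r) r"
proof -
  assume "rep n r"
  then obtain us where us: "length us = r" "n + r = sum_list (map (\<lambda>u. 2 ^ u) us)" by (auto simp: rep_def)
  have "sum_list (map (\<lambda>u. 2 ^ u) (map Suc us)) = 2 * sum_list (map (\<lambda>u. (2::nat) ^ u) us)"
    by (simp add: o_def sum_list_const_mult)
  then show ?thesis unfolding rep_def using us by (intro exI[of _ "map Suc us"]) auto
qed

lemma rep_Suc_right: "rep n r \<Longrightarrow> rep n (Suc r)"
  unfolding rep_def by (metis add_Suc_right length_Cons list.simps(9) plus_1_eq_Suc power_0 sum_list.Cons)

lemma rep_mono: "rep n r \<Longrightarrow> r \<le> r' \<Longrightarrow> rep n r'"
  by (induction r' rule: nat_induct) (auto simp: le_Suc_eq intro: rep_Suc_right)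

lemma rep_Suc: "rep n r \<Longrightarrow> rep (Suc n) (Suc r)"
proof -
  assume "rep n r"
  then obtain us where us: "length us = r" "n + r = sum_list (map (\<lambda>u. 2 ^ u) us)" by (auto simp: rep_def)
  then show ?thesis unfolding rep_def by (intro exI[of _ "1 # us"]) auto
qed

lemma split_term_low:
  assumes EZ: "(E, Z) \<in> set (splits L)" and L: "set L \<subseteq> {..<k}" and f: "f \<in> hom k m"
    and N: "N = length L + 2 * m + i" and c: "length Z < c"
  shows "xl Z * half_if (length E) i (\<lambda>j. conj_sq (lin E) j f) \<in> lows k c N"
proof (cases "length E \<le> i \<and> even (i - length E)")
  case False
  then show ?thesis by (auto simp: half_if_def lows_def aspan_zero)
next
  case True
  let ?j = "(i - length E) div 2"
  have E: "set E \<subseteq> {..<k}" and Z: "set Z \<subseteq> {..<k}" using splits_set[OF EZ] L by auto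
  have "conj_sq (lin E) ?j f \<in> hom k (m + ?j + length E)"
    by (rule hom_conj_sq[OF f]) (use E in \<open>auto simp: o_def sum_list_triv\<close>)
  moreover have "length Z + 2 * (m + ?j + length E) = N"
    using True splits_length[OF EZ] N by auto
  ultimately have "xl Z * (conj_sq (lin E) ?j f)^2 \<in> lows k c N"
    unfolding lows_def using Z c by (intro aspan_base) blast
  then show ?thesis unfolding half_if_def by (simp only: if_P[OF True])
qed

text \<open>The square of Sq^i f is Sq^(2 i) of \<open>f^2\<close>, and the odd square Sq^(2 i - 1)
  of \<open>f^2\<close> vanishes, which makes the second coordinate 0. In the expansion of the
  chi-term the empty \<open>E\<close> contributes 0 because i is positive, and a single variable in
  \<open>E\<close> is excluded by parity; so \<open>Z\<close> loses at least two variables.\<close>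

lemma square_hit_pair:
  assumes y: "y \<in> hits k M" and L: "set L \<subseteq> {..<k}" and N: "N = length L + 2 * M"
  shows "\<exists>u\<in>lows k (length L - 1) N. (xl L * y^2 + u, 0) \<in> hit_pairs k N"
  using y unfolding hits_def
proof induction
  case aspan_zero
  then show ?case by (intro bexI[of _ 0]) (auto simp: lows_def hit_pairs_def aspan.aspan_zero simp flip: zero_prod_def)
next
  case (aspan_step s v)
  then obtain i f m where s: "s = sq i f" "0 < i" "f \<in> hom k m" "m + i = M" by blast
  obtain j where j: "2 * i = Suc j" "odd j" using s(2)
    by (metis Suc_pred dvd_triv_left even_Suc nat_0_less_mult_iff zero_less_numeral)
  define w where "w = conj_sq (lin L) (2 * i) (f^2)"
  have "(xl L * sq (Suc j) (f^2) + conj_sq (lin L) (Suc j) (f^2), xl L * sq j (f^2)) \<in> hit_pairs k N"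
    using hom_power[OF s(3), of 2] L by (rule hit_pair_conj) (use N s j in simp)
  then have 1: "(xl L * s^2 + w, 0) \<in> hit_pairs k N"
    unfolding w_def j(1)[symmetric] using j(2) by (simp add: sq_square s(1))
  have "w \<in> lows k (length L - 1) N"
    unfolding w_def conj_sq_square lows_def
  proof (rule aspan_sum_list, clarify, fold lows_def)
    fix E Z assume EZ: "(E, Z) \<in> set (splits L)"
    show "xl Z * half_if (length E) (2 * i) (\<lambda>j. conj_sq (lin E) j f) \<in> lows k (length L - 1) N"
    proof (cases "length E < 2")
      case True
      then have "half_if (length E) (2 * i) (\<lambda>j. conj_sq (lin E) j f) = 0"
        using s(2) j by (cases E) (auto simp: half_if_def)
      then show ?thesis by (simp add: lows_def aspan.aspan_zero)
    next
      case False
      then show ?thesis using splits_length[OF EZ]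
        by (intro split_term_low[OF EZ L s(3)]) (use N s in auto)
    qed
  qed
  moreover obtain u where "u \<in> lows k (length L - 1) N" "(xl L * v^2 + u, 0) \<in> hit_pairs k N"
    using aspan_step.IH by blast
  moreover have "(xl L * (s + v)^2 + (w + u), 0::f2poly) = (xl L * s^2 + w, 0) + (xl L * v^2 + u, 0)"
    by (simp add: f2_square_add algebra_simps)
  ultimately show ?case using 1 by (metis hit_pairs_add lows_add)
qed

text \<open>The terms of the chi-expansion with two variables in \<open>E\<close>, expressed through
  the second coordinate \<open>r\<close> of a hit pair. They keep too many free factors to count
  among the low remainders of \<open>square_hit_pair2\<close>.\<close>

definition pair_part :: "nat list \<Rightarrow> (nat list \<Rightarrow> f2poly) \<Rightarrow> f2poly \<Rightarrow> f2poly" where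
  "pair_part L \<eta> r = (\<Sum>(E,Z)\<leftarrow>splits L. if length E = 2 then xl Z * (xl E * r + \<eta> E)^2 else 0)"

text \<open>For the generator (Sq^(i+1) f, Sq^i f) the relevant chi-term is that of index 2 i + 2 on
  \<open>f^2\<close>. Its terms with two variables p, q in \<open>E\<close> contain chi(Sq^i)(x_p
  x_q) f, which \<open>hit_conj\<close> identifies with x_p x_q Sq^i f up to a hit polynomial. The
  empty \<open>E\<close> contributes 0 and odd lengths fail by parity, so every other term has at
  least four variables in \<open>E\<close>.\<close>

lemma square_hit_pair2:
  assumes y: "(y, r) \<in> hit_pairs k M" and L: "set L \<subseteq> {..<k}" and N: "N = length L + 2 * M"
  shows "\<exists>\<eta> u. (\<forall>E Z. (E, Z) \<in> set (splits L) \<longrightarrow> length E = 2 \<longrightarrow> \<eta> E \<in> hits k (Suc M)) \<and>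
    u \<in> lows k (length L - 3) N \<and> (xl L * y^2 + pair_part L \<eta> r + u, 0) \<in> hit_pairs k N"
proof -
  have "\<exists>\<eta> u. (\<forall>E Z. (E, Z) \<in> set (splits L) \<longrightarrow> length E = 2 \<longrightarrow> \<eta> E \<in> hits k (Suc M)) \<and>
    u \<in> lows k (length L - 3) N \<and> (xl L * (fst p)^2 + pair_part L \<eta> (snd p) + u, 0) \<in> hit_pairs k N"
    if "p \<in> hit_pairs k M" for p
    using that unfolding hit_pairs_def[of k M]
  proof induction
    case aspan_zero
    have "pair_part L (\<lambda>_. 0) 0 = 0"
      by (auto simp: pair_part_def case_prod_unfold sum_list_0 cong: if_cong)
    then show ?case
      by (intro exI[of _ "\<lambda>_. 0"] exI[of _ 0]) (auto simp: lows_def hit_pairs_def aspan.aspan_zero simp flip: zero_prod_def)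
  next
    case (aspan_step s p)
    then obtain i f m where s: "s = (sq (Suc i) f, sq i f)" "f \<in> hom k m" "m + Suc i = M" by blast
    obtain \<eta> u where \<eta>: "\<And>E Z. (E, Z) \<in> set (splits L) \<Longrightarrow> length E = 2 \<Longrightarrow> \<eta> E \<in> hits k (Suc M)"
      and u: "u \<in> lows k (length L - 3) N" and p: "(xl L * (fst p)^2 + pair_part L \<eta> (snd p) + u, 0) \<in> hit_pairs k N"
      using aspan_step.IH by blast
    \<comment> \<open>The bracket is hit by \<open>hit_conj\<close>; it accounts for the passage
      from chi(Sq^i)(x_p x_q) f to x_p x_q Sq^i f.\<close>
    define \<eta>' where "\<eta>' E = \<eta> E + (xl E * sq i f + conj_sq (lin E) i f)" for E
    define J where "J = 2 * Suc i"
    define w where "w = (\<Sum>(E,Z)\<leftarrow>splits L. if length E = 2 then 0 else xl Z * half_if (length E) J (\<lambda>j. conj_sq (lin E) j f))"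
    have \<eta>': "\<eta>' E \<in> hits k (Suc M)" if EZ: "(E, Z) \<in> set (splits L)" "length E = 2" for E Z
    proof -
      have "set E \<subseteq> {..<k}" using splits_set[OF EZ(1)] L by auto
      then have "xl E * sq i f + conj_sq (lin E) i f \<in> hits k (Suc M)"
        by (rule hit_conj[OF s(2)]) (use EZ s in simp)
      then show ?thesis unfolding \<eta>'_def using \<eta>[OF EZ] by (rule hits_add[rotated])
    qed
    have pp: "pair_part L \<eta>' (snd (s + p)) = pair_part L \<eta> (snd p) + (\<Sum>(E,Z)\<leftarrow>splits L. if length E = 2 then xl Z * (conj_sq (lin E) i f)^2 else 0)"
    proof -
      have *: "xl E * (sq i f + snd p) + \<eta>' E = (xl E * snd p + \<eta> E) + conj_sq (lin E) i f" for E
        by (simp add: \<eta>'_def distrib_left add_ac)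
      have tm: "xl Z * (xl E * snd (s + p) + \<eta>' E)^2 = xl Z * (xl E * snd p + \<eta> E)^2 + xl Z * (conj_sq (lin E) i f)^2" for E Z
        unfolding snd_add s(1) snd_conv * f2_square_add[of "xl E * snd p + \<eta> E"] by (rule distrib_left)
      show ?thesis
        unfolding pair_part_def sum_list_addf[symmetric] tm
        by (auto simp: case_prod_unfold intro!: arg_cong[where f = sum_list])
    qed
    have cs: "conj_sq (lin L) J (f^2) = (\<Sum>(E,Z)\<leftarrow>splits L. if length E = 2 then xl Z * (conj_sq (lin E) i f)^2 else 0) + w"
      unfolding conj_sq_square w_def sum_list_addf[symmetric]
      by (auto simp: case_prod_unfold half_if_def J_def intro!: arg_cong[where f = sum_list])
    have w: "w \<in> lows k (length L - 3) N"
      unfolding w_def lows_def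
    proof (rule aspan_sum_list, clarify, fold lows_def)
      fix E Z assume EZ: "(E, Z) \<in> set (splits L)"
      show "(if length E = 2 then 0 else xl Z * half_if (length E) J (\<lambda>j. conj_sq (lin E) j f)) \<in> lows k (length L - 3) N"
      proof (cases "length E < 4")
        case True
        then have "length E = 2 \<or> half_if (length E) J (\<lambda>j. conj_sq (lin E) j f) = 0"
        proof -
          consider "E = []" | "length E = 1" | "length E = 2" | "length E = 3"
            using True by (cases "length E") (auto simp: less_Suc_eq numeral_eq_Suc)
          then show ?thesis by cases (auto simp: half_if_def J_def)
        qed
        then show ?thesis by (auto simp: lows_def aspan.aspan_zero)
      next
        case False
        then have "xl Z * half_if (length E) J (\<lambda>j. conj_sq (lin E) j f) \<in> lows k (length L - 3) N"
          using splits_length[OF EZ] by (intro split_term_low[OF EZ L s(2)]) (use N s J_def in auto)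
        then show ?thesis using False by auto
      qed
    qed
    have "(xl L * sq (Suc (2 * i + 1)) (f^2) + conj_sq (lin L) (Suc (2 * i + 1)) (f^2), xl L * sq (2 * i + 1) (f^2)) \<in> hit_pairs k N"
      using hom_power[OF s(2), of 2] L by (rule hit_pair_conj) (use N s in simp)
    then have "(xl L * (sq (Suc i) f)^2 + conj_sq (lin L) J (f^2), 0) \<in> hit_pairs k N"
      by (simp add: sq_square J_def)
    from hit_pairs_add[OF this p]
    have "(xl L * (fst (s + p))^2 + pair_part L \<eta>' (snd (s + p)) + (w + u), 0) \<in> hit_pairs k N"
      unfolding pp cs by (simp add: s(1) f2_square_add distrib_left add_ac)
    then show ?case using \<eta>' w u by (intro exI[of _ \<eta>'] exI[of _ "w + u"]) (auto intro: lows_add)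
  qed
  from this[OF y] show ?thesis by simp
qed

text \<open>
  The condition on r is what makes X y^2 hit when X is the product of all k = s + 2 variables: modulo
  hit polynomials X y^2 is the sum of the products X (x_p x_q)^(-1) (x_p x_q r)^2.
\<close>

definition strong_hits :: "nat \<Rightarrow> nat \<Rightarrow> f2poly set" where
  "strong_hits k M = {y. \<exists>r. (y, r) \<in> hit_pairs k M \<and> (\<forall>p<k. \<forall>q<k. x p * (x q * r) \<in> hits k (Suc M))}"

lemma strong_hits_add: "u \<in> strong_hits k M \<Longrightarrow> v \<in> strong_hits k M \<Longrightarrow> u + v \<in> strong_hits k M"
proof -
  assume "u \<in> strong_hits k M" "v \<in> strong_hits k M"
  then obtain r t where "(u, r) \<in> hit_pairs k M" "\<forall>p<k. \<forall>q<k. x p * (x q * r) \<in> hits k (Suc M)"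
    "(v, t) \<in> hit_pairs k M" "\<forall>p<k. \<forall>q<k. x p * (x q * t) \<in> hits k (Suc M)"
    by (auto simp: strong_hits_def)
  then have "(u + v, r + t) \<in> hit_pairs k M \<and> (\<forall>p<k. \<forall>q<k. x p * (x q * (r + t)) \<in> hits k (Suc M))"
    using hit_pairs_add[of "(u, r)" k M "(v, t)"] by (auto simp: distrib_left intro: hits_add)
  then show ?thesis by (auto simp: strong_hits_def)
qed

lemma strong_hits_pair: "(y, 0) \<in> hit_pairs k M \<Longrightarrow> y \<in> strong_hits k M"
  unfolding strong_hits_def by (auto intro!: exI[of _ 0])

lemma strong_hits_zero: "0 \<in> strong_hits k M"
  by (rule strong_hits_pair) (simp add: hit_pairs_def aspan_zero flip: zero_prod_def)

lemma strong_hits_sum_list: "(\<And>i. i \<in> set xs \<Longrightarrow> f i \<in> strong_hits k N) \<Longrightarrow> sum_list (map f xs) \<in> strong_hits k N"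
  by (induction xs) (auto intro: strong_hits_zero strong_hits_add)

text \<open>\<open>N_Suc\<close> is the effect of stripping off a first weight s. In the application
  \<open>N 0\<close> is m, a sum of s - 1 numbers 2^u - 1, so \<open>not_rep\<close> can be demanded
  only from level 1 on.\<close>

locale level_degrees =
  fixes k s :: nat and N :: "nat \<Rightarrow> nat"
  assumes ks: "k = s + 2" and s2: "2 \<le> s"
    and N_Suc: "N (Suc e) = 2 * N e + s"
    and not_rep: "\<not> rep (N (Suc e)) (s - 1)"
begin

text \<open>If \<open>d\<close> were a sum of \<open>length Z\<close> numbers 2^u - 1,
  \<open>rep_double\<close> would give such a sum for \<open>length Z + 2 * d\<close>, against
  \<open>not_rep\<close>; so \<open>hit_of_not_rep\<close> applies.\<close>

lemma lows_hits: "c \<le> s \<Longrightarrow> lows k c (N (Suc e)) \<subseteq> hits k (N (Suc e))"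
proof
  fix v assume c: "c \<le> s" and v: "v \<in> lows k c (N (Suc e))"
  show "v \<in> hits k (N (Suc e))"
    using v unfolding lows_def
  proof induction
    case (aspan_step t v)
    then obtain Z F d where t: "t = xl Z * F^2" "set Z \<subseteq> {..<k}" "length Z < c" "F \<in> hom k d" "length Z + 2 * d = N (Suc e)"
      by blast
    have "\<not> rep d (length Z)"
    proof
      assume "rep d (length Z)"
      from rep_double[OF this] have "rep (N (Suc e)) (length Z)" using t(5) by (simp add: add.commute)
      then show False using not_rep rep_mono t(3) c by (metis One_nat_def Suc_leI Suc_pred diff_le_mono less_le_trans not_less_eq_eq gr0_conv_Suc diff_Suc_1)
    qed
    then have "t \<in> hits k (N (Suc e))"
      unfolding t(1) by (intro hit_of_not_rep[OF t(2,4)]) (use t in auto)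
    then show ?case using aspan_step by (intro hits_add)
  qed simp
qed

lemma low_hit: "set Z \<subseteq> {..<k} \<Longrightarrow> length Z < s \<Longrightarrow> F \<in> hom k d \<Longrightarrow> length Z + 2 * d = N (Suc e) \<Longrightarrow> xl Z * F^2 \<in> hits k (N (Suc e))"
  by (rule subsetD[OF lows_hits[OF order_refl]]) (auto simp: lows_def intro!: aspan_base)

lemma square_hit:
  assumes "set Z \<subseteq> {..<k}" "length Z = s" "y \<in> hits k (N e)"
  shows "xl Z * y^2 \<in> hits k (N (Suc e))"
proof -
  obtain u where u: "u \<in> lows k (length Z - 1) (N (Suc e))" "(xl Z * y^2 + u, 0) \<in> hit_pairs k (N (Suc e))"
    using square_hit_pair[OF assms(3,1), of "N (Suc e)"] N_Suc assms(2) by auto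
  have "u \<in> hits k (N (Suc e))" using lows_hits[of "length Z - 1" e] u(1) assms(2) by auto
  then show ?thesis using hit_pairs_fst[OF u(2)] by (auto intro: hits_cancel)
qed

text \<open>Origin of the bounds: a sum for \<open>g\<close> with \<open>length Y\<close> terms
  gives one for \<open>N (Suc e)\<close> with one more term, the number 1. After multiplication by
  two variables, a sum for g - 1 with \<open>length Y + 2\<close> terms would give one for
  \<open>N (Suc e)\<close> with \<open>length Y + 3\<close> terms, which is excluded if
  \<open>length Y + 4\<close> is at most s. In the borderline case \<open>length Y + 3 = s\<close>
  the number g - 1 is \<open>N e\<close>, and \<open>not_rep\<close> is applied one level lower,
  which requires e to be positive.\<close>

lemma low_strong_hit:
  assumes Y: "set Y \<subseteq> {..<k}" and F: "F \<in> hom k g" and M: "length Y + 2 * g = M" "Suc M = N (Suc e)"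
    and len: "length Y + 3 \<le> s" "length Y + 4 \<le> s \<or> 1 \<le> e"
  shows "xl Y * F^2 \<in> strong_hits k M"
proof -
  have nr: "\<not> rep (N (Suc e)) r" if "r < s" for r
  proof -
    have "r \<le> s - 1" using that by simp
    then show ?thesis using not_rep rep_mono by blast
  qed
  have nr1: "\<not> rep g (length Y)"
  proof
    assume "rep g (length Y)"
    from rep_Suc[OF rep_double[OF this]] have "rep (N (Suc e)) (Suc (length Y))" using M by (simp add: add.commute)
    then show False using nr len by auto
  qed
  have "g \<noteq> 0"
  proof
    assume "g = 0"
    then have "rep g (length Y)" by (auto simp: rep_def sum_list_replicate intro!: exI[of _ "replicate (length Y) 0"])
    then show False using nr1 by simp
  qed
  then obtain g' where g': "g = Suc g'" by (cases g) auto
  have c0: "conj_sq (lin Y) g F = 0" using nr1 conj_sq_rep by blast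
  have pair: "(xl Y * F^2, xl Y * sq g' F) \<in> hit_pairs k M"
  proof -
    have "M = length Y + g + Suc g'" using M g' by simp
    from hit_pair_conj[OF F Y this] show ?thesis using c0 sq_top[OF F] unfolding g' by simp
  qed
  moreover have "x p * (x q * (xl Y * sq g' F)) \<in> hits k (Suc M)" if pq: "p < k" "q < k" for p q
  proof -
    have nr2: "\<not> rep g' (length Y + 2)"
    proof
      assume r: "rep g' (length Y + 2)"
      show False
      proof (cases "length Y + 4 \<le> s")
        case True
        have "Suc (2 * g' + (length Y + 2)) = N (Suc e)" using M g' by simp
        then have "rep (N (Suc e)) (Suc (length Y + 2))" using rep_Suc[OF rep_double[OF r]] by simp
        then show False using nr True by auto
      next
        case False
        then obtain e' where e': "e = Suc e'" using len by (cases e) auto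
        have "length Y + 3 = s" using False len by simp
        then have "g' = N e" using M g' N_Suc[of e] by simp
        then have "rep (N (Suc e')) (s - 1)" using r e' \<open>length Y + 3 = s\<close> rep_mono by fastforce
        then show False using not_rep by simp
      qed
    qed
    then have "conj_sq (lin (p # q # Y)) g' F = 0" using conj_sq_rep[of "p # q # Y" g' F] by auto
    moreover have "xl (p # q # Y) * sq g' F + conj_sq (lin (p # q # Y)) g' F \<in> hits k (Suc M)"
      by (rule hit_conj[OF F]) (use Y pq M g' in auto)
    ultimately show ?thesis by (simp add: mult.assoc)
  qed
  ultimately show ?thesis unfolding strong_hits_def by blast
qed

lemma lows_strong_hits:
  assumes "1 \<le> e" "Suc M = N (Suc e)" "c + 2 \<le> s" "u \<in> lows k c M"
  shows "u \<in> strong_hits k M"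
  using assms(4) unfolding lows_def
proof induction
  case (aspan_step t v)
  then obtain Z F d where t: "t = xl Z * F^2" "set Z \<subseteq> {..<k}" "length Z < c" "F \<in> hom k d" "length Z + 2 * d = M"
    by blast
  have "t \<in> strong_hits k M"
    unfolding t(1) by (rule low_strong_hit[OF t(2,4,5) assms(2)]) (use assms t in auto)
  then show ?case using aspan_step by (intro strong_hits_add)
qed (rule strong_hits_zero)

lemma strong_hits_cancel: "u + v \<in> strong_hits k M \<Longrightarrow> v \<in> strong_hits k M \<Longrightarrow> u \<in> strong_hits k M"
  using strong_hits_add[of "u + v" k M v] by (simp add: add.assoc)

text \<open>The transition of the weights from excess 1 to excess 0, with weight s - 1. As
  \<open>y\<close> is hit, \<open>square_hit_pair\<close> provides second coordinate 0, and the
  remainders are short enough for \<open>lows_strong_hits\<close>.\<close>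

lemma square_strong_hit1:
  assumes "set Y \<subseteq> {..<k}" "length Y + 1 = s" "y \<in> hits k (N e)" "1 \<le> e" "Suc M = N (Suc e)"
  shows "xl Y * y^2 \<in> strong_hits k M"
proof -
  have M: "M = length Y + 2 * N e" using assms N_Suc[of e] by simp
  obtain u where u: "u \<in> lows k (length Y - 1) M" "(xl Y * y^2 + u, 0) \<in> hit_pairs k M"
    using square_hit_pair[OF assms(3,1) M] by auto
  have "u \<in> strong_hits k M"
    by (rule lows_strong_hits[OF assms(4,5) _ u(1)]) (use assms(2) s2 in auto)
  then show ?thesis using strong_hits_pair[OF u(2)] by (blast intro: strong_hits_cancel)
qed

lemma pair_part_E:
  assumes "(E, Z) \<in> set (splits L)" "length E = 2" "set L \<subseteq> {..<k}"
    "\<forall>p<k. \<forall>q<k. x p * (x q * r) \<in> hits k M" "\<eta> \<in> hits k M"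
  shows "xl E * r + \<eta> \<in> hits k M"
proof -
  obtain p q where E: "E = [p, q]" using assms(2) by (auto simp: length_Suc_conv numeral_2_eq_2)
  have "p < k" "q < k" using splits_set[OF assms(1)] assms(3) E by auto
  then have "xl E * r \<in> hits k M" using assms(4) E by (auto simp: mult.assoc)
  then show ?thesis using assms(5) by (rule hits_add)
qed

text \<open>The transition that keeps excess 1, with weight s + 1. Each summand of
  \<open>pair_part\<close> keeps s - 1 free variables, and the strength of \<open>y\<close> makes
  the polynomial under the square hit, so \<open>square_strong_hit1\<close> applies.\<close>

lemma square_strong_hit2:
  assumes L: "set L \<subseteq> {..<k}" "length L = s + 1" and y: "y \<in> strong_hits k M'" "Suc M' = N e" and e: "1 \<le> e" "Suc M = N (Suc e)"
  shows "xl L * y^2 \<in> strong_hits k M"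
proof -
  obtain r where r: "(y, r) \<in> hit_pairs k M'" "\<forall>p<k. \<forall>q<k. x p * (x q * r) \<in> hits k (N e)"
    using y by (auto simp: strong_hits_def)
  have M: "M = length L + 2 * M'" using L y e N_Suc[of e] by simp
  obtain \<eta> u where \<eta>: "\<And>E Z. (E, Z) \<in> set (splits L) \<Longrightarrow> length E = 2 \<Longrightarrow> \<eta> E \<in> hits k (N e)"
    and u: "u \<in> lows k (length L - 3) M" and p: "(xl L * y^2 + pair_part L \<eta> r + u, 0) \<in> hit_pairs k M"
    using square_hit_pair2[OF r(1) L(1) M] y(2) by auto
  have "u \<in> strong_hits k M"
    by (rule lows_strong_hits[OF e _ u]) (use L s2 in auto)
  moreover have "pair_part L \<eta> r \<in> strong_hits k M"
    unfolding pair_part_def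
  proof (rule strong_hits_sum_list, clarify)
    fix E Z assume EZ: "(E, Z) \<in> set (splits L)"
    show "(if length E = 2 then xl Z * (xl E * r + \<eta> E)\<^sup>2 else 0) \<in> strong_hits k M"
    proof (cases "length E = 2")
      case True
      then have "xl E * r + \<eta> E \<in> hits k (N e)" by (intro pair_part_E[OF EZ _ L(1) r(2)] \<eta>[OF EZ])
      then have "xl Z * (xl E * r + \<eta> E)\<^sup>2 \<in> strong_hits k M"
        by (intro square_strong_hit1[OF _ _ _ e]) (use splits_set[OF EZ] splits_length[OF EZ] L True in auto)
      then show ?thesis using True by simp
    qed (auto intro: strong_hits_zero)
  qed
  ultimately show ?thesis using strong_hits_pair[OF p] by (blast intro: strong_hits_cancel)
qed

text \<open>The transition from excess 0 to excess 1, with weight s + 2. Now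
  \<open>pair_part\<close> keeps s free variables and \<open>square_hit\<close> takes over.\<close>

lemma square_strong_hit3:
  assumes L: "set L \<subseteq> {..<k}" "length L = s + 2" and y: "y \<in> strong_hits k M'" "Suc M' = N e"
  shows "xl L * y^2 \<in> hits k (N (Suc e))"
proof -
  let ?M = "N (Suc e)"
  obtain r where r: "(y, r) \<in> hit_pairs k M'" "\<forall>p<k. \<forall>q<k. x p * (x q * r) \<in> hits k (N e)"
    using y by (auto simp: strong_hits_def)
  have M: "?M = length L + 2 * M'" using L y N_Suc[of e] by simp
  obtain \<eta> u where \<eta>: "\<And>E Z. (E, Z) \<in> set (splits L) \<Longrightarrow> length E = 2 \<Longrightarrow> \<eta> E \<in> hits k (N e)"
    and u: "u \<in> lows k (length L - 3) ?M" and p: "(xl L * y^2 + pair_part L \<eta> r + u, 0) \<in> hit_pairs k ?M"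
    using square_hit_pair2[OF r(1) L(1) M] y(2) by auto
  have "u \<in> hits k ?M" using lows_hits[of "length L - 3" e] u L by auto
  moreover have "pair_part L \<eta> r \<in> hits k ?M"
    unfolding pair_part_def
  proof (rule hits_sum_list, clarify)
    fix E Z assume EZ: "(E, Z) \<in> set (splits L)"
    show "(if length E = 2 then xl Z * (xl E * r + \<eta> E)\<^sup>2 else 0) \<in> hits k ?M"
    proof (cases "length E = 2")
      case True
      then have "xl E * r + \<eta> E \<in> hits k (N e)" by (intro pair_part_E[OF EZ _ L(1) r(2)] \<eta>[OF EZ])
      then have "xl Z * (xl E * r + \<eta> E)\<^sup>2 \<in> hits k ?M"
        by (intro square_hit) (use splits_set[OF EZ] splits_length[OF EZ] L True in auto)
      then show ?thesis by simp
    qed auto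
  qed
  ultimately show ?thesis using hit_pairs_fst[OF p] by (auto intro: hits_cancel)
qed

end

lemma aspan_cancel: "u + v \<in> aspan S \<Longrightarrow> v \<in> aspan S \<Longrightarrow> (u :: 'a \<Rightarrow>\<^sub>0 bit) \<in> aspan S"
  using aspan_add[of "u + v" S v] by (simp add: add.assoc)

section \<open>Monomials given by exponent lists\<close>

definition ex :: "nat list \<Rightarrow> (nat \<Rightarrow>\<^sub>0 nat)" where "ex a = Poly_Mapping.nth a"
abbreviation ml :: "nat list \<Rightarrow> f2poly" where "ml a \<equiv> mon (ex a)"

lemma lookup_ex: "lookup (ex a) j = (if j < length a then a ! j else 0)"
  by (simp add: ex_def nth.rep_eq nth_default_def)

lemma keys_ex: "keys (ex a) \<subseteq> {..<length a}"
  by (auto simp: in_keys_iff lookup_ex split: if_splits)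

lemma ex_inj: "length a = length b \<Longrightarrow> ex a = ex b \<Longrightarrow> a = b"
  by (rule nth_equalityI) (auto simp: poly_mapping_eq_iff fun_eq_iff lookup_ex split: if_splits)

lemma dg_ex: "dg (ex a) = sum_list a"
proof -
  have "dg (ex a) = (\<Sum>j<length a. lookup (ex a) j)" by (rule dg_alt[OF _ keys_ex]) simp
  also have "\<dots> = sum_list a" by (simp add: lookup_ex sum_list_sum_nth atLeast0LessThan)
  finally show ?thesis .
qed

lemma ex_surj: "keys e \<subseteq> {..<k} \<Longrightarrow> e = ex (map (lookup e) [0..<k])"
  by (rule poly_mapping_eqI) (auto simp: lookup_ex in_keys_iff)

lemma hom_ml: "length a = k \<Longrightarrow> ml a \<in> hom k (sum_list a)"
  using keys_ex[of a] by (auto simp: dg_ex)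

lemma hom_expand_ml:
  assumes "v \<in> hom k d" shows "v \<in> aspan {ml a |a. length a = k \<and> sum_list a = d}"
proof (rule subsetD[OF aspan_mono hom_expand[OF assms]])
  show "{mon a |a. keys a \<subseteq> {..<k} \<and> dg a = d} \<subseteq> {ml a |a. length a = k \<and> sum_list a = d}"
  proof clarify
    fix e assume e: "keys e \<subseteq> {..<k}" "d = dg e"
    let ?a = "map (lookup e) [0..<k]"
    have "e = ex ?a" using e(1) by (rule ex_surj)
    moreover have "dg e = sum_list ?a" using calculation by (metis dg_ex)
    ultimately show "\<exists>a. mon e = ml a \<and> length a = k \<and> sum_list a = dg e"
      by (intro exI[of _ ?a]) auto
  qed
qed

lemma ml_plus: "ml (map (\<lambda>l. f l + g l) [0..<k]) = ml (map f [0..<k]) * ml (map g [0..<k])"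
  unfolding mon_mult by (rule arg_cong[where f = mon], rule poly_mapping_eqI) (auto simp: lookup_ex lookup_add)

lemma ml_times: "ml (map (\<lambda>l. c * f l) [0..<k]) = (ml (map f [0..<k])) ^ c"
proof (induction c)
  case 0
  have "ex (map (\<lambda>l. 0) [0..<k]) = 0" by (rule poly_mapping_eqI) (auto simp: lookup_ex)
  then show ?case by simp
next
  case (Suc c)
  show ?case using ml_plus[of f "\<lambda>l. c * f l" k] Suc by simp
qed

abbreviation X :: "nat set \<Rightarrow> f2poly" where "X A \<equiv> prod x A"

lemma X_ml: "A \<subseteq> {..<k} \<Longrightarrow> X A = ml (map (\<lambda>l. if l \<in> A then 1 else 0) [0..<k])"
proof -
  assume A: "A \<subseteq> {..<k}"
  then have "finite A" by (rule finite_subset) simp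
  then show ?thesis using A
  proof induction
    case empty
    have "ex (map (\<lambda>l. if l \<in> {} then 1 else 0) [0..<k]) = 0" by (rule poly_mapping_eqI) (auto simp: lookup_ex)
    then show ?case by simp
  next
    case (insert p A)
    then have "X (insert p A) = mon (Poly_Mapping.single p 1 + ex (map (\<lambda>l. if l \<in> A then 1 else 0) [0..<k]))"
      by (simp add: x_mon)
    also have "Poly_Mapping.single p 1 + ex (map (\<lambda>l. if l \<in> A then 1 else 0) [0..<k]) = ex (map (\<lambda>l. if l \<in> insert p A then 1 else 0) [0..<k])"
      by (rule poly_mapping_eqI) (use insert in \<open>auto simp: lookup_ex lookup_add lookup_single when_def\<close>)
    finally show ?case .
  qed
qed

lemma X_xl: assumes "A \<subseteq> {..<k}" obtains L where "set L = A" "length L = card A" "xl L = X A"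
proof -
  obtain L where L: "set L = A" "distinct L" using finite_distinct_list[of A] finite_subset[OF assms] by auto
  show ?thesis
    by (rule that[of L]) (use L prod.distinct_set_conv_list[of L x] distinct_card[of L] in \<open>auto simp: xl_def\<close>)
qed

lemma hom_X: "A \<subseteq> {..<k} \<Longrightarrow> X A \<in> hom k (card A)"
  by (metis X_xl hom_xl)

section \<open>Binary digits of exponents and the excess of the weights\<close>

definition odds :: "nat list \<Rightarrow> nat set" where "odds a = {j. j < length a \<and> odd (a ! j)}"
definition half :: "nat list \<Rightarrow> nat list" where "half a = map (\<lambda>e. e div 2) a"
definition comb :: "nat \<Rightarrow> nat set \<Rightarrow> nat list \<Rightarrow> nat list" where
  "comb k A c = map (\<lambda>l. (if l \<in> A then 1 else 0) + 2 * c ! l) [0..<k]"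

lemma length_half [simp]: "length (half a) = length a" by (simp add: half_def)
lemma length_comb [simp]: "length (comb k A c) = k" by (simp add: comb_def)
lemma odds_subset: "odds a \<subseteq> {..<length a}" by (auto simp: odds_def)
lemma odds_comb: "A \<subseteq> {..<k} \<Longrightarrow> odds (comb k A c) = A"
  by (auto simp: odds_def comb_def split: if_splits)
lemma half_comb: "length c = k \<Longrightarrow> half (comb k A c) = c"
  by (rule nth_equalityI) (auto simp: half_def comb_def)
lemma comb_odds_half: "length a = k \<Longrightarrow> comb k (odds a) (half a) = a"
  by (rule nth_equalityI) (auto simp: half_def comb_def odds_def odd_iff_mod_2_eq_one even_iff_mod_2_eq_zero div_mult_mod_eq)

lemma ml_comb: "A \<subseteq> {..<k} \<Longrightarrow> length c = k \<Longrightarrow> ml (comb k A c) = X A * (ml c)^2"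
  using map_nth[of c] unfolding comb_def ml_plus ml_times X_ml by simp

lemma sum_list_comb: "A \<subseteq> {..<k} \<Longrightarrow> length c = k \<Longrightarrow> sum_list (comb k A c) = card A + 2 * sum_list c"
proof -
  assume A: "A \<subseteq> {..<k}" and c: "length c = k"
  have "sum_list (comb k A c) = (\<Sum>l<k. (if l \<in> A then 1 else 0) + 2 * c ! l)"
    by (simp add: comb_def sum_list_sum_nth atLeast0LessThan)
  also have "\<dots> = card ({..<k} \<inter> A) + 2 * (\<Sum>l<k. c ! l)"
    by (simp add: sum.distrib sum_distrib_left sum.If_cases)
  finally show ?thesis using A c by (simp add: sum_list_sum_nth atLeast0LessThan Int_absorb1)
qed

lemma ml_decomp: "length a = k \<Longrightarrow> ml a = X (odds a) * (ml (half a))^2"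
  using ml_comb[of "odds a" k "half a"] comb_odds_half[of a k] odds_subset[of a] by simp

lemma sum_list_decomp: "sum_list a = card (odds a) + 2 * sum_list (half a)"
  using sum_list_comb[of "odds a" "length a" "half a"] comb_odds_half[of a "length a"] odds_subset[of a] by simp

lemma card_odds_le: "card (odds a) \<le> length a"
  using card_mono[OF _ odds_subset[of a]] by simp

text \<open>
  Let w_1, w_2, ... be the weights of a. The excess (w_1 + 2 w_2 + ... + 2^(h-1) w_h - s (2^h - 1)) / 2^h
  starts at 0 or, for the flag True, at 1/2^h, and bad says that it stays in {0, 1} up to some
  level at most e, where it becomes negative. From excess 1 at the very last level it has to reach -2,
  because there the degree that is left need not satisfy the condition on sums of numbers 2^u - 1.
\<close>

fun bad :: "nat \<Rightarrow> nat \<Rightarrow> bool \<Rightarrow> nat list \<Rightarrow> bool" where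
  "bad s 0 b a = False"
| "bad s (Suc e) False a = (card (odds a) < s \<or> (card (odds a) = s \<and> bad s e False (half a)) \<or>
      (card (odds a) = s + 2 \<and> bad s e True (half a)))"
| "bad s (Suc e) True a = (card (odds a) + 4 \<le> s \<or> (card (odds a) + 3 \<le> s \<and> 1 \<le> e) \<or>
      (card (odds a) + 1 = s \<and> bad s e False (half a)) \<or> (card (odds a) = s + 1 \<and> bad s e True (half a)))"

lemma weight_half: "1 \<le> j \<Longrightarrow> weight (half a) j = weight a (Suc j)"
proof -
  assume "1 \<le> j"
  then obtain i where "j = Suc i" by (cases j) auto
  then show ?thesis by (simp add: weight_def half_def div_mult2_eq)
qed

lemma weight_one: "weight a 1 = card (odds a)"
proof -
  have "weight a 1 = (\<Sum>j<length a. if odd (a ! j) then 1 else 0)"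
    unfolding weight_def by (rule sum.cong) (auto simp: odd_iff_mod_2_eq_one)
  also have "\<dots> = card ({..<length a} \<inter> {j. odd (a ! j)})" by (simp add: sum.If_cases)
  also have "{..<length a} \<inter> {j. odd (a ! j)} = odds a" by (auto simp: odds_def)
  finally show ?thesis .
qed

text \<open>This covers the monomials of \<open>Pminus\<close>: the excess stays 0 until the first
  weight below s.\<close>

lemma bad_lex:
  assumes "1 \<le> h" "h \<le> e" "\<And>j. 1 \<le> j \<Longrightarrow> j < h \<Longrightarrow> weight a j = s" "weight a h < s"
  shows "bad s e False a"
  using assms
proof (induction e arbitrary: a h)
  case (Suc e)
  show ?case
  proof (cases "h = 1")
    case True
    then show ?thesis using Suc by (simp add: weight_one[unfolded One_nat_def])
  next
    case False
    then obtain g where g: "h = Suc g" "1 \<le> g" using Suc(2) by (cases h) auto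
    have "card (odds a) = s" using Suc(4)[of 1] False Suc(2) by (simp add: weight_one[unfolded One_nat_def])
    moreover have "bad s e False (half a)"
      by (rule Suc(1)[of g]) (use Suc g in \<open>auto simp: weight_half\<close>)
    ultimately show ?thesis by simp
  qed
qed simp

text \<open>By \<open>pw_weight\<close> these are the partial weight sums that define
  \<open>Pcal\<close>. As sums of residues they can be compared through the quotients by
  2^h.\<close>

definition pw :: "nat \<Rightarrow> nat list \<Rightarrow> nat" where "pw h a = sum_list (map (\<lambda>e. e mod 2 ^ h) a)"

lemma pw_Suc: "pw (Suc h) a = card (odds a) + 2 * pw h (half a)"
proof -
  have m: "e mod 2 ^ Suc h = e mod 2 + 2 * (e div 2 mod 2 ^ h)" for e :: nat
    by (simp add: mod_mult2_eq)
  have "pw (Suc h) a = sum_list (map (\<lambda>e. e mod 2) a) + 2 * pw h (half a)"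
    unfolding pw_def half_def m sum_list_addf sum_list_const_mult by (simp add: o_def)
  moreover have "sum_list (map (\<lambda>e. e mod 2) a) = card (odds a)"
    unfolding weight_one[symmetric] by (simp add: weight_def sum_list_sum_nth atLeast0LessThan)
  ultimately show ?thesis by simp
qed

lemma pw_weight: "pw h a = (\<Sum>j=1..h. 2 ^ (j - 1) * weight a j)"
proof (induction h arbitrary: a)
  case 0
  then show ?case by (simp add: pw_def sum_list_0)
next
  case (Suc h)
  have "(\<Sum>j=1..Suc h. 2 ^ (j - 1) * weight a j) = weight a 1 + (\<Sum>j=Suc 1..Suc h. 2 ^ (j - 1) * weight a j)"
    by (subst sum.atLeast_Suc_atMost) auto
  also have "(\<Sum>j=Suc 1..Suc h. 2 ^ (j - 1) * weight a j) = (\<Sum>j=1..h. 2 ^ j * weight a (Suc j))"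
    unfolding sum.atLeast_Suc_atMost_Suc_shift by (simp add: o_def)
  also have "\<dots> = (\<Sum>j=1..h. 2 * (2 ^ (j - 1) * weight (half a) j))"
  proof (rule sum.cong)
    fix j assume "j \<in> {1..h}"
    then obtain i where "j = Suc i" by (cases j) auto
    then show "2 ^ j * weight a (Suc j) = 2 * (2 ^ (j - 1) * weight (half a) j)"
      by (simp add: weight_half)
  qed simp
  finally show ?case unfolding pw_Suc Suc weight_one by (simp add: sum_distrib_left)
qed

text \<open>Sq^1 is a derivation that annihilates squares, so each summand moves one variable of the
  product into the squared part.\<close>

lemma sq1_X:
  assumes "finite A"
  shows "sq 1 (X A * F^2) = (\<Sum>l\<in>A. X (A - {l}) * (x l * F)^2)"
  using assms
proof (induction A)
  case empty
  then show ?case by (simp add: sq_square)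
next
  case (insert p A)
  have "sq 1 (X (insert p A) * F^2) = x p * sq 1 (X A * F^2) + (x p)^2 * (X A * F^2)"
    using insert sq_x[of 0 p "X A * F^2"] by (simp add: mult.assoc)
  also have "\<dots> = (\<Sum>l\<in>A. x p * (X (A - {l}) * (x l * F)^2)) + X A * (x p * F)^2"
    using insert by (simp add: sum_distrib_left power_mult_distrib ac_simps)
  also have "(\<Sum>l\<in>A. x p * (X (A - {l}) * (x l * F)^2)) = (\<Sum>l\<in>A. X (insert p A - {l}) * (x l * F)^2)"
  proof (rule sum.cong)
    fix l assume "l \<in> A"
    then have "insert p A - {l} = insert p (A - {l})" using insert by auto
    then show "x p * (X (A - {l}) * (x l * F)^2) = X (insert p A - {l}) * (x l * F)^2"
      using insert by (simp add: mult.assoc)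
  qed simp
  finally show ?case using insert by (simp add: add.commute)
qed

context level_degrees begin

lemma low_hit_X: "A \<subseteq> {..<k} \<Longrightarrow> card A < s \<Longrightarrow> F \<in> hom k d \<Longrightarrow> card A + 2 * d = N (Suc e) \<Longrightarrow> X A * F^2 \<in> hits k (N (Suc e))"
  by (metis X_xl low_hit)

lemma square_hit_X: "A \<subseteq> {..<k} \<Longrightarrow> card A = s \<Longrightarrow> y \<in> hits k (N e) \<Longrightarrow> X A * y^2 \<in> hits k (N (Suc e))"
  by (metis X_xl square_hit)

text \<open>A tail of excess 1 has degree \<open>N e - 1\<close> and needs the stronger conclusion;
  the two flags call each other, so both are treated in one induction.\<close>

lemma bad_hit:
  assumes "length a = k"
  shows "(bad s e False a \<longrightarrow> sum_list a = N e \<longrightarrow> ml a \<in> hits k (N e)) \<and>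
         (bad s e True a \<longrightarrow> Suc (sum_list a) = N e \<longrightarrow> ml a \<in> strong_hits k (sum_list a))"
  using assms
proof (induction e arbitrary: a)
  case (Suc e)
  define b where "b = half a"
  have b: "length b = k" using Suc by (simp add: b_def)
  obtain L where L: "set L = odds a" "length L = card (odds a)" "xl L = X (odds a)"
    using X_xl odds_subset[of a] by metis
  have Lk: "set L \<subseteq> {..<k}" using L(1) odds_subset[of a] Suc(2) by simp
  have ml: "ml a = xl L * (ml b)^2" using ml_decomp[OF Suc(2)] by (simp add: L b_def)
  have sm: "sum_list a = length L + 2 * sum_list b" using sum_list_decomp[of a] by (simp add: L b_def)
  have hb: "ml b \<in> hom k (sum_list b)" by (rule hom_ml[OF b])
  note IH = Suc(1)[OF b]
  have e1: "1 \<le> e" if "bad s e d b" for d using that by (cases e) auto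
  show ?case
  proof (intro conjI impI)
    assume bd: "bad s (Suc e) False a" and N: "sum_list a = N (Suc e)"
    then consider "length L < s" | "length L = s" "bad s e False b" | "length L = s + 2" "bad s e True b"
      by (auto simp: L b_def)
    then show "ml a \<in> hits k (N (Suc e))"
    proof cases
      case 1
      then show ?thesis unfolding ml by (intro low_hit[OF Lk _ hb]) (use N sm in auto)
    next
      case 2
      then have "sum_list b = N e" using N sm N_Suc[of e] by simp
      then show ?thesis unfolding ml using IH 2 by (intro square_hit[OF Lk]) auto
    next
      case 3
      then have "Suc (sum_list b) = N e" using N sm N_Suc[of e] by simp
      then show ?thesis unfolding ml using IH 3 by (intro square_strong_hit3[OF Lk, of _ "sum_list b"]) auto
    qed
  next
    assume bd: "bad s (Suc e) True a" and N: "Suc (sum_list a) = N (Suc e)"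
    then consider "length L + 4 \<le> s \<or> length L + 3 \<le> s \<and> 1 \<le> e" | "length L + 1 = s" "bad s e False b" | "length L = s + 1" "bad s e True b"
      by (auto simp: L b_def)
    then show "ml a \<in> strong_hits k (sum_list a)"
    proof cases
      case 1
      then show ?thesis unfolding ml by (intro low_strong_hit[OF Lk hb _ N]) (use sm in auto)
    next
      case 2
      then have "sum_list b = N e" using N sm N_Suc[of e] by simp
      then show ?thesis unfolding ml using IH 2 e1 N by (intro square_strong_hit1[OF Lk, of _ e]) auto
    next
      case 3
      then have "Suc (sum_list b) = N e" using N sm N_Suc[of e] by simp
      then show ?thesis unfolding ml using IH 3 e1 N by (intro square_strong_hit2[OF Lk, of _ "sum_list b" e]) auto
    qed
  qed
qed simp

text \<open>The degree fixes the parity of the first weight w, and w is at most s + 2. From excess 0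
  this leaves w below s, equal to s, or equal to s + 2; from excess 1 it leaves w at most s - 3,
  equal to s - 1, or equal to s + 1. The value s - 3 at the last level is ruled out by the sharper
  last hypothesis, which mirrors the borderline case of \<open>low_strong_hit\<close>.\<close>

lemma bad_pw:
  assumes "length a = k" "sum_list a + (if \<delta> then 1 else 0) = N e" "1 \<le> h" "h \<le> e"
    "pw h a + (if \<delta> then 1 else 0) < s * (2 ^ h - 1)"
    "h = e \<Longrightarrow> 3 \<le> s \<Longrightarrow> pw h a + (if \<delta> then 1 else 0) + 2 ^ h < s * (2 ^ h - 1)"
  shows "bad s e \<delta> a"
  using assms
proof (induction e arbitrary: a h \<delta>)
  case (Suc e)
  define b where "b = half a"
  define w where "w = card (odds a)"
  define d :: nat where "d = (if \<delta> then 1 else 0)"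
  have b: "length b = k" using Suc by (simp add: b_def)
  have w: "w \<le> s + 2" using card_odds_le[of a] Suc(2) ks by (simp add: w_def)
  have sm: "sum_list a = w + 2 * sum_list b" using sum_list_decomp[of a] by (simp add: w_def b_def)
  have N: "w + 2 * sum_list b + d = 2 * N e + s" using Suc(3) sm N_Suc[of e] by (simp add: d_def)
  then have par: "even (w + d) = even s" by presburger
  obtain g where g: "h = Suc g" using Suc(4) by (cases h) auto
  define q where "q = s * (2 ^ g - 1)"
  have sh: "s * (2 ^ h - 1) = s + 2 * q"
  proof -
    define r :: nat where "r = 2 ^ g - 1"
    have "(1::nat) \<le> 2 ^ g" by simp
    then have "(2::nat) ^ h - 1 = 1 + 2 * r" unfolding g power_Suc r_def by arith
    moreover have "q = s * r" by (simp only: q_def r_def)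
    ultimately show ?thesis by (simp only: distrib_left mult_1_right mult.left_commute)
  qed
  have pwh: "pw h a = w + 2 * pw g b" unfolding g pw_Suc by (simp add: w_def b_def)
  have lt: "w + 2 * pw g b + d < s + 2 * q" using Suc(6) sh pwh by (simp add: d_def)
  have lt2: "w + 2 * pw g b + d + 2 * 2 ^ g < s + 2 * q" if "g = e" "3 \<le> s"
    using Suc(7) sh pwh that g by (simp add: d_def)
  have pw0: "pw 0 b = 0" by (simp add: pw_def sum_list_0)
  have rec: "bad s e \<delta>' b" if "w + d = s + 2 * d'" "d' = (if \<delta>' then 1 else 0)" "1 \<le> g" for \<delta>' d'
  proof (rule Suc(1)[OF b, of _ g])
    show "sum_list b + (if \<delta>' then 1 else 0) = N e" using N that by simp
    show "pw g b + (if \<delta>' then 1 else 0) < s * (2 ^ g - 1)" using lt that by (simp add: q_def)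
    show "pw g b + (if \<delta>' then 1 else 0) + 2 ^ g < s * (2 ^ g - 1)" if "g = e" "3 \<le> s"
      using lt2[OF that] \<open>w + d = s + 2 * d'\<close> \<open>d' = _\<close> by (simp add: q_def)
  qed (use that g Suc in auto)
  have g0: "w + d < s" if "g = 0" using lt that by (simp add: q_def)
  show ?case
  proof (cases \<delta>)
    case False
    then have d: "d = 0" by (simp add: d_def)
    consider "w < s" | "w = s" "1 \<le> g" | "w = s + 2" "1 \<le> g"
    proof -
      have "w \<noteq> s + 1" using par d by auto
      then show ?thesis using that w g0 d by (cases "g = 0") force+
    qed
    then show ?thesis
    proof cases
      case 1 then show ?thesis using False by (simp add: w_def)
    next
      case 2 then show ?thesis using rec[of 0 False] False d by (simp add: w_def b_def)
    next
      case 3 then show ?thesis using rec[of 1 True] False d by (simp add: w_def b_def)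
    qed
  next
    case True
    then have d: "d = 1" by (simp add: d_def)
    consider "w + 4 \<le> s" | "w + 3 = s" | "w + 1 = s" "1 \<le> g" | "w = s + 1" "1 \<le> g"
    proof -
      have "w \<noteq> s + 2" "w \<noteq> s" "w + 2 \<noteq> s" using par d by auto
      then have "w + 4 \<le> s \<or> w + 3 = s \<or> w + 1 = s \<or> w = s + 1" using w by arith
      then show ?thesis using that g0 d by (cases "g = 0") auto
    qed
    then show ?thesis
    proof cases
      case 1 then show ?thesis using True by (simp add: w_def)
    next
      case 2
      have "1 \<le> e"
      proof (rule ccontr)
        assume "\<not> 1 \<le> e"
        then have "e = 0" "g = 0" using g Suc(5) by auto
        then show False using lt2 2 d by (simp add: q_def)
      qed
      then show ?thesis using True 2 by (simp add: w_def)
    next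
      case 3 then show ?thesis using rec[of 0 False] True d by (simp add: w_def b_def)
    next
      case 4 then show ?thesis using rec[of 1 True] True d by (simp add: w_def b_def)
    qed
  qed
qed simp

section \<open>Reduction to monomials whose lowest weights equal s\<close>

fun level_pure :: "nat \<Rightarrow> nat list \<Rightarrow> bool" where
  "level_pure 0 a = True"
| "level_pure (Suc j) a = (card (odds a) = s \<and> level_pure j (half a))"

definition pure_mod :: "nat \<Rightarrow> nat \<Rightarrow> f2poly set" where
  "pure_mod j e = aspan ({ml a | a. length a = k \<and> sum_list a = N e \<and> level_pure j a} \<union> hits k (N e))"

lemma pure_mod_square:
  assumes A: "A \<subseteq> {..<k}" "card A = s" and F: "F \<in> pure_mod j e"
  shows "X A * F^2 \<in> pure_mod (Suc j) (Suc e)"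
  unfolding pure_mod_def
proof (rule aspan_image[OF F[unfolded pure_mod_def], of "\<lambda>F. X A * F^2"])
  fix t assume "t \<in> {ml a | a. length a = k \<and> sum_list a = N e \<and> level_pure j a} \<union> hits k (N e)"
  then consider a where "t = ml a" "length a = k" "sum_list a = N e" "level_pure j a" | "t \<in> hits k (N e)" by blast
  then have "X A * t^2 \<in> {ml a | a. length a = k \<and> sum_list a = N (Suc e) \<and> level_pure (Suc j) a} \<union> hits k (N (Suc e))"
  proof cases
    case 1
    have "X A * t^2 = ml (comb k A a)" using ml_comb[OF A(1)] 1 by simp
    moreover have "sum_list (comb k A a) = N (Suc e)" using sum_list_comb[OF A(1)] 1 A N_Suc[of e] by simp
    moreover have "level_pure (Suc j) (comb k A a)" using 1 A by (simp add: odds_comb half_comb)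
    ultimately show ?thesis by fastforce
  next
    case 2
    then show ?thesis using square_hit_X[OF A] by blast
  qed
  then show "X A * t^2 \<in> aspan ({ml a | a. length a = k \<and> sum_list a = N (Suc e) \<and> level_pure (Suc j) a} \<union> hits k (N (Suc e)))"
    by (rule aspan_base)
qed (auto simp: f2_square_add distrib_left)

text \<open>Sq^1 is applied to the product of all variables but q, times the square of X y^2 with X
  the product of all variables but p. The summand that moves p has second weight s + 2; in every
  other summand the inner product misses p and l, so the first two weights are both s.\<close>

lemma full_square_relation:
  assumes pq: "p < k" "q < k" "p \<noteq> q" and y: "y \<in> hom k d" and d: "k + 2 * d = N e"
  shows "X ({..<k} - {p,q}) * (X {..<k} * y^2)^2 +
     (\<Sum>l\<in>{..<k} - {p,q}. X ({..<k} - {q,l}) * (X ({..<k} - {p,l}) * (x l * y)^2)^2) \<in> hits k (N (Suc e))"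
proof -
  define A where "A = {..<k} - {q}"
  define F where "F = X ({..<k} - {p}) * y^2"
  have A: "finite A" "A \<subseteq> {..<k}" "card A = k - 1" using pq by (auto simp: A_def)
  have xF: "x l * F = X ({..<k} - {p,l}) * (x l * y)^2" if "l < k" "l \<noteq> p" for l
  proof -
    have "{..<k} - {p} = insert l ({..<k} - {p,l})" using that by auto
    then have "X ({..<k} - {p}) = x l * X ({..<k} - {p,l})" by (simp del: insert_Diff_single)
    then show ?thesis by (simp add: F_def power_mult_distrib power2_eq_square ac_simps)
  qed
  have xp: "x p * F = X {..<k} * y^2"
  proof -
    have "{..<k} = insert p ({..<k} - {p})" using pq by auto
    then have "X {..<k} = x p * X ({..<k} - {p})" by (metis Diff_iff finite_Diff finite_lessThan insertI1 prod.insert)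
    then show ?thesis by (simp add: F_def ac_simps)
  qed
  have "F \<in> hom k (card ({..<k} - {p}) + 2 * d)"
    unfolding F_def using hom_X[of "{..<k} - {p}" k] hom_power[OF y, of 2] by (auto intro: hom_mult)
  then have F: "F \<in> hom k (k - 1 + 2 * d)" using pq by simp
  have "X A * F^2 \<in> hom k ((k - 1) + 2 * (k - 1 + 2 * d))"
    using hom_mult[OF hom_X[OF A(2)] hom_power[OF F, of 2]] A(3) by simp
  then have "sq 1 (X A * F^2) \<in> hits k (N (Suc e))"
    by (rule hits_sq[rotated]) (use d N_Suc[of e] ks in auto)
  moreover have "sq 1 (X A * F^2) = X (A - {p}) * (x p * F)^2 + (\<Sum>l\<in>A - {p}. X (A - {l}) * (x l * F)^2)"
    unfolding sq1_X[OF A(1)] by (rule sum.remove) (use pq A in \<open>auto simp: A_def\<close>)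
  moreover have "A - {p} = {..<k} - {p,q}" by (auto simp: A_def)
  moreover have "(\<Sum>l\<in>{..<k} - {p,q}. X (A - {l}) * (x l * F)^2) =
     (\<Sum>l\<in>{..<k} - {p,q}. X ({..<k} - {q,l}) * (X ({..<k} - {p,l}) * (x l * y)^2)^2)"
    by (rule sum.cong) (auto simp: xF A_def Diff_insert2[symmetric] insert_commute)
  ultimately show ?thesis using xp by simp
qed

lemma two_missing:
  assumes "A \<subseteq> {..<k}" "card A = s"
  obtains p q where "p < q" "q < k" "A = {..<k} - {p,q}"
proof -
  have "card ({..<k} - A) = 2" using assms ks by (simp add: card_Diff_subset finite_subset)
  then obtain p q where pq: "{..<k} - A = {p, q}" "p \<noteq> q" by (auto simp: card_2_iff)
  have "A = {..<k} - {p,q}" using pq assms(1) by blast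
  moreover have "p < k" "q < k" using pq by auto
  ultimately show ?thesis using that pq(2) by (metis insert_commute nat_neq_iff)
qed

lemma card_minus_two: "p < k \<Longrightarrow> q < k \<Longrightarrow> p \<noteq> q \<Longrightarrow> card ({..<k} - {p,q}) = s"
  using ks by (simp add: card_Diff_subset)

text \<open>A monomial of first weight below s is hit. If the first weight is s, parity leaves
  second weights at most s or equal to s + 2; the latter are traded by
  \<open>full_square_relation\<close> for second weight s, and the induction hypothesis applies to
  the tails.\<close>

lemma reduce_to_pure:
  assumes "length a = k" "sum_list a = N e" "card (odds a) \<le> s" "j \<le> e"
  shows "ml a \<in> pure_mod j e"
  using assms
proof (induction j arbitrary: e a)
  case 0
  then show ?case unfolding pure_mod_def by (intro aspan_base) auto
next
  case (Suc j)
  obtain e' where e: "e = Suc e'" using Suc by (cases e) auto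
  define b where "b = half a"
  have b: "length b = k" using Suc by (simp add: b_def)
  have ml: "ml a = X (odds a) * (ml b)^2" using ml_decomp[OF Suc(2)] by (simp add: b_def)
  have sm: "sum_list a = card (odds a) + 2 * sum_list b" using sum_list_decomp[of a] by (simp add: b_def)
  have A: "odds a \<subseteq> {..<k}" using odds_subset[of a] Suc by simp
  show ?case
  proof (cases "card (odds a) < s")
    case True
    then have "ml a \<in> hits k (N e)"
      unfolding ml e by (intro low_hit_X[OF A _ hom_ml[OF b]]) (use Suc sm e in auto)
    then show ?thesis unfolding pure_mod_def by (intro aspan_base) auto
  next
    case False
    then have cs: "card (odds a) = s" using Suc by simp
    then have sb: "sum_list b = N e'" using sm Suc(3) N_Suc[of e'] e by simp
    show ?thesis
    proof (cases "j = 0 \<or> card (odds b) \<le> s")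
      case True
      then have "ml b \<in> pure_mod j e'"
      proof
        assume "j = 0"
        then show ?thesis unfolding pure_mod_def using b sb by (intro aspan_base) auto
      next
        assume "card (odds b) \<le> s"
        then show ?thesis using Suc(5) e by (intro Suc(1)[OF b sb]) auto
      qed
      then show ?thesis unfolding ml e by (rule pure_mod_square[OF A cs])
    next
      case False
      then obtain e'' where e'': "e' = Suc e''" using Suc(5) e by (cases e') auto
      define y where "y = half b"
      have y: "length y = k" using b by (simp add: y_def)
      have "card (odds b) = s + 2"
      proof -
        have "card (odds b) + 2 * sum_list y = 2 * N e'' + s"
          using sum_list_decomp[of b] sb N_Suc[of e''] e'' by (simp add: y_def)
        moreover have "card (odds b) \<le> s + 2" using card_odds_le[of b] b ks by simp
        ultimately show ?thesis using False by presburger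
      qed
      then have ob: "odds b = {..<k}" using odds_subset[of b] b ks by (intro card_subset_eq) auto
      have mlb: "ml b = X {..<k} * (ml y)^2" using ml_decomp[OF b] ob by (simp add: y_def)
      have dy: "k + 2 * sum_list y = N e'" using sum_list_decomp[of b] ob sb by (simp add: y_def)
      obtain p q where pq: "p < q" "q < k" "odds a = {..<k} - {p,q}" using two_missing[OF A cs] by metis
      let ?t = "\<lambda>l. X ({..<k} - {q,l}) * (X ({..<k} - {p,l}) * (x l * ml y)^2)^2"
      have rel: "ml a + (\<Sum>l\<in>{..<k} - {p,q}. ?t l) \<in> hits k (N e)"
        unfolding ml mlb pq(3) e
        by (rule full_square_relation[OF _ pq(2) _ hom_ml[OF y] dy]) (use pq in auto)
      have "?t l \<in> pure_mod (Suc j) e" if l: "l \<in> {..<k} - {p,q}" for l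
      proof -
        define y' where "y' = map (\<lambda>i. (if i = l then 1 else 0) + y ! i) [0..<k]"
        have y': "length y' = k" by (simp add: y'_def)
        have "ml y' = X {l} * ml y"
          unfolding y'_def ml_plus using X_ml[of "{l}" k] l y map_nth[of y] by simp
        then have xly: "x l * ml y = ml y'" by simp
        define c where "c = comb k ({..<k} - {p,l}) y'"
        have lk: "l < k" "p < k" "p \<noteq> l" "q \<noteq> l" using l pq by auto
        have cA: "{..<k} - {p,l} \<subseteq> {..<k}" "card ({..<k} - {p,l}) = s"
          using card_minus_two[OF lk(2,1,3)] by blast+
        have sy': "sum_list y' = Suc (sum_list y)"
        proof -
          have "sum_list y' = (\<Sum>i<k. (if i = l then 1 else 0) + y ! i)"
            by (simp add: y'_def sum_list_sum_nth atLeast0LessThan)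
          also have "\<dots> = Suc (sum_list y)" using l y by (simp add: sum.distrib sum_list_sum_nth atLeast0LessThan)
          finally show ?thesis .
        qed
        have "ml c \<in> pure_mod j e'"
        proof (rule Suc(1))
          show "length c = k" by (simp add: c_def)
          show "sum_list c = N e'" unfolding c_def sum_list_comb[OF cA(1) y'] using cA sy' dy ks by simp
          show "card (odds c) \<le> s" unfolding c_def odds_comb[OF cA(1)] using cA by simp
          show "j \<le> e'" using Suc(5) e by simp
        qed
        moreover have "ml c = X ({..<k} - {p,l}) * (x l * ml y)^2"
          unfolding c_def ml_comb[OF cA(1) y'] xly ..
        ultimately show ?thesis unfolding e
          using pure_mod_square[OF Diff_subset card_minus_two[OF pq(2) lk(1,4)], of "ml c" j e'] by simp
      qed
      then have 1: "(\<Sum>l\<in>{..<k} - {p,q}. ?t l) \<in> pure_mod (Suc j) e"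
        unfolding pure_mod_def by (rule aspan_sum)
      have 2: "ml a + (\<Sum>l\<in>{..<k} - {p,q}. ?t l) \<in> pure_mod (Suc j) e"
        using rel unfolding pure_mod_def by (intro aspan_base) auto
      show ?thesis using aspan_cancel[OF 2[unfolded pure_mod_def] 1[unfolded pure_mod_def]] unfolding pure_mod_def .
    qed
  qed
qed

end

section \<open>Minimal spikes\<close>

abbreviation val :: "nat list \<Rightarrow> nat" where "val es \<equiv> sum_list (map (\<lambda>e. 2 ^ e - 1) es)"

text \<open>The shape conditions of \<open>minspike_exps\<close> without the length
  \<open>mu n\<close>: only the last two entries may agree.\<close>

definition std :: "nat list \<Rightarrow> bool" where
  "std es \<longleftrightarrow> (\<forall>x\<in>set es. 0 < x) \<and> (\<forall>i. i + 1 < length es \<longrightarrow> es ! (i + 1) \<le> es ! i) \<and>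
     (\<forall>i. i + 2 < length es \<longrightarrow> es ! (i + 1) < es ! i)"

lemma std_Cons: "std (e # es) \<Longrightarrow> std es"
  unfolding std_def by (auto dest: spec[where x = "Suc _"])

text \<open>Together with \<open>val_Cons_ge\<close> this places the value between 2^e - 1 and
  2^(e+1) - 2, so the value determines the largest exponent and uniqueness follows greedily.\<close>

lemma std_bound: "std (e # es) \<Longrightarrow> val (e # es) + 2 \<le> 2 ^ (e + 1)"
proof (induction es arbitrary: e)
  case Nil
  then have "0 < e" by (simp add: std_def)
  then obtain d where "e = Suc d" by (cases e) auto
  moreover have "(1::nat) \<le> 2 ^ d" by simp
  ultimately show ?case by simp
next
  case (Cons f es)
  have IH: "val (f # es) + 2 \<le> 2 ^ (f + 1)" using Cons std_Cons by blast
  have fe: "f \<le> e" using Cons(2) unfolding std_def by (auto dest!: spec[of _ 0])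
  show ?case
  proof (cases es)
    case Nil
    have "(2::nat) ^ f \<le> 2 ^ e" using fe by (intro power_increasing) auto
    moreover have "(1::nat) \<le> 2 ^ f" "(1::nat) \<le> 2 ^ e" by simp_all
    moreover have "val (e # f # es) = (2 ^ e - 1) + (2 ^ f - 1)" using Nil by simp
    moreover have "(2::nat) ^ (e + 1) = 2 * 2 ^ e" by simp
    ultimately show ?thesis by linarith
  next
    case (Cons g gs)
    have "f < e" using \<open>std (e # f # es)\<close> Cons unfolding std_def by (auto dest!: spec[of _ 0])
    then have "(2::nat) ^ (f + 1) \<le> 2 ^ e" by (intro power_increasing) auto
    moreover have "(1::nat) \<le> 2 ^ e" by simp
    moreover have "val (e # f # es) = (2 ^ e - 1) + val (f # es)" by simp
    moreover have "(2::nat) ^ (e + 1) = 2 * 2 ^ e" by simp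
    ultimately show ?thesis using IH by linarith
  qed
qed

lemma val_Cons_ge: "2 ^ e \<le> val (e # es) + 1" by simp

lemma std_unique: "std es \<Longrightarrow> std fs \<Longrightarrow> val es = val fs \<Longrightarrow> es = fs"
proof (induction es arbitrary: fs)
  case Nil
  show ?case
  proof (cases fs)
    case (Cons f gs)
    then have "0 < f" using Nil by (simp add: std_def)
    then have "(2::nat) ^ 1 \<le> 2 ^ f" by (intro power_increasing) auto
    then show ?thesis using Nil Cons by simp
  qed simp
next
  case (Cons e es)
  show ?case
  proof (cases fs)
    case Nil
    have "0 < e" using Cons by (simp add: std_def)
    then have "(2::nat) ^ 1 \<le> 2 ^ e" by (intro power_increasing) auto
    then show ?thesis using Nil Cons by simp
  next
    case fs: (Cons f gs)
    have le: False if "a < b" "std (a # as)" "val (a # as) = val (b # bs)" for a b as bs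
    proof -
      have "(2::nat) ^ (a + 1) \<le> 2 ^ b" using that by (intro power_increasing) auto
      then show False using std_bound[OF that(2)] that(3) val_Cons_ge[of b bs] by linarith
    qed
    have "e = f" using le[of e f es gs] le[of f e gs es] Cons fs by (metis nat_neq_iff)
    have "(2 ^ e - 1) + val es = (2 ^ f - 1) + val gs" using Cons(4) fs by simp
    then have "val es = val gs" unfolding \<open>e = f\<close> by (rule add_left_imp_eq)
    then have "es = gs" using Cons(1)[of gs] std_Cons[OF Cons(2)] std_Cons[of f gs] Cons(3) fs by blast
    then show ?thesis using \<open>e = f\<close> fs by simp
  qed
qed

text \<open>
  Replacing e, e, f (with f > 0) by e + 1, f - 1, f - 1 keeps the value and increases the sum of the
  4^e, so a representation that maximises this sum has the required shape.
\<close>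

lemma std_exists: "\<exists>es. std es \<and> length es \<le> length us \<and> val es = val us"
proof -
  define S where "S = {vs. length vs = length us \<and> val vs = val us}"
  \<comment> \<open>Subtracting 1 makes zero entries weightless, so deleting them or padding with
    them does not change \<open>q\<close>.\<close>
  define q where "q vs = sum_list (map (\<lambda>v. 4 ^ v - (1::nat)) vs)" for vs :: "nat list"
  have "S \<subseteq> {vs. set vs \<subseteq> {..val us} \<and> length vs = length us}"
  proof
    fix vs assume vs: "vs \<in> S"
    have "v \<le> val us" if "v \<in> set vs" for v
    proof -
      have "v < 2 ^ v" by simp
      then have "v \<le> 2 ^ v - 1" by linarith
      also have "\<dots> \<le> val vs" using that by (intro member_le_sum_list) auto
      finally show ?thesis using vs by (simp add: S_def)
    qed
    then show "vs \<in> {vs. set vs \<subseteq> {..val us} \<and> length vs = length us}" using vs by (auto simp: S_def)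
  qed
  then have fin: "finite S" by (rule finite_subset) (rule finite_lists_length_eq, simp)
  have "us \<in> S" by (simp add: S_def)
  then have "Max (q ` S) \<in> q ` S" using fin by (intro Max_in) auto
  then obtain vs where vs: "vs \<in> S" and qvs: "Max (q ` S) = q vs" by (rule imageE) blast
  have vmax: "q ws \<le> q vs" if "ws \<in> S" for ws
    unfolding qvs[symmetric] using fin that by (intro Max_ge) auto
  define es where "es = rev (sort (filter (\<lambda>v. v > 0) vs))"
  have ms: "mset es = mset (filter (\<lambda>v. v > 0) vs)" by (simp add: es_def)
  have transfer: "sum_list (map f es) = sum_list (map f vs)" if "f 0 = 0" for f :: "nat \<Rightarrow> nat"
  proof -
    have "sum_list (map f es) = sum_list (map f (filter (\<lambda>v. v > 0) vs))"
      using arg_cong[OF ms, of "\<lambda>M. sum_mset (image_mset f M)"] unfolding mset_map[symmetric] sum_mset_sum_list .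
    also have "\<dots> = sum_list (map f vs)" using that by (intro sum_list_map_filter) auto
    finally show ?thesis .
  qed
  have len: "length es \<le> length us" using vs by (simp add: es_def S_def) (metis length_filter_le)
  have "std es"
    unfolding std_def
  proof (intro conjI allI impI)
    show "\<forall>x\<in>set es. 0 < x" by (auto simp: es_def)
  next
    fix i assume "i + 1 < length es"
    then show "es ! (i + 1) \<le> es ! i" by (intro sorted_rev_nth_mono) (auto simp: es_def)
  next
    fix i assume i: "i + 2 < length es"
    show "es ! (i + 1) < es ! i"
    proof (rule ccontr)
      assume "\<not> es ! (i + 1) < es ! i"
      moreover have "es ! (i + 1) \<le> es ! i" using i by (intro sorted_rev_nth_mono) (auto simp: es_def)
      ultimately have eq: "es ! (i + 1) = es ! i" by simp
      define e where "e = es ! i"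
      define f where "f = es ! (i + 2)"
      have fe: "f \<le> e" unfolding e_def f_def using i by (intro sorted_rev_nth_mono) (auto simp: es_def)
      have "f \<in> set es" using i by (simp add: f_def)
      then have f0: "0 < f" by (auto simp: es_def)
      then obtain f' where f': "f = Suc f'" by (cases f) auto
      have split: "es = take i es @ [e, e, f] @ drop (i + 3) es"
      proof -
        have "es = take i es @ drop i es" by simp
        also have "drop i es = es ! i # es ! (i + 1) # es ! (i + 2) # drop (i + 3) es"
          using i by (simp add: Cons_nth_drop_Suc numeral_eq_Suc flip: Suc_eq_plus1)
        finally show ?thesis using eq by (simp add: e_def f_def)
      qed
      \<comment> \<open>The zeros restore the length of \<open>us\<close>, so that the modified list
        competes for the maximum over \<open>S\<close>.\<close>
      define ws where "ws = take i es @ [e + 1, f', f'] @ drop (i + 3) es @ replicate (length us - length es) 0"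
      have fws: "sum_list (map f ws) = sum_list (map f (take i es)) + sum_list (map f (drop (i + 3) es)) + (f (e + 1) + 2 * f f')"
        if "f 0 = 0" for f :: "nat \<Rightarrow> nat" using that by (simp add: ws_def sum_list_replicate)
      have fes: "sum_list (map g es) = sum_list (map g (take i es)) + sum_list (map g (drop (i + 3) es)) + (g e + g e + g f)"
        for g :: "nat \<Rightarrow> nat" by (subst split) simp
      have "length ws = length us" using len i by (simp add: ws_def)
      moreover have "val ws = val us"
      proof -
        have "val ws = val (take i es) + val (drop (i + 3) es) + (2 ^ (e + 1) - 1 + 2 * (2 ^ f' - 1))"
          by (rule fws) simp
        also have "2 ^ (e + 1) - 1 + 2 * (2 ^ f' - 1) = (2 ^ e - 1) + (2 ^ e - 1) + ((2::nat) ^ f - 1)"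
        proof -
          have "(1::nat) \<le> 2 ^ e" "(1::nat) \<le> 2 ^ f'" by simp_all
          then show ?thesis unfolding f' power_add power_Suc power_one_right by linarith
        qed
        also have "val (take i es) + val (drop (i + 3) es) + \<dots> = val es"
          by (rule fes[symmetric])
        also have "val es = val vs" by (rule transfer) simp
        finally show ?thesis using vs by (simp add: S_def)
      qed
      ultimately have "q ws \<le> q vs" by (intro vmax) (simp add: S_def)
      moreover have "q vs < q ws"
      proof -
        have "q vs = q es" unfolding q_def by (rule transfer[symmetric]) simp
        also have "\<dots> = q (take i es) + q (drop (i + 3) es) + ((4 ^ e - 1) + (4 ^ e - 1) + (4 ^ f - 1))"
          unfolding q_def by (rule fes)
        also have "(4 ^ e - 1) + (4 ^ e - 1) + ((4::nat) ^ f - 1) < 4 ^ (e + 1) - 1 + 2 * (4 ^ f' - 1)"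
        proof -
          have "(4::nat) ^ f \<le> 4 ^ e" using fe by (intro power_increasing) auto
          moreover have "(1::nat) \<le> 4 ^ e" "(1::nat) \<le> 4 ^ f'" by simp_all
          ultimately show ?thesis unfolding f' power_add power_Suc power_one_right by linarith
        qed
        also have "q (take i es) + q (drop (i + 3) es) + (4 ^ (e + 1) - 1 + 2 * (4 ^ f' - 1)) = q ws"
          unfolding q_def by (rule fws[symmetric]) simp
        finally show ?thesis by simp
      qed
      ultimately show False by simp
    qed
  qed
  moreover have "val es = val vs" by (rule transfer) simp
  ultimately show ?thesis using len vs by (auto simp: S_def)
qed

lemma val_length: "val us + length us = sum_list (map (\<lambda>u. 2 ^ u) us)"
proof (induction us)
  case (Cons u us)
  have "(1::nat) \<le> 2 ^ u" by simp
  then show ?case using Cons unfolding list.map sum_list.Cons list.size by linarith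
qed simp

lemma rep_val: "rep n r \<longleftrightarrow> (\<exists>us. length us = r \<and> n = val us)"
  unfolding rep_def by (metis add_right_cancel val_length)

text \<open>By \<open>std_exists\<close> a shorter sum would yield a shorter list of the same shape
  and value, against \<open>std_unique\<close>.\<close>

lemma not_rep_std: "std es \<Longrightarrow> r < length es \<Longrightarrow> \<not> rep (val es) r"
  unfolding rep_val by (metis std_exists std_unique leD)

lemma minspike_exps_std:
  assumes es: "std es" shows "minspike_exps (val es) = es"
proof -
  have "mu (val es) = length es"
    unfolding mu_def
  proof (rule Least_equality)
    show "\<exists>u. length u = length es \<and> (\<forall>x\<in>set u. 0 < x) \<and> val es = val u"
      using es by (auto simp: std_def)
  next
    fix r assume "\<exists>u. length u = r \<and> (\<forall>x\<in>set u. 0 < x) \<and> val es = val u"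
    then have "rep (val es) r" by (auto simp: rep_val)
    then show "length es \<le> r" using not_rep_std[OF es] by (meson not_less)
  qed
  then show ?thesis
    unfolding minspike_exps_def
    by (intro the_equality) (use es std_unique in \<open>auto simp: std_def\<close>)
qed

section \<open>Partial weights compared with the minimal spike\<close>

lemma pw_divmod: "sum_list a = pw h a + 2 ^ h * sum_list (map (\<lambda>e. e div 2 ^ h) a)"
  unfolding pw_def sum_list_const_mult[symmetric] sum_list_addf[symmetric] by simp

lemma pw_le: "pw h a \<le> sum_list a" using pw_divmod[of a h] by simp

lemma pw_mono: "h \<le> h' \<Longrightarrow> pw h a \<le> pw h' a"
  unfolding pw_def
proof (rule sum_list_mono)
  fix e :: nat assume "h \<le> h'"
  then have "e mod 2 ^ h = e mod 2 ^ h' mod 2 ^ h" by (simp add: mod_mod_cancel le_imp_power_dvd)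
  then show "e mod 2 ^ h \<le> e mod 2 ^ h'" by (metis mod_less_eq_dividend)
qed

lemma sum_list_le_const: "(\<And>e. e \<in> set xs \<Longrightarrow> f e \<le> (c::nat)) \<Longrightarrow> sum_list (map f xs) \<le> length xs * c"
  by (induction xs) (auto simp: add_le_mono)

lemma sum_list_less_const: "(\<And>e. e \<in> set xs \<Longrightarrow> f e \<le> (c::nat)) \<Longrightarrow> z \<in> set xs \<Longrightarrow> f z < c \<Longrightarrow> sum_list (map f xs) < length xs * c"
proof (induction xs)
  case (Cons y xs)
  show ?case
  proof (cases "z = y")
    case True
    then show ?thesis using Cons sum_list_le_const[of xs f c] by (simp add: add_less_le_mono)
  next
    case False
    then show ?thesis using Cons by (simp add: add_le_less_mono)
  qed
qed simp

text \<open>If the drop below the spike occurs before level d0, that level serves. Otherwise it is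
  pulled back to d0, and for s at least 3 the sharper bound means that the quotients of the entries
  of \<open>y\<close> by 2^d0 add up to at least 2. At h0 = d0 the spike itself contributes at least
  1, and \<open>y\<close> must exceed it; for larger h0 some entry of \<open>y\<close> is at least
  2^(d0+1).\<close>

lemma pcal_level:
  assumes s: "2 \<le> s" and d0: "1 \<le> d0" and y: "sum_list y = s * (2 ^ d0 - 1)" and h0: "1 \<le> h0"
    and lt: "pw h0 y < pw h0 (minspike (s * (2 ^ d0 - 1)))"
  shows "\<exists>h. 1 \<le> h \<and> h \<le> d0 \<and> pw h y < s * (2 ^ h - 1) \<and> (h = d0 \<longrightarrow> 3 \<le> s \<longrightarrow> pw h y + 2 ^ h < s * (2 ^ h - 1))"
proof -
  let ?T = "s * (2 ^ d0 - 1)"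
  obtain es where es: "std es" "length es \<le> s" "val es = ?T"
    using std_exists[of "replicate s d0"] by (auto simp: sum_list_replicate)
  define z where "z = minspike ?T"
  have z: "z = map (\<lambda>e. 2 ^ e - 1) es" unfolding z_def minspike_def using minspike_exps_std[OF es(1)] es(3) by simp
  have sz: "sum_list z = ?T" using z es(3) by simp
  have pz: "pw h z \<le> s * (2 ^ h - 1)" for h
  proof -
    have "(e::nat) mod 2 ^ h \<le> 2 ^ h - 1" for e
    proof -
      have "e mod 2 ^ h < 2 ^ h" by simp
      then show ?thesis by linarith
    qed
    then have "pw h z \<le> length z * (2 ^ h - 1)" unfolding pw_def by (intro sum_list_le_const) auto
    also have "\<dots> \<le> s * (2 ^ h - 1)" using es(2) z by (intro mult_right_mono) auto
    finally show ?thesis .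
  qed
  show ?thesis
  proof (cases "h0 < d0")
    case True
    then show ?thesis using lt pz[of h0] h0 unfolding z_def[symmetric] by (intro exI[of _ h0]) auto
  next
    case False
    let ?dv = "\<lambda>h a. sum_list (map (\<lambda>e. e div 2 ^ h) a)"
    have ltT: "pw h0 y < ?T" using lt pw_le[of h0 z] sz by (simp add: z_def)
    then have 1: "pw d0 y < ?T" using pw_mono[of d0 h0 y] False by simp
    have 2: "pw d0 y + 2 ^ d0 < ?T" if s3: "3 \<le> s"
    proof -
      have "2 \<le> ?dv d0 y"
      proof (cases "h0 = d0")
        case True
        have "\<exists>e\<in>set es. d0 < e"
        proof (rule ccontr)
          assume "\<not> (\<exists>e\<in>set es. d0 < e)"
          then have le: "e \<le> d0" if "e \<in> set es" for e using that by (meson not_less)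
          have le': "2 ^ e - 1 \<le> (2::nat) ^ d0 - 1" if "e \<in> set es" for e
            using le[OF that] by (intro diff_le_mono power_increasing) auto
          have c: "(1::nat) \<le> 2 ^ d0 - 1"
            using power_increasing[OF d0, of "2::nat"] by simp
          have "length es = s"
          proof (rule ccontr)
            assume "length es \<noteq> s"
            then have "length es + 1 \<le> s" using es(2) by simp
            have "?T \<le> length es * (2 ^ d0 - 1)" unfolding es(3)[symmetric] by (rule sum_list_le_const[OF le'])
            then have "s \<le> length es" using c by simp
            then show False using \<open>length es + 1 \<le> s\<close> by simp
          qed
          \<comment> \<open>With three or more entries the first two entries of a \<open>std\<close>
            list differ, so s exponents bounded by d0 cannot reach the full value.\<close>
          then have "es ! 1 < es ! 0" "1 < length es" using es(1) s3 by (auto simp: std_def dest!: spec[of _ 0])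
          moreover have "es ! 0 \<le> d0" using le[of "es ! 0"] calculation by (meson dual_order.strict_trans nth_mem zero_less_one)
          ultimately have "(2::nat) ^ (es ! 1) < 2 ^ d0" by (intro power_strict_increasing) auto
          moreover have "(1::nat) \<le> 2 ^ (es ! 1)" by simp
          ultimately have "2 ^ (es ! 1) - 1 < (2::nat) ^ d0 - 1" by linarith
          then have "?T < length es * (2 ^ d0 - 1)" unfolding es(3)[symmetric]
            using \<open>1 < length es\<close> by (intro sum_list_less_const[OF le', where z = "es ! 1"]) auto
          then show False using \<open>length es = s\<close> by simp
        qed
        then obtain e where e: "e \<in> set es" "d0 < e" by blast
        have "(2::nat) ^ d0 < 2 ^ e" using e(2) by (intro power_strict_increasing) auto
        then have "2 ^ d0 \<le> (2::nat) ^ e - 1" by linarith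
        then have "1 \<le> ((2::nat) ^ e - 1) div 2 ^ d0" by (simp add: div_greater_zero_iff Suc_le_eq)
        also have "\<dots> \<le> ?dv d0 z" using e(1) by (intro member_le_sum_list) (auto simp: z)
        finally have "1 \<le> ?dv d0 z" .
        moreover have "2 ^ d0 * ?dv d0 z < 2 ^ d0 * ?dv d0 y"
          using lt pw_divmod[of z d0] pw_divmod[of y d0] sz y unfolding z_def[symmetric] True by linarith
        ultimately show ?thesis by simp
      next
        case h0d: False
        then have "d0 + 1 \<le> h0" using False by simp
        have "?dv h0 y \<noteq> 0"
        proof
          assume 0: "?dv h0 y = 0"
          show False using ltT pw_divmod[of y h0] unfolding y 0 mult_0_right by linarith
        qed
        then obtain e where e: "e \<in> set y" "e div 2 ^ h0 \<noteq> 0"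
          by (metis (mono_tags, lifting) sum_list_0 map_eq_conv)
        have "(2::nat) ^ (d0 + 1) \<le> 2 ^ h0" using \<open>d0 + 1 \<le> h0\<close> by (intro power_increasing) auto
        also have "\<dots> \<le> e" using e(2) by (meson div_less not_less)
        finally have "2 * 2 ^ d0 \<le> e" by simp
        then have "2 \<le> e div 2 ^ d0" by (simp add: less_eq_div_iff_mult_less_eq)
        also have "\<dots> \<le> ?dv d0 y" using e(1) by (intro member_le_sum_list) auto
        finally show ?thesis .
      qed
      then have "2 ^ d0 * 2 \<le> 2 ^ d0 * ?dv d0 y" by (intro mult_left_mono) auto
      moreover have "(0::nat) < 2 ^ d0" by simp
      ultimately show ?thesis using pw_divmod[of y d0] y by linarith
    qed
    show ?thesis using 1 2 d0 by (intro exI[of _ d0]) auto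
  qed
qed

section \<open>Prefixes of monomials\<close>

text \<open>Variables are numbered from 1 in Defs but from 0 in exponent lists.\<close>

definition cmp :: "nat \<Rightarrow> nat \<Rightarrow> nat \<Rightarrow> nat set" where
  "cmp k i j = {l. l < k \<and> Suc l \<noteq> i \<and> Suc l \<noteq> j}"

lemma cmp_subset: "cmp k i j \<subseteq> {..<k}" by (auto simp: cmp_def)

lemma length_XIJ [simp]: "length (XIJ k H K) = k" by (simp add: XIJ_def)

lemma XIJ_nth: "l < k \<Longrightarrow> XIJ k H K ! l = (\<Sum>t<length H. (if Suc l = H ! t \<or> Suc l = K ! t then 0 else 1) * 2 ^ (length H - 1 - t))"
  by (simp add: XIJ_def del: upt_Suc)

text \<open>The last pair of \<open>XIJ\<close> carries the exponent 2^0, so appending a pair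
  inserts a new lowest binary digit.\<close>

lemma XIJ_snoc:
  assumes "length H = length K"
  shows "XIJ k (H @ [h]) (K @ [q]) = comb k (cmp k h q) (XIJ k H K)"
proof (rule nth_equalityI)
  fix l assume "l < length (XIJ k (H @ [h]) (K @ [q]))"
  then have l: "l < k" by simp
  have "XIJ k (H @ [h]) (K @ [q]) ! l = (\<Sum>t<Suc (length H). (if Suc l = (H @ [h]) ! t \<or> Suc l = (K @ [q]) ! t then 0 else 1) * 2 ^ (length H - t))"
    using l by (simp add: XIJ_nth)
  also have "\<dots> = (\<Sum>t<length H. (if Suc l = H ! t \<or> Suc l = K ! t then 0 else 1) * 2 ^ (length H - t)) + (if Suc l = h \<or> Suc l = q then 0 else 1)"
    using assms by (simp add: nth_append)
  also have "(\<Sum>t<length H. (if Suc l = H ! t \<or> Suc l = K ! t then 0 else 1) * 2 ^ (length H - t)) = 2 * XIJ k H K ! l"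
    unfolding XIJ_nth[OF l] sum_distrib_left
  proof (rule sum.cong)
    fix t assume "t \<in> {..<length H}"
    then have "length H - t = Suc (length H - 1 - t)" by auto
    then show "(if Suc l = H ! t \<or> Suc l = K ! t then 0 else 1) * 2 ^ (length H - t) =
      2 * ((if Suc l = H ! t \<or> Suc l = K ! t then 0 else 1) * (2::nat) ^ (length H - 1 - t))" by simp
  qed simp
  finally show "XIJ k (H @ [h]) (K @ [q]) ! l = comb k (cmp k h q) (XIJ k H K) ! l"
    using l by (auto simp: comb_def cmp_def)
qed simp

definition pre :: "nat \<Rightarrow> nat list \<Rightarrow> nat list \<Rightarrow> f2poly \<Rightarrow> f2poly" where
  "pre k H K F = ml (XIJ k H K) * F ^ (2 ^ length H)"

lemma pre_Nil [simp]: "pre k [] [] F = F"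
proof -
  have "ex (XIJ k [] []) = 0" by (rule poly_mapping_eqI) (auto simp: lookup_ex XIJ_nth)
  then show ?thesis by (simp add: pre_def)
qed

lemma pre_add: "pre k H K (F + G) = pre k H K F + pre k H K G"
  by (simp add: pre_def f2_power_add distrib_left)

lemma pre_zero [simp]: "pre k H K 0 = 0"
  by (simp add: pre_def power_0_left)

lemma pre_snoc: "length H = length K \<Longrightarrow> pre k (H @ [h]) (K @ [q]) F = X (cmp k h q) * (pre k H K F)^2"
  unfolding pre_def XIJ_snoc ml_comb[OF cmp_subset length_XIJ]
  by (simp add: power_mult_distrib power_mult[symmetric] mult.assoc mult.commute[of _ 2])

text \<open>The first pair carries the highest power and can be absorbed into the argument. With
  \<open>pre_snoc\<close> both ends of a prefix are accessible: hit polynomials are propagated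
  through the last pair, variables are exchanged at the first.\<close>

lemma pre_Cons: "length H = length K \<Longrightarrow> pre k (h # H) (q # K) F = pre k H K (X (cmp k h q) * F^2)"
proof (induction "length H" arbitrary: H K)
  case 0
  then show ?case using pre_snoc[of "[]" "[]" k h q F] by simp
next
  case (Suc n)
  obtain H' h' K' q' where HK: "H = H' @ [h']" "K = K' @ [q']"
    using Suc(2,3) by (metis length_Suc_conv_rev)
  have "pre k (h # H') (q # K') F = pre k H' K' (X (cmp k h q) * F^2)"
    using Suc HK by auto
  moreover have "length H' = length K'" using Suc(3) HK by simp
  ultimately show ?case unfolding HK using pre_snoc[of "h # H'" "q # K'" k h' q'] by (simp add: pre_snoc)
qed

lemma PSeq_snocE:
  assumes "(H, K) \<in> PSeq k (Suc n)"
  obtains H' h K' q where "H = H' @ [h]" "K = K' @ [q]" "(H', K') \<in> PSeq k n" "1 \<le> h" "h < q" "q \<le> k"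
proof -
  have l: "length H = Suc n" "length K = Suc n" and t: "\<And>t. t < Suc n \<Longrightarrow> 1 \<le> H ! t \<and> H ! t < K ! t \<and> K ! t \<le> k"
    using assms by (auto simp: PSeq_def)
  obtain H' h where H: "H = H' @ [h]" using l(1) by (metis length_Suc_conv_rev)
  obtain K' q where K: "K = K' @ [q]" using l(2) by (metis length_Suc_conv_rev)
  have "(H', K') \<in> PSeq k n"
  proof -
    have len: "length H' = n" "length K' = n" using l H K by auto
    have "1 \<le> H' ! u \<and> H' ! u < K' ! u \<and> K' ! u \<le> k" if "u < n" for u
      using t[of u] that len by (simp add: H K nth_append)
    then show ?thesis using len by (auto simp: PSeq_def)
  qed
  moreover have "1 \<le> h \<and> h < q \<and> q \<le> k" using t[of n] l H K by (simp add: nth_append)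
  ultimately show ?thesis using that H K by blast
qed

context level_degrees begin

lemma card_cmp: "1 \<le> i \<Longrightarrow> i \<le> k \<Longrightarrow> 1 \<le> j \<Longrightarrow> j \<le> k \<Longrightarrow> i \<noteq> j \<Longrightarrow> card (cmp k i j) = s"
proof -
  assume a: "1 \<le> i" "i \<le> k" "1 \<le> j" "j \<le> k" "i \<noteq> j"
  then have "cmp k i j = {..<k} - {i - 1, j - 1}" by (auto simp: cmp_def)
  then show ?thesis using card_minus_two[of "i - 1" "j - 1"] a by auto
qed

lemma pre_hits: "(H, K) \<in> PSeq k n \<Longrightarrow> F \<in> hits k (N e) \<Longrightarrow> pre k H K F \<in> hits k (N (e + n))"
proof (induction n arbitrary: H K)
  case 0
  then show ?case by (auto simp: PSeq_def)
next
  case (Suc n)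
  obtain H' h K' q where s: "H = H' @ [h]" "K = K' @ [q]" "(H', K') \<in> PSeq k n" "1 \<le> h" "h < q" "q \<le> k"
    using Suc(2) by (rule PSeq_snocE)
  have len: "length H' = length K'" using s(3) by (auto simp: PSeq_def)
  have "card (cmp k h q) = s" using s by (intro card_cmp) auto
  from square_hit_X[OF cmp_subset this Suc(1)[OF s(3) Suc(3)]]
  show ?case unfolding s(1,2) pre_snoc[OF len] by simp
qed

text \<open>At a level of weight s exactly two variables are missing; they form the pair of that
  level.\<close>

lemma pure_pre:
  assumes "length a = k" "level_pure n a" "sum_list a = N (e + n)"
  shows "\<exists>H K g. (H, K) \<in> PSeq k n \<and> length g = k \<and> sum_list g = N e \<and> ml a = pre k H K (ml g)"
  using assms
proof (induction n arbitrary: a)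
  case 0
  then show ?case by (intro exI[of _ "[]"] exI[of _ a]) (auto simp: PSeq_def)
next
  case (Suc n)
  have c: "card (odds a) = s" using Suc by simp
  then have "sum_list (half a) = N (e + n)" using sum_list_decomp[of a] Suc(4) N_Suc[of "e + n"] by simp
  then obtain H K g where g: "(H, K) \<in> PSeq k n" "length g = k" "sum_list g = N e" "ml (half a) = pre k H K (ml g)"
    using Suc(1)[of "half a"] Suc(2,3) by auto
  have "odds a \<subseteq> {..<k}" using odds_subset[of a] Suc(2) by simp
  then obtain p q where pq: "p < q" "q < k" "odds a = {..<k} - {p,q}" using two_missing[OF _ c] by metis
  have "odds a = cmp k (Suc p) (Suc q)" unfolding pq(3) by (auto simp: cmp_def)
  moreover have "length H = length K" "length H = n" using g(1) by (auto simp: PSeq_def)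
  ultimately have "ml a = pre k (H @ [Suc p]) (K @ [Suc q]) (ml g)"
    using ml_decomp[OF Suc(2)] g(4) by (simp add: pre_snoc)
  moreover have "(H @ [Suc p], K @ [Suc q]) \<in> PSeq k (Suc n)"
    using g(1) pq by (auto simp: PSeq_def nth_append less_Suc_eq)
  ultimately show ?case using g by blast
qed

text \<open>Sq^1 on the product of all variables but x_j, times \<open>F^2\<close>, trades the
  factor x_i of the squared part for the other variables. No order between i and j is assumed, so
  either entry of a pair can be replaced.\<close>

lemma move_variable:
  assumes ij: "1 \<le> i" "i \<le> k" "1 \<le> j" "j \<le> k" "i \<noteq> j" and F: "F \<in> hom k d" "Suc d = N e"
  shows "X (cmp k i j) * (x (i - 1) * F)^2 + (\<Sum>l\<in>cmp k i j. X (cmp k (Suc l) j) * (x l * F)^2) \<in> hits k (N (Suc e))"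
proof -
  define A where "A = {..<k} - {j - 1}"
  have A: "finite A" "A \<subseteq> {..<k}" "card A = k - 1" using ij by (auto simp: A_def)
  have "X A * F^2 \<in> hom k ((k - 1) + 2 * d)"
    using hom_mult[OF hom_X[OF A(2)] hom_power[OF F(1), of 2]] A(3) by simp
  then have "sq 1 (X A * F^2) \<in> hits k (N (Suc e))"
    by (rule hits_sq[rotated]) (use F N_Suc[of e] ks in auto)
  moreover have "sq 1 (X A * F^2) = X (A - {i - 1}) * (x (i - 1) * F)^2 + (\<Sum>l\<in>A - {i - 1}. X (A - {l}) * (x l * F)^2)"
    unfolding sq1_X[OF A(1)] by (rule sum.remove) (use ij A in \<open>auto simp: A_def\<close>)
  moreover have "A - {i - 1} = cmp k i j" using ij by (auto simp: A_def cmp_def)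
  moreover have "A - {l} = cmp k (Suc l) j" for l using ij by (auto simp: A_def cmp_def)
  ultimately show ?thesis by simp
qed

end

section \<open>Transfer from sets of exponent lists\<close>

text \<open>The map \<open>E\<close> on exponents is a parameter, so that one transfer serves P_k
  itself, through \<open>ex\<close>, and the copies f_(i,j)(P_(k-2)), through
  \<open>fij\<close>.\<close>

definition toE :: "(nat list \<Rightarrow> (nat \<Rightarrow>\<^sub>0 nat)) \<Rightarrow> poly \<Rightarrow> f2poly" where
  "toE E P = (\<Sum>a\<in>P. mon (E a))"

lemma toE_empty [simp]: "toE E {} = 0" by (simp add: toE_def)
lemma toE_single [simp]: "toE E {a} = mon (E a)" by (simp add: toE_def)
lemma toE_padd: "finite A \<Longrightarrow> finite B \<Longrightarrow> toE E (padd A B) = toE E A + toE E B"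
  unfolding toE_def padd_def by (rule sum_sym_diff)

lemma padd_finite: "finite A \<Longrightarrow> finite B \<Longrightarrow> finite (padd A B)" by (simp add: padd_def)
lemma padd_empty [simp]: "padd A {} = A" "padd {} A = A" by (auto simp: padd_def)
lemma padd_self [simp]: "padd A A = {}" by (auto simp: padd_def)
lemma padd_assoc: "padd (padd A B) C = padd A (padd B C)" by (auto simp: padd_def)
lemma Psum_empty [simp]: "Psum F {} = {}" by (simp add: Psum_def)

lemma Psum_insert: "finite S \<Longrightarrow> s \<notin> S \<Longrightarrow> Psum F (insert s S) = padd (F s) (Psum F S)"
proof -
  assume S: "finite S" "s \<notin> S"
  have "{t \<in> insert s S. m \<in> F t} = (if m \<in> F s then insert s {t \<in> S. m \<in> F t} else {t \<in> S. m \<in> F t})" for m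
    by auto
  then have "card {t \<in> insert s S. m \<in> F t} = (if m \<in> F s then Suc (card {t \<in> S. m \<in> F t}) else card {t \<in> S. m \<in> F t})" for m
    using S by simp
  then show ?thesis by (auto simp: Psum_def padd_def)
qed

lemma Psum_finite: "finite S \<Longrightarrow> (\<And>s. s \<in> S \<Longrightarrow> finite (F s)) \<Longrightarrow> finite (Psum F S)"
  by (induction S rule: finite_induct) (auto simp: Psum_insert padd_finite)

lemma toE_Psum: "finite S \<Longrightarrow> (\<And>s. s \<in> S \<Longrightarrow> finite (F s)) \<Longrightarrow> toE E (Psum F S) = (\<Sum>s\<in>S. toE E (F s))"
  by (induction S rule: finite_induct) (auto simp: Psum_insert toE_padd Psum_finite)

lemma Psum_closed:
  assumes "finite S" "{} \<in> V" "\<And>A B. A \<in> V \<Longrightarrow> B \<in> V \<Longrightarrow> padd A B \<in> V" "\<And>s. s \<in> S \<Longrightarrow> F s \<in> V"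
  shows "Psum F S \<in> V"
  using assms(1,4) by (induction S rule: finite_induct) (auto simp: Psum_insert assms)

lemma Psum_sym_diff:
  "finite S \<Longrightarrow> finite T \<Longrightarrow> padd (Psum F S) (Psum F T) = Psum F ((S - T) \<union> (T - S))"
proof (induction S arbitrary: T rule: finite_induct)
  case (insert s S)
  show ?case
  proof (cases "s \<in> T")
    case True
    then obtain T' where T': "T = insert s T'" "s \<notin> T'" by (meson Set.set_insert)
    have "(insert s S - T) \<union> (T - insert s S) = (S - T') \<union> (T' - S)" using T' insert by auto
    moreover have "padd (padd A B) (padd A C) = padd B C" for A B C by (auto simp: padd_def)
    moreover have "finite T'" using insert(4) T' by simp
    ultimately show ?thesis using insert(3)[of T'] Psum_insert[OF insert(1,2), of F] Psum_insert[of T' s F] T' by simp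
  next
    case False
    then have "(insert s S - T) \<union> (T - insert s S) = insert s ((S - T) \<union> (T - S))" using insert by auto
    then show ?thesis using insert False by (simp add: Psum_insert padd_assoc)
  qed
qed simp

lemma f2span_empty [simp]: "{} \<in> f2span S"
  unfolding f2span_def by (auto intro!: exI[of _ "{}"])

lemma f2span_base: "P \<in> S \<Longrightarrow> P \<in> f2span S"
  unfolding f2span_def using Psum_insert[of "{}" P id] by (auto intro!: exI[of _ "{P}"])

lemma f2span_padd: "A \<in> f2span S \<Longrightarrow> B \<in> f2span S \<Longrightarrow> padd A B \<in> f2span S"
proof -
  assume "A \<in> f2span S" "B \<in> f2span S"
  then obtain T U where "A = Psum id T" "finite T" "T \<subseteq> S" "B = Psum id U" "finite U" "U \<subseteq> S"
    by (auto simp: f2span_def)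
  then show ?thesis unfolding f2span_def
    by (auto simp: Psum_sym_diff intro!: exI[of _ "(T - U) \<union> (U - T)"])
qed

lemma f2span_closed:
  assumes "P \<in> f2span S" "{} \<in> V" "\<And>A B. A \<in> V \<Longrightarrow> B \<in> V \<Longrightarrow> padd A B \<in> V" "S \<subseteq> V"
  shows "P \<in> V"
proof -
  obtain T where T: "P = Psum id T" "finite T" "T \<subseteq> S" using assms(1) by (auto simp: f2span_def)
  show ?thesis unfolding T(1) by (rule Psum_closed[OF T(2) assms(2,3)]) (use T assms(4) in auto)
qed

lemma ssum_padd:
  assumes "\<And>A B. A \<in> V \<Longrightarrow> B \<in> V \<Longrightarrow> padd A B \<in> V" "\<And>A B. A \<in> W \<Longrightarrow> B \<in> W \<Longrightarrow> padd A B \<in> W"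
    "A \<in> ssum V W" "B \<in> ssum V W"
  shows "padd A B \<in> ssum V W"
proof -
  obtain a b c d where "A = padd a b" "B = padd c d" "a \<in> V" "c \<in> V" "b \<in> W" "d \<in> W"
    using assms(3,4) by (auto simp: ssum_def)
  moreover have "padd (padd a b) (padd c d) = padd (padd a c) (padd b d)" by (auto simp: padd_def)
  ultimately show ?thesis using assms(1,2) unfolding ssum_def by blast
qed

lemma polys_deg_empty [simp]: "{} \<in> polys_deg k n" by (simp add: polys_deg_def polys_def)
lemma polys_deg_padd: "A \<in> polys_deg k n \<Longrightarrow> B \<in> polys_deg k n \<Longrightarrow> padd A B \<in> polys_deg k n"
  by (auto simp: polys_deg_def polys_def padd_def)
lemma polys_deg_finite: "A \<in> polys_deg k n \<Longrightarrow> finite A" by (simp add: polys_deg_def polys_def)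
lemma polys_deg_polys: "A \<in> polys_deg k n \<Longrightarrow> A \<in> polys k" by (simp add: polys_deg_def)
lemma polys_empty [simp]: "{} \<in> polys k" by (simp add: polys_def)
lemma polys_padd: "A \<in> polys k \<Longrightarrow> B \<in> polys k \<Longrightarrow> padd A B \<in> polys k"
  by (auto simp: polys_def padd_def)

definition embeds :: "nat \<Rightarrow> nat \<Rightarrow> (nat list \<Rightarrow> (nat \<Rightarrow>\<^sub>0 nat)) \<Rightarrow> bool" where
  "embeds k s E \<longleftrightarrow> inj_on E {a. length a = s} \<and>
     (\<forall>a. length a = s \<longrightarrow> keys (E a) \<subseteq> {..<k} \<and> dg (E a) = sum_list a \<and> (\<forall>i. E ` Sq_mono i a = sqexp i (E a)))"

lemma embeds_of_positions:
  assumes inj: "inj_on pos {..<s}" and sub: "pos ` {..<s} \<subseteq> {..<k}"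
    and E1: "\<And>a t. length a = s \<Longrightarrow> t < s \<Longrightarrow> lookup (E a) (pos t) = a ! t"
    and E0: "\<And>a l. length a = s \<Longrightarrow> l \<notin> pos ` {..<s} \<Longrightarrow> lookup (E a) l = 0"
  shows "embeds k s E"
proof -
  have keys: "keys (E a) \<subseteq> pos ` {..<s}" if "length a = s" for a
    using E0[OF that] by (metis in_keys_iff subsetI)
  have dgE: "dg (E a) = sum_list a" if "length a = s" for a
  proof -
    have "dg (E a) = (\<Sum>l\<in>pos ` {..<s}. lookup (E a) l)" by (rule dg_alt[OF _ keys[OF that]]) simp
    also have "\<dots> = (\<Sum>t<s. a ! t)" using E1[OF that] by (simp add: sum.reindex[OF inj])
    finally show ?thesis using that by (simp add: sum_list_sum_nth atLeast0LessThan)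
  qed
  have "inj_on E {a. length a = s}"
  proof (rule inj_onI)
    fix a b assume ab: "a \<in> {a. length a = s}" "b \<in> {a. length a = s}" "E a = E b"
    show "a = b" by (rule nth_equalityI) (use ab E1[of a] E1[of b] in auto)
  qed
  moreover have "E ` Sq_mono i a = sqexp i (E a)" if a: "length a = s" for i a
  proof -
    have iff: "E b \<in> sqexp i (E a) \<longleftrightarrow> b \<in> Sq_mono i a" if b: "length b = s" for b
    proof -
      have "(\<forall>l. lookup (E a) l \<le> lookup (E b) l \<and> odd (lookup (E a) l choose (lookup (E b) l - lookup (E a) l))) \<longleftrightarrow>
        (\<forall>t<s. a ! t \<le> b ! t \<and> odd (a ! t choose (b ! t - a ! t)))" (is "(\<forall>l. ?R l) \<longleftrightarrow> ?Q")
      proof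
        assume R: "\<forall>l. ?R l"
        show ?Q
        proof (intro allI impI)
          fix t assume "t < s"
          then show "a ! t \<le> b ! t \<and> odd (a ! t choose (b ! t - a ! t))"
            using R[rule_format, of "pos t"] E1[OF a] E1[OF b] by simp
        qed
      next
        assume Q: ?Q
        show "\<forall>l. ?R l"
        proof
          fix l show "?R l"
          proof (cases "l \<in> pos ` {..<s}")
            case True
            then obtain t where "t < s" "l = pos t" by auto
            then show ?thesis using Q E1[OF a] E1[OF b] by simp
          next
            case False
            then show ?thesis using E0[OF a] E0[OF b] by simp
          qed
        qed
      qed
      then show ?thesis unfolding sqexp_def Sq_mono_def using a b dgE by auto
    qed
    show ?thesis
    proof
      show "E ` Sq_mono i a \<subseteq> sqexp i (E a)" using iff a by (auto simp: Sq_mono_def)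
      show "sqexp i (E a) \<subseteq> E ` Sq_mono i a"
      proof
        fix c assume c: "c \<in> sqexp i (E a)"
        define b where "b = map (\<lambda>t. lookup c (pos t)) [0..<s]"
        have b: "length b = s" by (simp add: b_def)
        have kc: "keys c \<subseteq> pos ` {..<s}" using sqexp_keys[OF c] keys[OF a] by simp
        have "c = E b"
        proof (rule poly_mapping_eqI)
          fix l show "lookup c l = lookup (E b) l"
          proof (cases "l \<in> pos ` {..<s}")
            case True
            then obtain t where "t < s" "l = pos t" by auto
            then show ?thesis using E1[OF b] by (simp add: b_def)
          next
            case False
            then show ?thesis using E0[OF b] kc by (metis in_keys_iff subsetD)
          qed
        qed
        then show "c \<in> E ` Sq_mono i a" using c iff[OF b] by auto
      qed
    qed
  qed
  ultimately show ?thesis unfolding embeds_def using keys sub dgE by blast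
qed

lemma embeds_ex: "embeds k k ex"
  by (rule embeds_of_positions[of "\<lambda>t. t"]) (auto simp: lookup_ex inj_on_def image_def)

context
  fixes k s E assumes emb: "embeds k s E"
begin

lemma inj_E_Sq_mono: "length a = s \<Longrightarrow> inj_on E (Sq_mono i a)"
  using emb unfolding embeds_def by (auto intro: inj_on_subset simp: Sq_mono_def)

lemma finite_Sq_mono: "length a = s \<Longrightarrow> finite (Sq_mono i a)"
  using emb unfolding embeds_def by (metis finite_imageD finite_sqexp inj_E_Sq_mono)

lemma toE_Sq_mono: "length a = s \<Longrightarrow> toE E (Sq_mono i a) = sq i (mon (E a))"
proof -
  assume a: "length a = s"
  have im: "E ` Sq_mono i a = sqexp i (E a)" using emb a by (simp add: embeds_def)
  show ?thesis unfolding sq_mon im[symmetric] toE_def by (simp add: sum.reindex[OF inj_E_Sq_mono[OF a]])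
qed

lemma finite_Sq: "f \<in> polys s \<Longrightarrow> finite (Sq i f)"
  unfolding Sq_def by (rule Psum_finite) (auto simp: polys_def finite_Sq_mono)

lemma toE_Sq: "f \<in> polys s \<Longrightarrow> toE E (Sq i f) = (\<Sum>a\<in>f. sq i (mon (E a)))"
  unfolding Sq_def by (subst toE_Psum) (auto simp: polys_def finite_Sq_mono toE_Sq_mono)

lemma toE_hom: "P \<in> polys_deg s n \<Longrightarrow> toE E P \<in> hom k n"
  unfolding toE_def using emb by (intro hom_sum) (auto simp: polys_deg_def polys_def embeds_def)

definition comp :: "nat \<Rightarrow> f2poly \<Rightarrow> f2poly" where
  "comp n = lext (\<lambda>a. if dg a = n then mon a else 0)"

lemma comp_add: "comp n (u + v) = comp n u + comp n v" by (simp add: comp_def lext_add)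
lemma comp_sum: "comp n (\<Sum>i\<in>I. f i) = (\<Sum>i\<in>I. comp n (f i))"
  by (induction I rule: infinite_finite_induct) (auto simp: comp_add, auto simp: comp_def)

lemma comp_hom: "v \<in> hom k d \<Longrightarrow> comp n v = (if d = n then v else 0)"
proof -
  assume v: "v \<in> hom k d"
  have "comp n v = (\<Sum>a\<in>keys v. if d = n then mon a else 0)"
    unfolding comp_def lext_def by (rule sum.cong) (use v in \<open>auto simp: hom_def\<close>)
  then show ?thesis using f2_expand[of v] by auto
qed

text \<open>The generators of \<open>hit\<close> and \<open>hitA\<close> may be inhomogeneous,
  whereas \<open>hits\<close> is graded. As Sq^i raises every degree by i, the degree-n component of
  a generator is a sum of squares of single monomials. The predicate \<open>q\<close> covers both
  spans.\<close>

lemma toE_hit_span: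
  assumes P: "P \<in> f2span {Sq i f | i f. q i \<and> f \<in> polys s}" and hom: "P \<in> polys_deg s n"
  shows "toE E P \<in> aspan {sq i (mon (E a)) | i a. q i \<and> length a = s \<and> sum_list a + i = n}" (is "_ \<in> aspan ?S")
proof -
  obtain T where T: "P = Psum id T" "finite T" "T \<subseteq> {Sq i f | i f. q i \<and> f \<in> polys s}"
    using P by (auto simp: f2span_def)
  have 1: "toE E P = (\<Sum>t\<in>T. toE E t)"
    unfolding T(1) by (subst toE_Psum[OF T(2)]) (use T(3) finite_Sq in auto)
  have 2: "comp n (\<Sum>t\<in>T. toE E t) \<in> aspan ?S"
    unfolding comp_sum
  proof (rule aspan_sum)
    fix t assume "t \<in> T"
    then obtain i f where t: "t = Sq i f" "q i" "f \<in> polys s" using T(3) by blast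
    show "comp n (toE E t) \<in> aspan ?S"
      unfolding t(1) toE_Sq[OF t(3)] comp_sum
    proof (rule aspan_sum)
      fix a assume "a \<in> f"
      then have a: "length a = s" using t(3) by (simp add: polys_def)
      have "sq i (mon (E a)) \<in> hom k (sum_list a + i)"
        using emb a by (intro hom_sq) (auto simp: embeds_def)
      from comp_hom[OF this, of n] show "comp n (sq i (mon (E a))) \<in> aspan ?S"
        using a t(2) by (auto intro: aspan_base aspan_zero)
    qed
  qed
  show ?thesis using 2 unfolding 1[symmetric] comp_hom[OF toE_hom[OF hom]] by simp
qed

lemma toE_hit: "P \<in> hit s \<Longrightarrow> P \<in> polys_deg s n \<Longrightarrow> toE E P \<in> hits k n"
proof -
  assume "P \<in> hit s" "P \<in> polys_deg s n"
  from toE_hit_span[OF this(1)[unfolded hit_def] this(2)] show ?thesis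
  proof (rule aspan_closed)
    fix t assume "t \<in> {sq i (mon (E a)) |i a. 0 < i \<and> length a = s \<and> sum_list a + i = n}"
    then obtain i a where t: "t = sq i (mon (E a))" "0 < i" "length a = s" "sum_list a + i = n" by blast
    have "mon (E a) \<in> hom k (sum_list a)" using emb t(3) by (auto simp: embeds_def)
    then show "t \<in> hits k n" unfolding t(1) using t by (intro hits_sq)
  qed (auto intro: hits_add)
qed

end

lemma keys_toE_ex: "P \<in> polys k \<Longrightarrow> keys (toE ex P) = ex ` P"
proof -
  assume "P \<in> polys k"
  then have "finite P" "\<forall>a\<in>P. length a = k" by (auto simp: polys_def)
  then show ?thesis
  proof induction
    case (insert a P)
    have "ex a \<notin> ex ` P" using insert ex_inj by fastforce
    then show ?case using insert by (auto simp: toE_def keys_f2_add)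
  qed simp
qed

lemma toE_ex_inj: "P \<in> polys k \<Longrightarrow> Q \<in> polys k \<Longrightarrow> toE ex P = toE ex Q \<Longrightarrow> P = Q"
proof -
  assume P: "P \<in> polys k" and Q: "Q \<in> polys k" and "toE ex P = toE ex Q"
  then have "ex ` P = ex ` Q" using keys_toE_ex by metis
  moreover have "inj_on ex {a. length a = k}" using embeds_ex[of k] by (simp add: embeds_def)
  moreover have "P \<subseteq> {a. length a = k}" "Q \<subseteq> {a. length a = k}" using P Q by (auto simp: polys_def)
  ultimately show ?thesis by (simp add: inj_on_image_eq_iff)
qed

lemma hom_toE_ex: "v \<in> hom k n \<Longrightarrow> \<exists>P\<in>polys_deg k n. toE ex P = v"
proof -
  assume "v \<in> hom k n"
  from hom_expand_ml[OF this] show ?thesis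
  proof induction
    case aspan_zero
    then show ?case by (intro bexI[of _ "{}"]) auto
  next
    case (aspan_step t v)
    then obtain a P where "t = ml a" "length a = k" "sum_list a = n" "P \<in> polys_deg k n" "toE ex P = v" by blast
    then show ?case
      by (intro bexI[of _ "padd {a} P"]) (auto simp: toE_padd polys_deg_finite intro!: polys_deg_padd, auto simp: polys_deg_def polys_def)
  qed
qed

lemma lift_span:
  assumes "v \<in> aspan (toE ex ` S)" "S \<subseteq> polys k"
  shows "\<exists>P\<in>f2span S. P \<in> polys k \<and> toE ex P = v"
  using assms(1)
proof induction
  case aspan_zero
  then show ?case by (intro bexI[of _ "{}"]) auto
next
  case (aspan_step t v)
  then obtain Q P where "Q \<in> S" "t = toE ex Q" "P \<in> f2span S" "P \<in> polys k" "toE ex P = v" by blast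
  moreover have "finite Q" "finite P" using calculation assms(2) by (auto simp: polys_def)
  ultimately show ?case using assms(2)
    by (intro bexI[of _ "padd Q P"]) (auto simp: toE_padd intro: f2span_padd[OF f2span_base] polys_padd)
qed

lemma Sq_polys: "f \<in> polys k \<Longrightarrow> Sq i f \<in> polys k"
  unfolding Sq_def
proof (rule Psum_closed)
  fix a assume "f \<in> polys k" "a \<in> f"
  then have "length a = k" by (simp add: polys_def)
  then show "Sq_mono i a \<in> polys k"
    using finite_Sq_mono[OF embeds_ex] by (auto simp: polys_def Sq_mono_def)
qed (auto intro: polys_padd, auto simp: polys_def)

lemma hits_lift: "v \<in> hits k n \<Longrightarrow> \<exists>P\<in>hit k. P \<in> polys k \<and> toE ex P = v"
proof -
  assume "v \<in> hits k n"
  then have "v \<in> aspan (toE ex ` {Sq i f | i f. 0 < i \<and> f \<in> polys k})"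
    unfolding hits_def
  proof (rule subsetD[OF aspan_mono, rotated], safe)
    fix i m :: nat and f :: f2poly assume i: "0 < i" and f: "f \<in> hom k m"
    obtain P where P: "P \<in> polys_deg k m" "toE ex P = f" using hom_toE_ex[OF f] by blast
    have "sq i f = toE ex (Sq i P)"
      unfolding toE_Sq[OF embeds_ex polys_deg_polys[OF P(1)]] P(2)[symmetric] by (simp add: toE_def sq_sum)
    then show "sq i f \<in> toE ex ` {Sq i f | i f. 0 < i \<and> f \<in> polys k}"
      using i polys_deg_polys[OF P(1)] by blast
  qed
  then show ?thesis unfolding hit_def by (rule lift_span) (auto intro: Sq_polys)
qed

lemma lift_span_hits:
  assumes f: "f \<in> polys k" "toE ex f \<in> aspan (toE ex ` G \<union> hits k n)" and G: "G \<subseteq> polys k"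
  shows "f \<in> ssum (f2span G) (hit k)"
proof -
  have "\<exists>g\<in>aspan (toE ex ` G). \<exists>h\<in>hits k n. v = g + h" if "v \<in> aspan (toE ex ` G \<union> hits k n)" for v
    using that
  proof induction
    case aspan_zero
    show ?case by (intro bexI[of _ 0]) (auto simp: aspan.aspan_zero)
  next
    case (aspan_step t v)
    then obtain g h where gh: "g \<in> aspan (toE ex ` G)" "h \<in> hits k n" "v = g + h" by blast
    show ?case
    proof (cases "t \<in> hits k n")
      case True
      then show ?thesis using gh hits_add[OF True gh(2)] by (metis add.left_commute)
    next
      case False
      then have "t + g \<in> aspan (toE ex ` G)" using aspan_step gh by (intro aspan.aspan_step) auto
      then show ?thesis using gh by (metis add.assoc)
    qed
  qed
  from this[OF f(2)] obtain g h where gh: "g \<in> aspan (toE ex ` G)" "h \<in> hits k n" "toE ex f = g + h" by blast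
  obtain P where P: "P \<in> f2span G" "P \<in> polys k" "toE ex P = g" using lift_span[OF gh(1) G] by blast
  obtain Q where Q: "Q \<in> hit k" "Q \<in> polys k" "toE ex Q = h" using hits_lift[OF gh(2)] by blast
  have "toE ex (padd P Q) = toE ex f" using P Q gh by (simp add: toE_padd polys_def)
  then have "f = padd P Q" using toE_ex_inj[OF f(1)] polys_padd[OF P(2) Q(2)] by metis
  then show ?thesis unfolding ssum_def using P Q by blast
qed

section \<open>Admissible monomials generate the quotient\<close>

lemma wlt_trans: "wlt u v \<Longrightarrow> wlt v w \<Longrightarrow> wlt u w"
proof -
  assume "wlt u v" "wlt v w"
  then obtain i j where i: "i \<ge> 1" "\<And>l. 1 \<le> l \<and> l < i \<Longrightarrow> u l = v l" "u i < v i"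
    and j: "j \<ge> 1" "\<And>l. 1 \<le> l \<and> l < j \<Longrightarrow> v l = w l" "v j < w j"
    unfolding wlt_def by blast
  show ?thesis
    unfolding wlt_def
  proof (intro exI[of _ "min i j"] conjI allI impI)
    show "1 \<le> min i j" using i j by simp
    show "u l = w l" if "1 \<le> l \<and> l < min i j" for l using i(2)[of l] j(2)[of l] that by simp
    show "u (min i j) < w (min i j)"
      using i j by (cases i j rule: linorder_cases) (auto simp: min_def)
  qed
qed

lemma wlt_irrefl: "\<not> wlt u u" by (auto simp: wlt_def)

lemma mless_trans:
  fixes x y z :: "nat list"
  shows "length x = length y \<Longrightarrow> length y = length z \<Longrightarrow> mless x y \<Longrightarrow> mless y z \<Longrightarrow> mless x z"
proof -
  assume l: "length x = length y" "length y = length z" and xy: "mless x y" and yz: "mless y z"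
  show ?thesis
  proof (cases "wlt (weight x) (weight y) \<or> wlt (weight y) (weight z)")
    case True
    then show ?thesis using xy yz unfolding mless_def by (metis wlt_trans)
  next
    case False
    then obtain i j where w: "weight x = weight y" "weight y = weight z"
      and i: "i < length x" "take i x = take i y" "x ! i < y ! i"
      and j: "j < length y" "take j y = take j z" "y ! j < z ! j"
      using xy yz unfolding mless_def by blast
    have tx: "take m x = take m y" if "m \<le> i" for m using i(2) that by (metis min.absorb2 take_take min.commute)
    have ty: "take m y = take m z" if "m \<le> j" for m using j(2) that by (metis min.absorb2 take_take min.commute)
    have nx: "x ! m = y ! m" if "m < i" for m using i(2) that by (metis nth_take)
    have ny: "y ! m = z ! m" if "m < j" for m using j(2) that by (metis nth_take)
    have "take (min i j) x = take (min i j) z" using tx[of "min i j"] ty[of "min i j"] by simp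
    moreover have "x ! min i j < z ! min i j"
      using nx[of j] ny[of i] i(3) j(3) by (cases i j rule: linorder_cases) (auto simp: min_def)
    moreover have "min i j < length x" using i by simp
    ultimately show ?thesis using w unfolding mless_def by metis
  qed
qed

lemma mless_irrefl: fixes x :: "nat list" shows "\<not> mless x x" by (auto simp: mless_def wlt_irrefl)

lemma finite_monos: "finite {x :: nat list. length x = s \<and> sum_list x = m}"
proof (rule finite_subset)
  show "{x :: nat list. length x = s \<and> sum_list x = m} \<subseteq> {x. set x \<subseteq> {..m} \<and> length x = s}"
    by (auto intro: member_le_sum_list)
qed (rule finite_lists_length_eq, simp)

lemma hit_padd: "A \<in> hit k \<Longrightarrow> B \<in> hit k \<Longrightarrow> padd A B \<in> hit k"
  unfolding hit_def by (rule f2span_padd)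

text \<open>In a fixed degree there are finitely many monomials, so the strict order
  \<open>mless\<close> is well-founded there, and rewriting inadmissible monomials into smaller ones
  ends.\<close>

lemma admissible_span:
  "polys_deg s m \<subseteq> ssum (f2span {{y} | y. y \<in> admissible_set s m}) (hit s)"
proof -
  let ?W = "ssum (f2span {{y} | y. y \<in> admissible_set s m}) (hit s)"
  let ?M = "{x :: nat list. length x = s \<and> sum_list x = m}"
  define r where "r = {(y, x). y \<in> ?M \<and> x \<in> ?M \<and> mless y x}"
  have W_padd: "padd A B \<in> ?W" if "A \<in> ?W" "B \<in> ?W" for A B
    using ssum_padd[OF f2span_padd hit_padd that] .
  have W_hit: "A \<in> ?W" if "A \<in> hit s" for A
    unfolding ssum_def using that by (intro CollectI exI[of _ "{}"] exI[of _ A]) auto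
  have W_span: "A \<in> ?W" if "A \<in> f2span {{y} | y. y \<in> admissible_set s m}" for A
    unfolding ssum_def using that by (intro CollectI exI[of _ A] exI[of _ "{}"]) (auto simp: hit_def)
  have "trans r"
  proof (rule transI)
    fix u v w assume "(u, v) \<in> r" "(v, w) \<in> r"
    then show "(u, w) \<in> r" using mless_trans[of u v w] by (auto simp: r_def)
  qed
  moreover have "irrefl r" by (auto simp: irrefl_def r_def mless_irrefl)
  ultimately have "acyclic r" by (simp add: acyclic_irrefl)
  moreover have "finite r" by (rule finite_subset[of _ "?M \<times> ?M"]) (auto simp: r_def finite_monos)
  ultimately have wf: "wf r" by (simp add: finite_acyclic_wf)
  have mono: "x \<in> ?M \<Longrightarrow> {x} \<in> ?W" for x
  proof (induction x rule: wf_induct_rule[OF wf])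
    case (1 x)
    show ?case
    proof (cases "inadmissible s x")
      case False
      then show ?thesis using 1 by (intro W_span f2span_base) (auto simp: admissible_set_def)
    next
      case True
      then obtain T where T: "finite T" "\<And>y. y \<in> T \<Longrightarrow> length y = s \<and> sum_list y = sum_list x \<and> mless y x"
        "padd {x} (Psum (\<lambda>y. {y}) T) \<in> hit s" unfolding inadmissible_def by blast
      have "Psum (\<lambda>y. {y}) T \<in> ?W"
      proof (rule Psum_closed[OF T(1) _ W_padd])
        show "{} \<in> ?W" by (rule W_span) simp
        show "{y} \<in> ?W" if "y \<in> T" for y using T(2)[OF that] 1 by (auto simp: r_def)
      qed
      from W_padd[OF W_hit[OF T(3)] this] show ?thesis by (simp add: padd_assoc)
    qed
  qed
  show ?thesis
  proof
    fix P assume P: "P \<in> polys_deg s m"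
    have eq: "P = Psum (\<lambda>y. {y}) P"
    proof -
      have "{t \<in> P. y \<in> {t}} = (if y \<in> P then {y} else {})" for y by auto
      then show ?thesis by (auto simp: Psum_def)
    qed
    have "Psum (\<lambda>y. {y}) P \<in> ?W"
    proof (rule Psum_closed[OF polys_deg_finite[OF P] _ W_padd])
      show "{} \<in> ?W" by (rule W_span) simp
      show "{y} \<in> ?W" if "y \<in> P" for y using P that by (intro mono) (auto simp: polys_deg_def polys_def)
    qed
    then show "P \<in> ?W" using eq by simp
  qed
qed

section \<open>Generators of the kernel\<close>

text \<open>Zero-based index in P_k of the variable to which f_(i,j) sends the variable of index
  \<open>t\<close>; \<open>i\<close> and \<open>j\<close> themselves are counted from 1, as in
  \<open>fij\<close>.\<close>

definition pos :: "nat \<Rightarrow> nat \<Rightarrow> nat \<Rightarrow> nat" where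
  "pos i j t = (if Suc t < i then t else if Suc (Suc t) < j then Suc t else Suc (Suc t))"

lemma fij_nth: "l < k \<Longrightarrow> fij k i j y ! l =
  (if Suc l = i \<or> Suc l = j then 0 else y ! (l - (if i < Suc l then 1 else 0) - (if j < Suc l then 1 else 0)))"
  by (simp add: fij_def del: upt_Suc)

lemma length_fij [simp]: "length (fij k i j y) = k" by (simp add: fij_def)

lemma half_fij: "length y + 2 = k \<Longrightarrow> 1 \<le> i \<Longrightarrow> i < j \<Longrightarrow> j \<le> k \<Longrightarrow> half (fij k i j y) = fij k i j (half y)"
  by (rule nth_equalityI) (auto simp: half_def fij_nth)

lemma toE_f2span: "P \<in> f2span S \<Longrightarrow> (\<And>s. s \<in> S \<Longrightarrow> finite s) \<Longrightarrow> toE E P \<in> aspan (toE E ` S)"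
proof -
  assume "P \<in> f2span S" and fin: "\<And>s. s \<in> S \<Longrightarrow> finite s"
  then obtain T where T: "P = Psum id T" "finite T" "T \<subseteq> S" by (auto simp: f2span_def)
  have "toE E P = (\<Sum>t\<in>T. toE E t)" unfolding T(1) by (subst toE_Psum) (use T fin in auto)
  also have "\<dots> \<in> aspan (toE E ` S)" by (rule aspan_sum) (use T in \<open>auto intro: aspan_base\<close>)
  finally show ?thesis .
qed

lemma ml_x: "l < length a \<Longrightarrow> x l * ml a = ml (a[l := Suc (a ! l)])"
  unfolding x_mon by (rule arg_cong[where f = mon], rule poly_mapping_eqI)
    (auto simp: lookup_add lookup_ex lookup_single when_def nth_list_update)

lemma sum_list_incr: "l < length a \<Longrightarrow> sum_list (a[l := Suc (a ! l)]) = Suc (sum_list (a :: nat list))"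
  by (simp add: sum_list_update)

lemma pre_sum: "pre k H K (\<Sum>l\<in>A. f l) = (\<Sum>l\<in>A. pre k H K (f l))"
  by (induction A rule: infinite_finite_induct) (auto simp: pre_add)

lemma PSeq_Cons: "(H, K) \<in> PSeq k n \<Longrightarrow> 1 \<le> h \<Longrightarrow> h < q \<Longrightarrow> q \<le> k \<Longrightarrow> (h # H, q # K) \<in> PSeq k (Suc n)"
  by (auto simp: PSeq_def nth_Cons split: nat.split)

lemma PSeq_ConsD: "(h # H, q # K) \<in> PSeq k (Suc n) \<Longrightarrow> (H, K) \<in> PSeq k n \<and> 1 \<le> h \<and> h < q \<and> q \<le> k"
proof -
  assume a: "(h # H, q # K) \<in> PSeq k (Suc n)"
  then have t: "\<And>t. t < Suc n \<Longrightarrow> 1 \<le> (h # H) ! t \<and> (h # H) ! t < (q # K) ! t \<and> (q # K) ! t \<le> k"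
    and len: "length H = n" "length K = n" by (auto simp: PSeq_def)
  have "1 \<le> H ! u \<and> H ! u < K ! u \<and> K ! u \<le> k" if "u < n" for u using t[of "Suc u"] that by simp
  then have "(H, K) \<in> PSeq k n" using len by (simp add: PSeq_def)
  then show ?thesis using t[of 0] by simp
qed

lemma finite_PSeq: "finite (PSeq k n)"
proof (rule finite_subset)
  have "set K \<subseteq> {..k} \<and> set H \<subseteq> {..k}" if "(H, K) \<in> PSeq k n" for H K
    using that unfolding PSeq_def by (auto simp: in_set_conv_nth) (meson le_trans less_imp_le)
  then show "PSeq k n \<subseteq> {H. set H \<subseteq> {..k} \<and> length H = n} \<times> {H. set H \<subseteq> {..k} \<and> length H = n}"
    by (auto simp: PSeq_def)
  show "finite ({H :: nat list. set H \<subseteq> {..k} \<and> length H = n} \<times> {H :: nat list. set H \<subseteq> {..k} \<and> length H = n})"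
    by (intro finite_cartesian_product finite_lists_length_eq) auto
qed

text \<open>\<open>rl\<close> leaves out exactly the first constant block, so the bound says that
  this block has at least two entries.\<close>

lemma rl_two:
  assumes "length S = d" "2 < d" "rl S \<le> d - 2" obtains a S' where "S = a # a # S'"
proof -
  obtain a b S' where S: "S = a # b # S'" using assms by (cases S; cases "tl S") auto
  have "a = b"
  proof (rule ccontr)
    assume "a \<noteq> b"
    then have "rl S = d - 1" using S assms(1) by (auto simp: rl_def)
    then show False using assms by simp
  qed
  then show ?thesis using that S by blast
qed

lemma geometric_Suc: "(s::nat) * (2 ^ Suc n - 1) = s + 2 * (s * (2 ^ n - 1))"
proof -
  define r :: nat where "r = 2 ^ n - 1"
  have "(1::nat) \<le> 2 ^ n" by simp
  then have "(2::nat) ^ Suc n - 1 = 1 + 2 * r" unfolding power_Suc r_def by arith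
  then show ?thesis unfolding r_def[symmetric] by (simp only: distrib_left mult_1_right mult.left_commute)
qed

lemma wdeg_cw: "0 < s \<Longrightarrow> wdeg (cw s d) = s * (2 ^ d - 1)"
proof -
  assume s: "0 < s"
  have "{i. 1 \<le> i \<and> cw s d i \<noteq> 0} = {1..d}" using s by (auto simp: cw_def)
  then have "wdeg (cw s d) = (\<Sum>i=1..d. 2 ^ (i - 1) * s)" by (auto simp: wdeg_def cw_def)
  also have "\<dots> = s * (2 ^ d - 1)"
  proof (induction d)
    case (Suc d)
    have "(1::nat) \<le> 2 ^ d" by simp
    then have "s \<le> s * 2 ^ d" by simp
    then show ?case using Suc by (simp add: algebra_simps)
  qed simp
  finally show ?thesis .
qed

context level_degrees begin

lemma fij_embeds:
  assumes ij: "1 \<le> i" "i < j" "j \<le> k"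
  shows "embeds k s (\<lambda>a. ex (fij k i j a))"
proof (rule embeds_of_positions)
  show inj: "inj_on (pos i j) {..<s}" using ij by (auto simp: inj_on_def pos_def split: if_splits)
  have sub: "pos i j ` {..<s} \<subseteq> cmp k i j" using ij ks by (auto simp: pos_def cmp_def)
  then show "pos i j ` {..<s} \<subseteq> {..<k}" using cmp_subset by blast
  have eq: "pos i j ` {..<s} = cmp k i j"
  proof (rule card_subset_eq[OF _ sub])
    show "finite (cmp k i j)" by (rule finite_subset[OF cmp_subset]) simp
    show "card (pos i j ` {..<s}) = card (cmp k i j)" using card_image[OF inj] card_cmp[of i j] ij by simp
  qed
  show "lookup (ex (fij k i j a)) (pos i j t) = a ! t" if "length a = s" "t < s" for a t
  proof -
    have "pos i j t \<in> cmp k i j" using eq that by auto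
    then show ?thesis using ij that by (auto simp: lookup_ex fij_nth cmp_def pos_def split: if_splits)
  qed
  show "lookup (ex (fij k i j a)) l = 0" if "length a = s" "l \<notin> pos i j ` {..<s}" for a l
    using that(2) unfolding eq by (auto simp: lookup_ex fij_nth cmp_def)
qed

lemma fij_surj:
  assumes ij: "1 \<le> i" "i < j" "j \<le> k" and g: "length g = k" "g ! (i - 1) = 0" "g ! (j - 1) = 0"
  obtains y where "length y = s" "fij k i j y = g" "sum_list y = sum_list g"
proof -
  define y where "y = map (\<lambda>t. g ! pos i j t) [0..<s]"
  have y: "length y = s" by (simp add: y_def)
  have "fij k i j y = g"
  proof (rule nth_equalityI)
    fix l assume "l < length (fij k i j y)"
    then have l: "l < k" by simp
    consider "Suc l = i" | "Suc l = j" | "Suc l < i" | "i < Suc l" "Suc l < j" | "j < Suc l" by linarith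
    then show "fij k i j y ! l = g ! l"
    proof cases
      case 1 then show ?thesis using l g by (auto simp: fij_nth)
    next
      case 2 then show ?thesis using l g by (auto simp: fij_nth)
    next
      case 3 then show ?thesis using l ij ks by (auto simp: fij_nth y_def pos_def)
    next
      case 4 
      then obtain m where "l = Suc m" using ij by (cases l) auto
      then show ?thesis using 4 l ij ks by (auto simp: fij_nth y_def pos_def)
    next
      case 5
      define m where "m = l - 2"
      have "l = Suc (Suc m)" using 5 ij by (simp add: m_def)
      then show ?thesis using 5 l ij ks by (auto simp: fij_nth y_def pos_def)
    qed
  qed (use g in simp)
  moreover have "sum_list (fij k i j y) = sum_list y"
    using fij_embeds[OF ij] y by (auto simp: embeds_def dg_ex)
  ultimately show ?thesis using that y by metis
qed

lemma pre_aspan: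
  assumes "(I, J) \<in> PSeq k n" "F \<in> aspan (S \<union> hits k (N e))"
  shows "pre k I J F \<in> aspan (pre k I J ` S \<union> hits k (N (e + n)))"
  by (rule aspan_image[OF assms(2)]) (auto simp: pre_add intro!: aspan_base pre_hits[OF assms(1)])

lemma N_closed: "N (e + n) = 2 ^ n * N e + s * (2 ^ n - 1)"
proof (induction n)
  case (Suc n)
  then show ?case using N_Suc[of "e + n"] unfolding geometric_Suc by simp
qed simp

lemma sum_XIJ: "(H, K) \<in> PSeq k n \<Longrightarrow> sum_list (XIJ k H K) = s * (2 ^ n - 1)"
proof (induction n arbitrary: H K)
  case 0
  then have "H = []" "K = []" by (auto simp: PSeq_def)
  then show ?case by (simp add: XIJ_def sum_list_0 del: upt_Suc)
next
  case (Suc n)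
  obtain H' h K' q where HK: "H = H' @ [h]" "K = K' @ [q]" "(H', K') \<in> PSeq k n" "1 \<le> h" "h < q" "q \<le> k"
    using Suc(2) by (rule PSeq_snocE)
  have len: "length H' = length K'" using HK(3) by (auto simp: PSeq_def)
  have "card (cmp k h q) = s" using HK by (intro card_cmp) auto
  then have "sum_list (XIJ k H K) = s + 2 * (s * (2 ^ n - 1))"
    unfolding HK(1,2) XIJ_snoc[OF len] sum_list_comb[OF cmp_subset length_XIJ] using Suc(1)[OF HK(3)] by simp
  then show ?case unfolding geometric_Suc .
qed

text \<open>Only s variables are available: either all of them have odd exponents and one level is
  stripped off, or fewer do and \<open>low_hit_X\<close> applies. At level 0 the generating set of
  P_s enters, and \<open>toE_hit\<close> carries hit polynomials of P_s to hit polynomials of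
  P_k.\<close>

lemma fij_reduce:
  assumes ij: "1 \<le> i" "i < j" "j \<le> k"
    and Y: "\<Y> \<subseteq> polys_deg s (N 0)" "polys_deg s (N 0) \<subseteq> ssum (f2span \<Y>) (hit s)"
    and y: "length y = s" "sum_list y = N e"
  shows "ml (fij k i j y) \<in> aspan ((\<lambda>Y. pre k (replicate e i) (replicate e j) (toE (\<lambda>a. ex (fij k i j a)) Y)) ` \<Y> \<union> hits k (N e))"
  using y
proof (induction e arbitrary: y)
  case 0
  let ?E = "\<lambda>a. ex (fij k i j a)"
  have "{y} \<in> polys_deg s (N 0)" using 0 by (simp add: polys_deg_def polys_def)
  then obtain P h where P: "{y} = padd P h" "P \<in> f2span \<Y>" "h \<in> hit s" using Y(2) by (auto simp: ssum_def)
  have Pd: "P \<in> polys_deg s (N 0)" by (rule f2span_closed[OF P(2)]) (use Y polys_deg_padd in auto)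
  have "h = padd {y} P" unfolding P(1) by (auto simp: padd_def)
  then have hd: "h \<in> polys_deg s (N 0)" using polys_deg_padd[OF \<open>{y} \<in> _\<close> Pd] by simp
  have "ml (fij k i j y) = toE ?E P + toE ?E h"
    using arg_cong[OF P(1), of "toE ?E"] toE_padd[OF polys_deg_finite[OF Pd] polys_deg_finite[OF hd]] by simp
  moreover have "toE ?E P \<in> aspan (toE ?E ` \<Y>)"
    by (rule toE_f2span[OF P(2)]) (use Y polys_deg_finite in auto)
  then have "toE ?E P \<in> aspan (toE ?E ` \<Y> \<union> hits k (N 0))" by (rule subsetD[OF aspan_mono, rotated]) auto
  moreover have "toE ?E h \<in> aspan (toE ?E ` \<Y> \<union> hits k (N 0))"
    by (rule aspan_base) (use toE_hit[OF fij_embeds[OF ij] P(3) hd] in auto)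
  ultimately show ?case by (simp add: aspan_add)
next
  case (Suc e)
  let ?a = "fij k i j y"
  have C: "card (cmp k i j) = s" using ij by (intro card_cmp) auto
  have sub: "odds ?a \<subseteq> cmp k i j" by (auto simp: odds_def cmp_def fij_nth)
  have fin: "finite (cmp k i j)" by (rule finite_subset[OF cmp_subset]) simp
  have hf: "half ?a = fij k i j (half y)" using Suc ks ij by (intro half_fij) auto
  have ml: "ml ?a = X (odds ?a) * (ml (fij k i j (half y)))^2" using ml_decomp[of ?a k] hf by simp
  have sa: "sum_list ?a = N (Suc e)" using fij_embeds[OF ij] Suc by (auto simp: embeds_def dg_ex)
  have sm: "N (Suc e) = card (odds ?a) + 2 * sum_list (fij k i j (half y))" using sum_list_decomp[of ?a] hf sa by simp
  show ?case
  proof (cases "odds ?a = cmp k i j")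
    case False
    then have "card (odds ?a) < s" using psubset_card_mono[OF fin] sub C by blast
    then have "ml ?a \<in> hits k (N (Suc e))"
      unfolding ml by (intro low_hit_X[OF _ _ hom_ml]) (use sm sub cmp_subset[of k i j] in auto)
    then show ?thesis by (intro aspan_base) auto
  next
    case True
    have "sum_list (fij k i j (half y)) = N e" using sm True C N_Suc[of e] by simp
    moreover have "sum_list (fij k i j (half y)) = sum_list (half y)"
      using fij_embeds[OF ij] Suc(2) by (auto simp: embeds_def dg_ex)
    ultimately have IH: "ml (fij k i j (half y)) \<in> aspan ((\<lambda>Y. pre k (replicate e i) (replicate e j) (toE (\<lambda>a. ex (fij k i j a)) Y)) ` \<Y> \<union> hits k (N e))"
      using Suc(1)[of "half y"] Suc(2) by simp
    have ps: "pre k (replicate (Suc e) i) (replicate (Suc e) j) F = X (cmp k i j) * (pre k (replicate e i) (replicate e j) F)^2" for F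
      using pre_snoc[of "replicate e i" "replicate e j" k i j F] by (simp add: replicate_append_same)
    have "X (cmp k i j) * (ml (fij k i j (half y)))^2 \<in>
      aspan ((\<lambda>Y. pre k (replicate (Suc e) i) (replicate (Suc e) j) (toE (\<lambda>a. ex (fij k i j a)) Y)) ` \<Y> \<union> hits k (N (Suc e)))"
      by (rule aspan_image[OF IH, of "\<lambda>F. X (cmp k i j) * F^2"])
        (auto simp: f2_square_add distrib_left ps simp del: replicate_Suc intro!: aspan_base square_hit_X[OF cmp_subset C])
    then show ?thesis unfolding ml True .
  qed
qed

end

text \<open>\<open>\<Y>\<close> is an arbitrary generating set of polynomials: the admissible
  monomials yield the explicit generators, a generating set of least size yields the bound on the
  dimension.\<close>

locale compatible_family = level_degrees +
  fixes d0 e0 :: nat and B :: "(nat list \<times> nat list) set" and \<Y> :: "poly set"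
  assumes d0: "2 < d0" and compat: "compatible k d0 B"
    and Y_deg: "\<Y> \<subseteq> polys_deg s (N 0)" and Y_span: "polys_deg s (N 0) \<subseteq> ssum (f2span \<Y>) (hit s)"
begin

text \<open>With d = e0 + d0, the inner constant prefix supplies the power of X_(i,j), because (2^e0
  - 1) 2^d0 = 2^d - 2^d0.\<close>

definition gen_image :: "nat list \<Rightarrow> nat list \<Rightarrow> poly \<Rightarrow> f2poly" where
  "gen_image I J Y = pre k I J (pre k (replicate e0 (Min (set I))) (replicate e0 (Min (set J)))
      (toE (\<lambda>a. ex (fij k (Min (set I)) (Min (set J)) a)) Y))"

definition target :: "f2poly set" where
  "target = aspan ({gen_image I J Y | I J Y. (I, J) \<in> B \<and> Y \<in> \<Y>} \<union> hits k (N (e0 + d0)))"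

lemma target_add: "u \<in> target \<Longrightarrow> v \<in> target \<Longrightarrow> u + v \<in> target"
  unfolding target_def by (rule aspan_add)
lemma target_cancel: "u + v \<in> target \<Longrightarrow> v \<in> target \<Longrightarrow> u \<in> target"
  unfolding target_def by (rule aspan_cancel)
lemma target_sum: "(\<And>i. i \<in> A \<Longrightarrow> f i \<in> target) \<Longrightarrow> sum f A \<in> target"
  unfolding target_def by (rule aspan_sum)
lemma target_hits: "v \<in> hits k (N (e0 + d0)) \<Longrightarrow> v \<in> target"
  unfolding target_def by (rule aspan_base) simp

lemma B_PInc: "B \<subseteq> PInc k d0" using compat by (simp add: compatible_def)
lemma B_PSeq: "B \<subseteq> PSeq k d0" using B_PInc by (auto simp: PInc_def)
lemma finite_B: "finite B" using B_PSeq finite_PSeq finite_subset by blast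

lemma k_minus: "k - 2 = s" using ks by simp

text \<open>Multiplication by \<open>(ml g) ^ (2 ^ d0)\<close> leaves the d0 lowest binary digits of
  the exponents unchanged, so the product inherits the weights of \<open>y\<close> up to level d0,
  where \<open>bad\<close> is decided.\<close>

lemma bad_multiple:
  assumes y: "length y = k" "sum_list y = s * (2 ^ d0 - 1)" and g: "length g = k" "sum_list g = N e0"
    and yy: "wlt (weight y) (cw s d0) \<or> (\<exists>h\<ge>1. pw h y < pw h (minspike (s * (2 ^ d0 - 1))))"
  shows "ml y * (ml g) ^ (2 ^ d0) \<in> hits k (N (e0 + d0))"
proof -
  define a where "a = map (\<lambda>l. y ! l + 2 ^ d0 * g ! l) [0..<k]"
  have a: "length a = k" by (simp add: a_def)
  have mla: "ml a = ml y * (ml g) ^ (2 ^ d0)"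
    unfolding a_def ml_plus ml_times using map_nth[of y] map_nth[of g] y g by simp
  have "sum_list a = (\<Sum>l<k. y ! l) + 2 ^ d0 * (\<Sum>l<k. g ! l)"
    by (simp add: a_def sum_list_sum_nth atLeast0LessThan sum.distrib sum_distrib_left)
  then have "sum_list a = sum_list y + 2 ^ d0 * sum_list g"
    using y g by (simp add: sum_list_sum_nth atLeast0LessThan)
  then have sa: "sum_list a = N (e0 + d0)" using y g N_closed[of e0 d0] by simp
  have w: "weight a i = weight y i" if "1 \<le> i" "i \<le> d0" for i
  proof -
    have "2 ^ d0 = 2 ^ (i - 1) * (2 * (2::nat) ^ (d0 - i))"
      using that by (simp flip: power_Suc power_add)
    then have "((u + 2 ^ d0 * v) div 2 ^ (i - 1)) mod 2 = (u div 2 ^ (i - 1)) mod (2::nat)" for u v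
      by (simp add: mult.assoc)
    then show ?thesis unfolding weight_def a_def using y by simp
  qed
  have p: "pw h a = pw h y" if "h \<le> d0" for h
  proof -
    have "2 ^ d0 = (2::nat) ^ h * 2 ^ (d0 - h)" using that by (simp flip: power_add)
    then have "(u + 2 ^ d0 * v) mod 2 ^ h = u mod (2::nat) ^ h" for u v by (simp add: mult.assoc)
    moreover have "pw h y = sum_list (map (\<lambda>l. y ! l mod 2 ^ h) [0..<k])"
      unfolding pw_def using map_nth[of y] y by (metis (mono_tags, lifting) map_map comp_apply map_eq_conv)
    ultimately show ?thesis unfolding a_def by (simp add: pw_def o_def)
  qed
  have "bad s (e0 + d0) False a"
    using yy
  proof
    assume "wlt (weight y) (cw s d0)"
    then obtain i where i: "i \<ge> 1" "\<And>j. 1 \<le> j \<Longrightarrow> j < i \<Longrightarrow> weight y j = cw s d0 j" "weight y i < cw s d0 i"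
      unfolding wlt_def by blast
    have "i \<le> d0" using i(3) by (auto simp: cw_def split: if_splits)
    then show ?thesis using i w by (intro bad_lex[of i]) (auto simp: cw_def)
  next
    assume "\<exists>h\<ge>1. pw h y < pw h (minspike (s * (2 ^ d0 - 1)))"
    then obtain h0 where "1 \<le> h0" "pw h0 y < pw h0 (minspike (s * (2 ^ d0 - 1)))" by blast
    then obtain h where h: "1 \<le> h" "h \<le> d0" "pw h y < s * (2 ^ h - 1)" "h = d0 \<longrightarrow> 3 \<le> s \<longrightarrow> pw h y + 2 ^ h < s * (2 ^ h - 1)"
      using pcal_level[OF s2 _ y(2)] d0 by force
    show ?thesis by (rule bad_pw[OF a, of False _ h]) (use h p sa in auto)
  qed
  then show ?thesis using bad_hit[OF a] sa mla by auto
qed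

text \<open>The three error terms become hit for different reasons: squares of index below 2^d0 pass
  through a 2^d0-th power, smaller weight vectors fall under \<open>bad_lex\<close>, and
  \<open>Pcal\<close> falls under \<open>pcal_level\<close> with \<open>bad_pw\<close>.\<close>

lemma compat_multiple:
  assumes Q: "Q \<in> ssum (ssum (hitA d0 k) (Pminus k (cw (k-2) d0))) (Pcal k ((k-2) * (2^d0 - 1)))"
    and Qd: "Q \<in> polys_deg k (s * (2 ^ d0 - 1))" and g: "length g = k" "sum_list g = N e0"
  shows "toE ex Q * (ml g) ^ (2 ^ d0) \<in> hits k (N (e0 + d0))"
proof -
  let ?n = "s * (2 ^ d0 - 1)" and ?G = "(ml g) ^ (2 ^ d0)"
  obtain a b c where abc: "Q = padd (padd a b) c" "a \<in> hitA d0 k" "b \<in> Pminus k (cw s d0)" "c \<in> Pcal k ?n"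
    using Q unfolding ssum_def k_minus by blast
  have wd: "wdeg (cw s d0) = ?n" using wdeg_cw s2 by simp
  define V where "V = {P. P \<in> polys_deg k ?n \<and> toE ex P * ?G \<in> hits k (N (e0 + d0))}"
  have V0: "{} \<in> V" by (simp add: V_def)
  have Vp: "padd A C \<in> V" if "A \<in> V" "C \<in> V" for A C
    using that polys_deg_finite by (auto simp: V_def toE_padd distrib_right intro: polys_deg_padd hits_add)
  have bV: "b \<in> V"
  proof (rule f2span_closed[OF abc(3)[unfolded Pminus_def] V0 Vp])
    show "{{y} |y. length y = k \<and> sum_list y = wdeg (cw s d0) \<and> wlt (weight y) (cw s d0)} \<subseteq> V"
      using bad_multiple[OF _ _ g] wd by (auto simp: V_def polys_deg_def polys_def)
  qed
  have cV: "c \<in> V"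
  proof (rule f2span_closed[OF abc(4)[unfolded Pcal_def] V0 Vp])
    show "{{y} |y. length y = k \<and> sum_list y = ?n \<and> (\<exists>h\<ge>1. (\<Sum>j = 1..h. 2 ^ (j - 1) * weight y j)
        < (\<Sum>j = 1..h. 2 ^ (j - 1) * weight (minspike ?n) j))} \<subseteq> V"
      unfolding pw_weight[symmetric]
    proof (rule subsetI)
      fix t assume "t \<in> {{y} |y. length y = k \<and> sum_list y = ?n \<and> (\<exists>h\<ge>1. pw h y < pw h (minspike ?n))}"
      then obtain y h where t: "t = {y}" and y: "length y = k" "sum_list y = ?n" and h: "h \<ge> 1" "pw h y < pw h (minspike ?n)" by blast
      have "ml y * ?G \<in> hits k (N (e0 + d0))" by (rule bad_multiple[OF y g]) (use h in blast)
      then show "t \<in> V" unfolding t using y by (simp add: V_def polys_deg_def polys_def)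
    qed
  qed
  \<comment> \<open>An element of \<open>hitA\<close> may be inhomogeneous; the degree of
    \<open>a\<close> is recovered from \<open>Q\<close> and the two other parts.\<close>
  have "a = padd (padd Q c) b" unfolding abc(1) by (auto simp: padd_def)
  then have ad: "a \<in> polys_deg k ?n" using Qd bV cV by (auto simp: V_def intro: polys_deg_padd)
  have "a \<in> f2span {Sq i f | i f. (0 < i \<and> i < 2 ^ d0) \<and> f \<in> polys k}"
    using abc(2) by (simp add: hitA_def conj_assoc)
  from toE_hit_span[OF embeds_ex this ad]
  have "toE ex a \<in> {v. v * ?G \<in> hits k (N (e0 + d0))}"
  proof (rule aspan_closed)
    fix t assume "t \<in> {sq i (ml a) |i a. (0 < i \<and> i < 2 ^ d0) \<and> length a = k \<and> sum_list a + i = ?n}"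
    then obtain i y where t: "t = sq i (ml y)" "0 < i" "i < 2 ^ d0" "length y = k" "sum_list y + i = ?n" by blast
    have "t * ?G = sq i (ml y * ?G)" unfolding t(1) using sq_mult_power[OF t(3)] by simp
    moreover have "ml y * ?G \<in> hom k (sum_list y + 2 ^ d0 * N e0)"
      using hom_mult[OF hom_ml[OF t(4)] hom_power[OF hom_ml[OF g(1)], of "2 ^ d0"]] g(2) by simp
    ultimately show "t \<in> {v. v * ?G \<in> hits k (N (e0 + d0))}"
      using t N_closed[of e0 d0] by (auto intro!: hits_sq)
  qed (auto simp: distrib_right intro: hits_add)
  then have "a \<in> V" using ad by (simp add: V_def)
  then have "Q \<in> V" unfolding abc(1) using bV cV by (intro Vp)
  then show ?thesis by (simp add: V_def)
qed

lemma compat_relation: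
  assumes HK: "(H, K) \<in> PSeq k d0"
  obtains S where "finite S" "S \<subseteq> B" "\<And>I J. (I, J) \<in> S \<Longrightarrow> Min (set I) = Min (set H) \<and> Min (set J) \<le> Min (set K)"
    "\<And>g. length g = k \<Longrightarrow> sum_list g = N e0 \<Longrightarrow> pre k H K (ml g) + (\<Sum>(I,J)\<in>S. pre k I J (ml g)) \<in> hits k (N (e0 + d0))"
proof -
  let ?U = "{Min (set H)<..Min (set K)}"
  obtain Bu where Bu: "\<And>u. u \<in> ?U \<Longrightarrow> Bu u \<subseteq> B \<and> (\<forall>(I,J)\<in>Bu u. Min (set I) = Min (set H) \<and> Min (set J) = u)"
    and rel: "padd {XIJ k H K} (Psum (\<lambda>u. Psum (\<lambda>(I,J). {XIJ k I J}) (Bu u)) ?U)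
        \<in> ssum (ssum (hitA d0 k) (Pminus k (cw (k-2) d0))) (Pcal k ((k-2) * (2^d0 - 1)))"
    using bspec[OF conjunct2[OF conjunct2[OF iffD1[OF compatible_def compat]]] HK] unfolding prod.case by metis
  define S where "S = (\<Union>u\<in>?U. Bu u)"
  have BuB: "Bu u \<subseteq> B" if "u \<in> ?U" for u using Bu[OF that] by (rule conjunct1)
  have Bum: "Min (set I) = Min (set H) \<and> Min (set J) = u" if "u \<in> ?U" "(I, J) \<in> Bu u" for u I J
    using bspec[OF conjunct2[OF Bu[OF that(1)]] that(2)] by simp
  have SB: "S \<subseteq> B" unfolding S_def by (rule UN_least) (rule BuB)
  have finBu: "finite (Bu u)" if "u \<in> ?U" for u using BuB[OF that] finite_B by (rule finite_subset)
  have mono: "{XIJ k I J} \<in> polys_deg k (s * (2 ^ d0 - 1))" if "(I, J) \<in> PSeq k d0" for I J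
    using sum_XIJ[OF that] by (simp add: polys_deg_def polys_def)
  let ?F = "\<lambda>(I,J). {XIJ k I J}"
  have inner: "Psum ?F (Bu u) \<in> polys_deg k (s * (2 ^ d0 - 1))" if "u \<in> ?U" for u
  proof (rule Psum_closed[OF finBu[OF that] _ polys_deg_padd])
    fix t assume "t \<in> Bu u"
    then have "t \<in> PSeq k d0" using BuB[OF that] B_PSeq by blast
    then show "?F t \<in> polys_deg k (s * (2 ^ d0 - 1))" using mono by (cases t) auto
  qed auto
  define Q where "Q = padd {XIJ k H K} (Psum (\<lambda>u. Psum ?F (Bu u)) ?U)"
  have outer: "Psum (\<lambda>u. Psum ?F (Bu u)) ?U \<in> polys_deg k (s * (2 ^ d0 - 1))"
    by (rule Psum_closed[OF _ _ polys_deg_padd]) (use inner in auto)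
  have Qd: "Q \<in> polys_deg k (s * (2 ^ d0 - 1))" unfolding Q_def by (rule polys_deg_padd[OF mono[OF HK] outer])
  have "toE ex (Psum (\<lambda>u. Psum ?F (Bu u)) ?U) = (\<Sum>u\<in>?U. toE ex (Psum ?F (Bu u)))"
    by (rule toE_Psum) (use inner polys_deg_finite in auto)
  also have "\<dots> = (\<Sum>u\<in>?U. \<Sum>t\<in>Bu u. toE ex (?F t))"
    by (rule sum.cong[OF refl], rule toE_Psum) (auto simp: finBu)
  also have "\<dots> = (\<Sum>t\<in>S. toE ex (?F t))"
    unfolding S_def
  \<comment> \<open>The sets \<open>Bu u\<close> are disjoint because \<open>u\<close> is the
    minimum of the second sequence, so the double sum is a sum over their union without
    cancellation.\<close>
  proof (rule sum.UNION_disjoint[symmetric])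
    show "\<forall>i\<in>?U. \<forall>j\<in>?U. i \<noteq> j \<longrightarrow> Bu i \<inter> Bu j = {}"
    proof (intro ballI impI equals0I)
      fix i j t assume ij: "i \<in> ?U" "j \<in> ?U" "i \<noteq> j" and t: "t \<in> Bu i \<inter> Bu j"
      obtain I J where IJ: "t = (I, J)" by (cases t)
      show False using Bum[OF ij(1), of I J] Bum[OF ij(2), of I J] t IJ ij(3) by simp
    qed
  qed (use finBu in auto)
  finally have toQ: "toE ex Q = ml (XIJ k H K) + (\<Sum>(I,J)\<in>S. ml (XIJ k I J))"
    unfolding Q_def toE_padd[OF finite.insertI[OF finite.emptyI] polys_deg_finite[OF outer]] by (simp add: case_prod_unfold)
  show ?thesis
  proof (rule that[OF finite_subset[OF SB finite_B] SB])
    show "Min (set I) = Min (set H) \<and> Min (set J) \<le> Min (set K)" if mem: "(I, J) \<in> S" for I J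
    proof -
      obtain u where "u \<in> ?U" "(I, J) \<in> Bu u" using mem by (auto simp: S_def)
      then show ?thesis using Bum[of u I J] by simp
    qed
    fix g assume g: "length g = k" "sum_list g = N e0"
    have len: "length (fst t) = d0" if "t \<in> S" for t using that SB B_PSeq by (cases t) (auto simp: PSeq_def)
    have "(\<Sum>(I,J)\<in>S. ml (XIJ k I J)) * (ml g) ^ (2 ^ d0) = (\<Sum>(I,J)\<in>S. pre k I J (ml g))"
      unfolding sum_distrib_right by (rule sum.cong) (auto simp: pre_def dest!: len)
    moreover have "length H = d0" using HK by (simp add: PSeq_def)
    ultimately have "toE ex Q * (ml g) ^ (2 ^ d0) = pre k H K (ml g) + (\<Sum>(I,J)\<in>S. pre k I J (ml g))"
      unfolding toQ distrib_right by (simp add: pre_def)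
    then show "pre k H K (ml g) + (\<Sum>(I,J)\<in>S. pre k I J (ml g)) \<in> hits k (N (e0 + d0))"
      using compat_multiple[OF rel[folded Q_def] Qd g] by simp
  qed
qed

lemma B_heads:
  assumes "(I, J) \<in> B"
  obtains i j I' J' where "I = i # i # I'" "J = j # j # J'" "Min (set I) = i" "Min (set J) = j" "1 \<le> i" "i < j" "j \<le> k"
proof -
  have len: "length I = d0" "length J = d0" and sorted: "sorted I" "sorted J" and PS: "(I, J) \<in> PSeq k d0"
    using assms B_PInc by (auto simp: PInc_def PSeq_def)
  have "rl I \<le> d0 - 2" "rl J \<le> d0 - 2" using compat assms unfolding compatible_def by auto
  then obtain i I' j J' where IJ: "I = i # i # I'" "J = j # j # J'"
    using rl_two[OF len(1) d0] rl_two[OF len(2) d0] by metis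
  have "Min (set I) = i" "Min (set J) = j" using sorted IJ by (auto intro!: Min_eqI)
  moreover have "1 \<le> i \<and> i < j \<and> j \<le> k" using PS d0 unfolding PSeq_def IJ by force
  ultimately show ?thesis using that IJ by blast
qed

lemma eliminated_in_target:
  assumes IJ: "(I, J) \<in> B" and g: "length g = k" "sum_list g = N e0" "g ! (Min (set I) - 1) = 0" "g ! (Min (set J) - 1) = 0"
  shows "pre k I J (ml g) \<in> target"
proof -
  define i j where "i = Min (set I)" and "j = Min (set J)"
  have ij: "1 \<le> i" "i < j" "j \<le> k" using B_heads[OF IJ] unfolding i_def j_def by metis+
  obtain y where y: "length y = s" "fij k i j y = g" "sum_list y = N e0"
    using fij_surj[OF ij g(1)] g(2-4) unfolding i_def j_def by metis
  have "ml g \<in> aspan ((\<lambda>Y. pre k (replicate e0 i) (replicate e0 j) (toE (\<lambda>a. ex (fij k i j a)) Y)) ` \<Y> \<union> hits k (N e0))"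
    using fij_reduce[OF ij Y_deg Y_span y(1,3)] y(2) by simp
  from pre_aspan[OF subsetD[OF B_PSeq IJ] this]
  show ?thesis unfolding target_def
    by (rule subsetD[OF aspan_mono, rotated]) (use IJ in \<open>auto simp: gen_image_def i_def j_def\<close>)
qed

lemma prefix_in_target:
  assumes "(H, K) \<in> PSeq k d0" "length g = k" "sum_list g = N e0"
  shows "pre k H K (ml g) \<in> target"
  using assms
proof (induction "(Min (set H), Min (set K), g ! (Min (set H) - 1) + g ! (Min (set K) - 1))" arbitrary: H K g
    rule: wf_induct_rule[OF wf_lex_prod[OF wf_less_than wf_lex_prod[OF wf_less_than wf_less_than]]])
  case (1 H K g)
  note IH = "1"(1) and HK = "1"(2) and g = "1"(3,4)
  have IH': "pre k H' K' (ml g') \<in> target"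
    if "(H', K') \<in> PSeq k d0" "length g' = k" "sum_list g' = N e0"
      "Min (set H') < Min (set H) \<or> Min (set H') = Min (set H) \<and> (Min (set K') < Min (set K) \<or> Min (set K') = Min (set K) \<and>
        g' ! (Min (set H') - 1) + g' ! (Min (set K') - 1) < g ! (Min (set H) - 1) + g ! (Min (set K) - 1))" for H' K' g'
    by (rule IH[OF _ that(1-3)]) (use that(4) in auto)
  \<comment> \<open>Compatibility is applied first: from here on the pair lies in \<open>B\<close>,
    with its two topmost entries equal, and neither minimum has been raised.\<close>
  obtain S where S: "finite S" "S \<subseteq> B" "\<And>I J. (I, J) \<in> S \<Longrightarrow> Min (set I) = Min (set H) \<and> Min (set J) \<le> Min (set K)"
    "pre k H K (ml g) + (\<Sum>(I,J)\<in>S. pre k I J (ml g)) \<in> hits k (N (e0 + d0))"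
    using compat_relation[OF HK] g by metis
  have "pre k I J (ml g) \<in> target" if IJS: "(I, J) \<in> S" for I J
  proof -
    have IJB: "(I, J) \<in> B" using S(2) IJS by blast
    obtain i j I2 J2 where IJ: "I = i # i # I2" "J = j # j # J2" "Min (set I) = i" "Min (set J) = j" "1 \<le> i" "i < j" "j \<le> k"
      using B_heads[OF IJB] by metis
    have Hi: "Min (set H) = i" and Kj: "j \<le> Min (set K)" using S(3)[OF IJS] IJ by auto
    define I1 J1 where "I1 = i # I2" and "J1 = j # J2"
    obtain d1 where d1: "d0 = Suc d1" using d0 by (cases d0) auto
    have PS1: "(I1, J1) \<in> PSeq k d1"
      using PSeq_ConsD[of i I1 j J1 k d1] subsetD[OF B_PSeq IJB] IJ d1 by (simp add: I1_def J1_def)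
    have len1: "length I1 = length J1" using PS1 by (simp add: PSeq_def)
    have min1: "Min (set I1) = i" "Min (set J1) = j" using IJ by (auto simp: I1_def J1_def)
    \<comment> \<open>\<open>c\<close> is the entry of the topmost pair whose variable divides
      \<open>ml g\<close> and is exchanged, \<open>o'\<close> is the other entry.\<close>
    have move: "pre k I J (ml g) \<in> target" if co: "c = i \<and> o' = j \<or> c = j \<and> o' = i" and pos: "0 < g ! (c - 1)" for c o'
    proof -
      have ck: "1 \<le> c" "c \<le> k" "1 \<le> o'" "o' \<le> k" "c \<noteq> o'" using co IJ by auto
      define g' where "g' = g[c - 1 := g ! (c - 1) - 1]"
      have g': "length g' = k" using g by (simp add: g'_def)
      have gg: "g'[c - 1 := Suc (g' ! (c - 1))] = g" using pos ck g by (simp add: g'_def)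
      have c1: "c - 1 < length g'" using ck g' by simp
      have xg: "x (c - 1) * ml g' = ml g" using ml_x[OF c1] gg by simp
      have sg: "Suc (sum_list g') = N e0" using sum_list_incr[OF c1] gg g by simp
      define gl where "gl l = g'[l := Suc (g' ! l)]" for l
      have gl: "length (gl l) = k" "x l * ml g' = ml (gl l)" "sum_list (gl l) = N e0" if "l < k" for l
        using that g' sg ml_x[of l g'] sum_list_incr[of l g'] by (auto simp: gl_def)
      have cmp_sym: "cmp k a b = cmp k b a" for a b by (auto simp: cmp_def)
      have cij: "cmp k c o' = cmp k i j" using co cmp_sym by auto
      let ?t = "\<lambda>l. X (cmp k (Suc l) o') * (x l * ml g')^2"
      have "X (cmp k c o') * (x (c - 1) * ml g')^2 + (\<Sum>l\<in>cmp k c o'. ?t l) \<in> hits k (N (Suc e0))"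
        by (rule move_variable[OF ck hom_ml[OF g'] sg])
      from pre_hits[OF PS1 this]
      have "pre k I1 J1 (X (cmp k i j) * (ml g)^2) + (\<Sum>l\<in>cmp k c o'. pre k I1 J1 (?t l)) \<in> hits k (N (e0 + d0))"
        unfolding pre_add pre_sum xg cij d1 by simp
      moreover have "pre k I1 J1 (X (cmp k i j) * (ml g)^2) = pre k I J (ml g)"
        using pre_Cons[OF len1, of k i j "ml g"] IJ by (simp add: I1_def J1_def)
      ultimately have rel: "pre k I J (ml g) + (\<Sum>l\<in>cmp k c o'. pre k I1 J1 (?t l)) \<in> target"
        by (simp add: target_hits)
      have "pre k I1 J1 (?t l) \<in> target" if l: "l \<in> cmp k c o'" for l
      proof -
        have lk: "l < k" "Suc l \<noteq> i" "Suc l \<noteq> j" using l unfolding cij by (auto simp: cmp_def)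
        have lo: "Suc l \<noteq> o'" using lk co by auto
        define a b where "a = min (Suc l) o'" and "b = max (Suc l) o'"
        have "cmp k (Suc l) o' = cmp k a b" unfolding a_def b_def using cmp_sym by (simp add: min_def max_def)
        then have "pre k I1 J1 (?t l) = pre k (a # I1) (b # J1) (ml (gl l))"
          using pre_Cons[OF len1, of k a b "ml (gl l)"] gl(2)[OF lk(1)] by simp
        also have "\<dots> \<in> target"
        proof (rule IH')
          show "(a # I1, b # J1) \<in> PSeq k d0"
            unfolding d1 by (rule PSeq_Cons[OF PS1]) (use lk lo ck in \<open>auto simp: a_def b_def min_def max_def\<close>)
          show "length (gl l) = k" "sum_list (gl l) = N e0" using gl lk by auto
          \<comment> \<open>The sequences \<open>I1\<close> and \<open>J1\<close> still begin with i
            and j, so a change of the topmost pair cannot raise either minimum.\<close>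
          have mH: "Min (set (a # I1)) = min (Suc l) i"
          proof -
            have "Min (set (a # I1)) = min a i" using min1 by (simp add: I1_def)
            then show ?thesis using co IJ by (auto simp: a_def min_def)
          qed
          have mK: "Min (set (b # J1)) = min b j" using min1 by (simp add: J1_def)
          \<comment> \<open>The exchange lowers the exponent of x_c by one, and the variable that
            gains is neither x_i nor x_j.\<close>
          have third: "gl l ! (i - 1) + gl l ! (j - 1) < g ! (i - 1) + g ! (j - 1)"
          proof -
            have ne: "i - 1 \<noteq> l" "j - 1 \<noteq> l" "i - 1 \<noteq> j - 1" "i - 1 < k" "j - 1 < k" using lk IJ by auto
            then have "gl l ! (i - 1) = g' ! (i - 1)" "gl l ! (j - 1) = g' ! (j - 1)" by (auto simp: gl_def)
            then show ?thesis using co pos ne g by (auto simp: g'_def)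
          qed
          show "Min (set (a # I1)) < Min (set H) \<or> Min (set (a # I1)) = Min (set H) \<and>
            (Min (set (b # J1)) < Min (set K) \<or> Min (set (b # J1)) = Min (set K) \<and>
             gl l ! (Min (set (a # I1)) - 1) + gl l ! (Min (set (b # J1)) - 1) < g ! (Min (set H) - 1) + g ! (Min (set K) - 1))"
          proof (cases "Suc l < i")
            case True
            then show ?thesis unfolding mH Hi by simp
          next
            case False
            then have e1: "Min (set (a # I1)) = i" using mH by simp
            show ?thesis
            proof (cases "min b j < Min (set K)")
              case True
              then show ?thesis using e1 Hi mK by simp
            next
              case False
              then have "Min (set K) = j" "min b j = j" using Kj by auto
              then show ?thesis using e1 Hi mK third by simp
            qed
          qed
        qed
        finally show ?thesis .
      qed
      then have "(\<Sum>l\<in>cmp k c o'. pre k I1 J1 (?t l)) \<in> target" by (rule target_sum)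
      from target_cancel[OF rel this] show ?thesis .
    qed
    show ?thesis
    proof (cases "g ! (i - 1) = 0 \<and> g ! (j - 1) = 0")
      case True
      then show ?thesis using eliminated_in_target[OF IJB g] IJ by simp
    next
      case False
      then show ?thesis using move[of i j] move[of j i] by auto
    qed
  qed
  then have "(\<Sum>(I,J)\<in>S. pre k I J (ml g)) \<in> target" by (intro target_sum) auto
  from target_cancel[OF target_hits[OF S(4)] this] show ?case .
qed

lemma low_in_target:
  assumes "length a = k" "sum_list a = N (e0 + d0)" "card (odds a) \<le> s"
  shows "ml a \<in> target"
proof -
  have "ml a \<in> pure_mod d0 (e0 + d0)" by (rule reduce_to_pure[OF assms]) simp
  then show ?thesis
    unfolding pure_mod_def
  proof (rule aspan_closed)
    show "0 \<in> target" by (rule target_hits) simp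
    fix t assume "t \<in> {ml a |a. length a = k \<and> sum_list a = N (e0 + d0) \<and> level_pure d0 a} \<union> hits k (N (e0 + d0))"
    then show "t \<in> target"
    proof
      assume "t \<in> {ml a |a. length a = k \<and> sum_list a = N (e0 + d0) \<and> level_pure d0 a}"
      then obtain b where "t = ml b" "length b = k" "sum_list b = N (e0 + d0)" "level_pure d0 b" by blast
      then show ?thesis using pure_pre[of b d0 e0] prefix_in_target by metis
    qed (rule target_hits)
  qed (rule target_add)
qed

text \<open>The variables are multiplied in one at a time, and each adds at most one odd exponent; a
  repeated variable removes one again.\<close>

lemma xl_square_ml:
  assumes "set Z \<subseteq> {..<k}" "length c = k"
  shows "\<exists>a. length a = k \<and> ml a = xl Z * (ml c)^2 \<and> card (odds a) \<le> length Z \<and> sum_list a = length Z + 2 * sum_list c"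
  using assms(1)
proof (induction Z)
  case Nil
  show ?case
    using ml_comb[of "{}" k c] sum_list_comb[of "{}" k c] odds_comb[of "{}" k c] assms(2)
    by (intro exI[of _ "comb k {} c"]) auto
next
  case (Cons l Z)
  then obtain a where a: "length a = k" "ml a = xl Z * (ml c)^2" "card (odds a) \<le> length Z" "sum_list a = length Z + 2 * sum_list c"
    by auto
  have l: "l < length a" using Cons a by simp
  let ?b = "a[l := Suc (a ! l)]"
  have "odds ?b \<subseteq> insert l (odds a)" by (auto simp: odds_def nth_list_update split: if_splits)
  moreover have "finite (odds a)" by (rule finite_subset[OF odds_subset]) simp
  ultimately have "card (odds ?b) \<le> card (insert l (odds a))" by (intro card_mono) auto
  also have "\<dots> \<le> Suc (card (odds a))" using \<open>finite (odds a)\<close> by (simp add: card_insert_if)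
  finally have "card (odds ?b) \<le> Suc (card (odds a))" .
  then show ?case using a l ml_x[OF l] sum_list_incr[OF l]
    by (intro exI[of _ ?b]) (auto simp: mult.assoc)
qed

lemma lows_in_target: "u \<in> lows k (k - 1) (N (e0 + d0)) \<Longrightarrow> u \<in> target"
  unfolding lows_def
proof (erule aspan_closed)
  show "0 \<in> target" by (rule target_hits) simp
  fix t assume "t \<in> {xl Z * F\<^sup>2 |Z F d. set Z \<subseteq> {..<k} \<and> length Z < k - 1 \<and> F \<in> hom k d \<and> length Z + 2 * d = N (e0 + d0)}"
  then obtain Z F d where t: "t = xl Z * F^2" "set Z \<subseteq> {..<k}" "length Z < k - 1" "F \<in> hom k d" "length Z + 2 * d = N (e0 + d0)"
    by blast
  from hom_expand_ml[OF t(4)] have "xl Z * F^2 \<in> target"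
  proof induction
    case aspan_zero
    show ?case using target_hits[OF hits_zero] by simp
  next
    case (aspan_step v w)
    then obtain c where c: "v = ml c" "length c = k" "sum_list c = d" by blast
    obtain a where a: "length a = k" "ml a = xl Z * (ml c)^2" "card (odds a) \<le> length Z" "sum_list a = length Z + 2 * sum_list c"
      using xl_square_ml[OF t(2) c(2)] by blast
    have "ml a \<in> target" by (rule low_in_target) (use a c t ks in auto)
    then show ?case using aspan_step a c by (simp add: f2_square_add distrib_left target_add)
  qed
  then show "t \<in> target" using t by simp
qed (rule target_add)

text \<open>The terms of \<open>f\<close> with all exponents odd add up to X y^2, where X is the
  product of all variables and y is \<open>kameko f\<close>. As y is hit,
  \<open>square_hit_pair\<close> leaves only low remainders. In the other terms parity bounds the
  number of odd exponents by s.\<close>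

lemma kernel_in_target:
  assumes f: "f \<in> polys_deg k (N (e0 + d0))" and ker: "kameko f \<in> hit k"
  shows "toE ex f \<in> target"
proof -
  \<comment> \<open>Writing the level as a double successor makes \<open>N (Suc e1)\<close> at least
    s, hence positive, so that \<open>M\<close> is a genuine predecessor.\<close>
  define e1 where "e1 = e0 + d0 - 2"
  have e1: "e0 + d0 = Suc (Suc e1)" using d0 by (simp add: e1_def)
  let ?n = "N (e0 + d0)"
  define M where "M = N (Suc e1) - 1"
  have "0 < N (Suc e1)" using N_Suc[of e1] s2 by simp
  then have nM: "?n = k + 2 * M" using N_Suc[of "Suc e1"] ks by (simp add: M_def e1)
  have fin: "finite f" and fl: "\<And>a. a \<in> f \<Longrightarrow> length a = k" and fs: "\<And>a. a \<in> f \<Longrightarrow> sum_list a = ?n"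
    using f by (auto simp: polys_deg_def polys_def)
  define odd_part where "odd_part = {a \<in> f. odds a = {..<k}}"
  have allodd: "(\<forall>e\<in>set a. odd e) \<longleftrightarrow> odds a = {..<k}" if "a \<in> f" for a
  proof -
    have "(\<forall>e\<in>set a. odd e) \<longleftrightarrow> (\<forall>j<k. odd (a ! j))" using fl[OF that] by (simp add: all_set_conv_all_nth)
    then show ?thesis using fl[OF that] by (auto simp: odds_def)
  qed
  have kam: "map (\<lambda>e. (e - 1) div 2) a = half a" if "\<forall>e\<in>set a. odd e" for a :: "nat list"
    using that by (auto simp: half_def elim!: oddE)
  let ?g = "\<lambda>a. if (\<forall>e\<in>set a. odd e) then {map (\<lambda>e. (e - 1) div 2) a} else {}"
  have kd: "kameko f \<in> polys_deg k M"
    unfolding kameko_def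
  proof (rule Psum_closed[OF fin _ polys_deg_padd])
    fix a assume a: "a \<in> f"
    show "?g a \<in> polys_deg k M"
    proof (cases "\<forall>e\<in>set a. odd e")
      case True
      then have "sum_list (half a) = M"
        using allodd[OF a] sum_list_decomp[of a] fs[OF a] nM by simp
      then show ?thesis unfolding if_P[OF True] kam[OF True] using fl[OF a] by (simp add: polys_deg_def polys_def)
    next
      case False
      show ?thesis unfolding if_not_P[OF False] by simp
    qed
  qed auto
  have y: "toE ex (kameko f) \<in> hits k M" by (rule toE_hit[OF embeds_ex ker kd])
  have "toE ex (kameko f) = (\<Sum>a\<in>f. toE ex (?g a))"
    unfolding kameko_def by (rule toE_Psum[OF fin]) auto
  also have "\<dots> = (\<Sum>a\<in>f. if odds a = {..<k} then ml (half a) else 0)"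
  proof (rule sum.cong[OF refl])
    fix a assume a: "a \<in> f"
    show "toE ex (?g a) = (if odds a = {..<k} then ml (half a) else 0)"
    proof (cases "\<forall>e\<in>set a. odd e")
      case True
      show ?thesis unfolding if_P[OF True] kam[OF True] using True allodd[OF a] by simp
    next
      case False
      show ?thesis unfolding if_not_P[OF False] using False allodd[OF a] by simp
    qed
  qed
  also have "\<dots> = (\<Sum>a\<in>odd_part. ml (half a))"
    unfolding odd_part_def using fin by (simp add: sum.inter_filter)
  finally have "X {..<k} * (toE ex (kameko f))^2 = (\<Sum>a\<in>odd_part. X {..<k} * (ml (half a))^2)"
    by (simp add: f2_square_sum sum_distrib_left)
  also have "\<dots> = (\<Sum>a\<in>odd_part. ml a)"
    by (rule sum.cong[OF refl]) (use ml_decomp[OF fl] in \<open>simp add: odd_part_def\<close>)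
  finally have op: "(\<Sum>a\<in>odd_part. ml a) = X {..<k} * (toE ex (kameko f))^2" by simp
  obtain L where L: "set L = {..<k}" "length L = card {..<k}" "xl L = X {..<k}" using X_xl[of "{..<k}" k] by auto
  obtain u where u: "u \<in> lows k (length L - 1) ?n" "(xl L * (toE ex (kameko f))^2 + u, 0) \<in> hit_pairs k ?n"
    using square_hit_pair[OF y, of L ?n] L nM by auto
  have "u \<in> target" using lows_in_target u(1) L(2) by simp
  then have "X {..<k} * (toE ex (kameko f))^2 \<in> target"
    using target_cancel[of "X {..<k} * (toE ex (kameko f))^2" u] target_hits[OF hit_pairs_fst[OF u(2)]] L(3) by simp
  then have odd_target: "(\<Sum>a\<in>odd_part. ml a) \<in> target" using op by simp
  have "(\<Sum>a\<in>f - odd_part. ml a) \<in> target"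
  proof (rule target_sum)
    fix a assume a: "a \<in> f - odd_part"
    have ak: "length a = k" "sum_list a = ?n" using fl fs a by auto
    have "odds a \<noteq> {..<k}" using a by (auto simp: odd_part_def)
    then have "card (odds a) < k" using psubset_card_mono[of "{..<k}" "odds a"] odds_subset[of a] ak by auto
    moreover have "card (odds a) + 2 * sum_list (half a) = 2 * N (Suc e1) + s"
      using sum_list_decomp[of a] ak N_Suc[of "Suc e1"] e1 by simp
    ultimately have "card (odds a) \<le> s" using ks by presburger
    then show "ml a \<in> target" by (rule low_in_target[OF ak])
  qed
  moreover have "toE ex f = (\<Sum>a\<in>f - odd_part. ml a) + (\<Sum>a\<in>odd_part. ml a)"
    unfolding toE_def by (rule sum.subset_diff) (use fin in \<open>auto simp: odd_part_def\<close>)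
  ultimately show ?thesis using odd_target by (simp add: target_add)
qed

end

section \<open>The generators as exponent lists\<close>

lemma Xij_cmp: "Xij k i j = map (\<lambda>l. if l \<in> cmp k i j then 1 else 0) [0..<k]"
  by (rule nth_equalityI) (auto simp: Xij_def cmp_def simp del: upt_Suc)

lemma length_Xij [simp]: "length (Xij k i j) = k" by (simp add: Xij_def)

lemma pre_replicate: "pre k (replicate e i) (replicate e j) F = X (cmp k i j) ^ (2 ^ e - 1) * F ^ (2 ^ e)"
proof (induction e)
  case (Suc e)
  have "pre k (replicate (Suc e) i) (replicate (Suc e) j) F = X (cmp k i j) * (X (cmp k i j) ^ (2 ^ e - 1) * F ^ (2 ^ e))^2"
    using pre_snoc[of "replicate e i" "replicate e j" k i j F] Suc by (simp add: replicate_append_same)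
  also have "\<dots> = X (cmp k i j) ^ (1 + 2 * (2 ^ e - 1)) * F ^ (2 * 2 ^ e)"
    by (simp add: power_mult_distrib power_mult[symmetric] power_add mult.assoc mult.commute[of _ 2])
  also have "1 + 2 * (2 ^ e - 1) = 2 ^ Suc e - (1::nat)"
    using geometric_Suc[of 1 e] by simp
  finally show ?case by simp
qed simp

lemma sum_list_indicator: "A \<subseteq> {..<k} \<Longrightarrow> sum_list (map (\<lambda>l. if l \<in> A then 1 else 0) [0..<k]) = card A"
  by (simp add: sum_list_sum_nth atLeast0LessThan sum.If_cases Int_absorb1)

lemma Psum_all_empty: "finite S \<Longrightarrow> (\<And>s. s \<in> S \<Longrightarrow> F s = {}) \<Longrightarrow> Psum F S = {}"
  using Psum_closed[of S "{{}}" F] by auto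

context compatible_family begin

abbreviation gn :: "nat list \<Rightarrow> nat list \<Rightarrow> nat list \<Rightarrow> nat list" where
  "gn I J y \<equiv> gen k d0 (e0 + d0) I J y"

lemma gn_nth: "l < k \<Longrightarrow> gn I J y ! l = XIJ k I J ! l + (2 ^ (e0 + d0) - 2 ^ d0) * Xij k (Min (set I)) (Min (set J)) ! l +
    2 ^ (e0 + d0) * fij k (Min (set I)) (Min (set J)) y ! l"
  by (simp add: gen_def Let_def)

lemma length_gn [simp]: "length (gn I J y) = k" by (simp add: gen_def Let_def)

lemma ml_gn: assumes "(I, J) \<in> B" shows "ml (gn I J y) = gen_image I J {y}"
proof -
  let ?i = "Min (set I)" and ?j = "Min (set J)"
  have len: "length I = d0" using B_PSeq assms by (auto simp: PSeq_def)
  have mx: "ml (map (\<lambda>l. XIJ k I J ! l) [0..<k]) = ml (XIJ k I J)" using map_nth[of "XIJ k I J"] by simp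
  have mf: "ml (map (\<lambda>l. fij k ?i ?j y ! l) [0..<k]) = ml (fij k ?i ?j y)" using map_nth[of "fij k ?i ?j y"] by simp
  have mX: "ml (map (\<lambda>l. Xij k ?i ?j ! l) [0..<k]) = X (cmp k ?i ?j)"
    unfolding X_ml[OF cmp_subset] Xij_cmp[symmetric] using map_nth[of "Xij k ?i ?j"] by simp
  have "ml (gn I J y) = ml (XIJ k I J) * X (cmp k ?i ?j) ^ (2 ^ (e0 + d0) - 2 ^ d0) * ml (fij k ?i ?j y) ^ (2 ^ (e0 + d0))"
    unfolding gen_def Let_def ml_plus ml_times mx mf mX ..
  moreover have "gen_image I J {y} = ml (XIJ k I J) * (X (cmp k ?i ?j) ^ (2 ^ e0 - 1) * ml (fij k ?i ?j y) ^ (2 ^ e0)) ^ (2 ^ d0)"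
    unfolding gen_image_def pre_replicate by (simp add: pre_def len)
  moreover have "(2 ^ e0 - 1) * 2 ^ d0 = 2 ^ (e0 + d0) - (2::nat) ^ d0"
    by (simp add: diff_mult_distrib power_add)
  ultimately show ?thesis
    by (simp add: power_mult_distrib power_mult[symmetric] power_add mult.assoc)
qed

text \<open>Generating polynomials are mapped elementwise as sets of monomials; without injectivity
  the image could merge monomials instead of adding them.\<close>

lemma gn_inj: assumes "(I, J) \<in> B" shows "inj_on (gn I J) {y. length y = s}"
proof (rule inj_onI)
  fix y z assume yz: "y \<in> {y. length y = s}" "z \<in> {y. length y = s}" "gn I J y = gn I J z"
  let ?i = "Min (set I)" and ?j = "Min (set J)"
  have ij: "1 \<le> ?i" "?i < ?j" "?j \<le> k" using B_heads[OF assms] by metis+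
  have eq: "fij k ?i ?j y = fij k ?i ?j z"
  proof (rule nth_equalityI)
    fix l assume "l < length (fij k ?i ?j y)"
    then have l: "l < k" by simp
    show "fij k ?i ?j y ! l = fij k ?i ?j z ! l"
      using arg_cong[OF yz(3), of "\<lambda>a. a ! l"] unfolding gn_nth[OF l] by simp
  qed simp
  have "inj_on (\<lambda>a. ex (fij k ?i ?j a)) {a. length a = s}" using fij_embeds[OF ij] by (simp add: embeds_def)
  from inj_onD[OF this _ yz(1,2)] show "y = z" using eq by simp
qed

lemma toE_gn: assumes IJ: "(I, J) \<in> B" and Y: "Y \<in> \<Y>" shows "toE ex (gn I J ` Y) = gen_image I J Y"
proof -
  have "Y \<subseteq> {y. length y = s}" using Y Y_deg by (auto simp: polys_deg_def polys_def)
  then have "toE ex (gn I J ` Y) = (\<Sum>y\<in>Y. gen_image I J {y})"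
    unfolding toE_def using ml_gn[OF IJ] by (simp add: sum.reindex[OF inj_on_subset[OF gn_inj[OF IJ]]])
  also have "\<dots> = gen_image I J Y"
    unfolding gen_image_def toE_def by (simp add: pre_sum)
  finally show ?thesis .
qed

lemma sum_list_gn:
  assumes IJ: "(I, J) \<in> B" and y: "length y = s" "sum_list y = N 0"
  shows "sum_list (gn I J y) = N (e0 + d0)"
proof -
  let ?i = "Min (set I)" and ?j = "Min (set J)"
  have ij: "1 \<le> ?i" "?i < ?j" "?j \<le> k" using B_heads[OF IJ] by metis+
  have nth: "(\<Sum>l<k. a ! l) = sum_list a" if "length a = k" for a :: "nat list"
    using that by (simp add: sum_list_sum_nth atLeast0LessThan)
  have sX: "sum_list (Xij k ?i ?j) = s"
    unfolding Xij_cmp sum_list_indicator[OF cmp_subset] using ij by (intro card_cmp) auto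
  have sf: "sum_list (fij k ?i ?j y) = N 0" using fij_embeds[OF ij] y by (auto simp: embeds_def dg_ex)
  have "sum_list (gn I J y) = (\<Sum>l<k. gn I J y ! l)" using nth by simp
  also have "\<dots> = (\<Sum>l<k. XIJ k I J ! l) + (2 ^ (e0 + d0) - 2 ^ d0) * (\<Sum>l<k. Xij k ?i ?j ! l) + 2 ^ (e0 + d0) * (\<Sum>l<k. fij k ?i ?j y ! l)"
    by (simp add: gn_nth sum.distrib sum_distrib_left)
  also have "\<dots> = s * (2 ^ d0 - 1) + (2 ^ (e0 + d0) - 2 ^ d0) * s + 2 ^ (e0 + d0) * N 0"
    unfolding nth[OF length_XIJ] nth[OF length_Xij] nth[OF length_fij] sX sf sum_XIJ[OF subsetD[OF B_PSeq IJ]] ..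
  also have "s * (2 ^ d0 - 1) + (2 ^ (e0 + d0) - 2 ^ d0) * s = s * (2 ^ (e0 + d0) - 1)"
  proof -
    have "(1::nat) \<le> 2 ^ d0" by simp
    moreover have "(2::nat) ^ d0 \<le> 2 ^ (e0 + d0)" by (rule power_increasing) auto
    ultimately have "(2 ^ d0 - 1) + (2 ^ (e0 + d0) - 2 ^ d0) = 2 ^ (e0 + d0) - (1::nat)" by linarith
    then show ?thesis by (metis distrib_left mult.commute)
  qed
  finally show ?thesis using N_closed[of 0 "e0 + d0"] by simp
qed

lemma gn_polys_deg: assumes "(I, J) \<in> B" "Y \<in> \<Y>" shows "gn I J ` Y \<in> polys_deg k (N (e0 + d0))"
proof -
  have "Y \<in> polys_deg s (N 0)" using assms(2) Y_deg by blast
  then show ?thesis using sum_list_gn[OF assms(1)] by (auto simp: polys_deg_def polys_def)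
qed

text \<open>The last pair carries the exponent 2^0, so its first variable has an even exponent in
  every monomial and Kameko's map kills the generator. Membership in the kernel is required because
  \<open>qdim\<close> admits only generating sets inside the subspace.\<close>

lemma gn_kameko: assumes IJ: "(I, J) \<in> B" and Y: "Y \<in> \<Y>" shows "kameko (gn I J ` Y) \<in> hit k"
proof -
  obtain d1 where d1: "d0 = Suc d1" using d0 by (cases d0) auto
  have "(I, J) \<in> PSeq k (Suc d1)" using IJ B_PSeq d1 by blast
  then obtain I' h J' q where HK: "I = I' @ [h]" "J = J' @ [q]" "(I', J') \<in> PSeq k d1" "1 \<le> h" "h < q" "q \<le> k"
    by (rule PSeq_snocE)
  have len: "length I' = length J'" using HK(3) by (auto simp: PSeq_def)
  have hk: "h - 1 < k" using HK by simp
  have "\<not> (\<forall>e\<in>set (gn I J y). odd e)" for y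
  proof -
    have "even (XIJ k I J ! (h - 1))"
      unfolding HK(1,2) XIJ_snoc[OF len] using hk HK(4) by (simp add: comb_def cmp_def)
    moreover have "even ((2::nat) ^ (e0 + d0) - 2 ^ d0)" "even ((2::nat) ^ (e0 + d0))" using d1 by auto
    ultimately have "even (gn I J y ! (h - 1))" unfolding gn_nth[OF hk] by simp
    moreover have "gn I J y ! (h - 1) \<in> set (gn I J y)" using hk by simp
    ultimately show ?thesis by blast
  qed
  then have "kameko (gn I J ` Y) = {}"
    unfolding kameko_def using polys_deg_finite[OF gn_polys_deg[OF IJ Y]] by (intro Psum_all_empty) auto
  then show ?thesis by (simp add: hit_def)
qed

definition gens :: "poly set" where "gens = {gn I J ` Y | I J Y. (I, J) \<in> B \<and> Y \<in> \<Y>}"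

lemma kernel_span:
  assumes f: "f \<in> polys_deg k (N (e0 + d0))" and ker: "kameko f \<in> hit k"
  shows "f \<in> ssum (f2span gens) (hit k)"
proof (rule lift_span_hits)
  show "f \<in> polys k" using f by (rule polys_deg_polys)
  show "gens \<subseteq> polys k" by (auto simp: gens_def intro: polys_deg_polys[OF gn_polys_deg])
  have "{gen_image I J Y | I J Y. (I, J) \<in> B \<and> Y \<in> \<Y>} \<subseteq> toE ex ` gens"
  proof clarify
    fix I J Y assume IJY: "(I, J) \<in> B" "Y \<in> \<Y>"
    then have "gn I J ` Y \<in> gens" by (auto simp: gens_def)
    then show "gen_image I J Y \<in> toE ex ` gens" unfolding toE_gn[OF IJY, symmetric] by (rule imageI)
  qed
  then have "target \<subseteq> aspan (toE ex ` gens \<union> hits k (N (e0 + d0)))"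
    unfolding target_def by (intro aspan_mono Un_mono order_refl)
  then show "toE ex f \<in> aspan (toE ex ` gens \<union> hits k (N (e0 + d0)))" using kernel_in_target[OF f ker] by blast
qed

lemma gens_kernel: "gens \<subseteq> {f \<in> polys_deg k (N (e0 + d0)). kameko f \<in> hit k}"
  by (auto simp: gens_def intro: gn_polys_deg gn_kameko)

lemma gens_card: "finite \<Y> \<Longrightarrow> finite gens \<and> card gens \<le> card B * card \<Y>"
proof -
  assume Y: "finite \<Y>"
  let ?f = "\<lambda>((I,J),Y). gn I J ` Y"
  have sub: "gens \<subseteq> ?f ` (B \<times> \<Y>)"
  proof
    fix t assume "t \<in> gens"
    then obtain I J Y where "t = gn I J ` Y" "(I, J) \<in> B" "Y \<in> \<Y>" by (auto simp: gens_def)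
    then show "t \<in> ?f ` (B \<times> \<Y>)" by (intro image_eqI[of _ _ "((I, J), Y)"]) auto
  qed
  have fin: "finite (B \<times> \<Y>)" using Y finite_B by simp
  have "card gens \<le> card (?f ` (B \<times> \<Y>))" by (rule card_mono[OF finite_imageI[OF fin] sub])
  also have "\<dots> \<le> card (B \<times> \<Y>)" by (rule card_image_le[OF fin])
  finally show ?thesis using finite_subset[OF sub finite_imageI[OF fin]] by (simp add: card_cartesian_product)
qed

end

section \<open>Degrees obtained from the exponents d_i, and the bound on the dimension\<close>

lemma finite_polys_deg: "finite (polys_deg s m)"
proof (rule finite_subset)
  show "polys_deg s m \<subseteq> Pow {a. length a = s \<and> sum_list a = m}" by (auto simp: polys_deg_def polys_def)
qed (simp add: finite_monos)

theorem theorem3: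
  fixes k d0 n m :: nat and ds :: "nat \<Rightarrow> nat" and B :: "(nat list \<times> nat list) set"
  assumes "4 \<le> k" and "2 < d0"
    and "\<forall>i. 1 \<le> i \<and> i \<le> k - 2 \<longrightarrow> 0 < ds i"
    and "\<forall>i. 1 \<le> i \<and> i < k - 3 \<longrightarrow> ds (i+1) < ds i"
    and "ds (k-2) \<le> ds (k-3)"
    and "d0 \<le> ds (k-2)"
    and "n = (\<Sum>i=1..k-2. 2^(ds i) - 1)"
    and "m = (\<Sum>i=1..k-3. 2^(ds i - ds (k-2)) - 1)"
    and "compatible k d0 B"
  shows "(\<forall>f\<in>polys_deg k n. kameko f \<in> hit k \<longrightarrow>
            f \<in> ssum (f2span {{gen k d0 (ds (k-2)) I J y} | I J y.
                                 (I,J) \<in> B \<and> y \<in> admissible_set (k-2) m}) (hit k))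
       \<and> qdim {f\<in>polys_deg k n. kameko f \<in> hit k} (hit k)
           \<le> card B * qdim (polys_deg (k-2) m) (hit (k-2))"
proof -
  define s where "s = k - 2"
  define d where "d = ds s"
  define e0 where "e0 = d - d0"
  \<comment> \<open>All exponents are lowered by the smallest one, d, and raised again by e. So e =
    d gives n, and at e = 0 the last summand vanishes and m remains.\<close>
  define N :: "nat \<Rightarrow> nat" where "N e = (\<Sum>i=1..s. 2 ^ (ds i - d + e) - 1)" for e
  have ks: "k = s + 2" and s2: "2 \<le> s" using assms(1) by (auto simp: s_def)
  have k3: "k - 3 = s - 1" using ks by simp
  have dd: "e0 + d0 = d" using assms(6) by (simp add: e0_def d_def s_def)
  have last: "ds s \<le> ds (s - 1)" using assms(5) unfolding k3 s_def[symmetric] .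
  have dk: "ds (k - 2) = d" unfolding d_def s_def ..
  have mono: "ds (s - 1) \<le> ds i" if "1 \<le> i" "i \<le> s - 1" for i
    using that(2,1)
  proof (induction i rule: inc_induct)
    case (step i)
    then show ?case using assms(4) k3 by (metis Suc_eq_plus1 le_SucI less_imp_le le_trans)
  qed simp
  have ge: "d \<le> ds i" if "1 \<le> i" "i \<le> s" for i
  proof (cases "i = s")
    case False
    then have "ds (s - 1) \<le> ds i" using that by (intro mono) auto
    moreover have "d \<le> ds (s - 1)" unfolding d_def by (rule last)
    ultimately show ?thesis by (rule le_trans[rotated])
  qed (simp add: d_def)
  have N_Suc: "N (Suc e) = 2 * N e + s" for e
  proof -
    have "2 ^ (ds i - d + Suc e) - 1 = 2 * (2 ^ (ds i - d + e) - 1) + (1::nat)" for i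
      using geometric_Suc[of 1 "ds i - d + e"] by simp
    then have "N (Suc e) = (\<Sum>i=1..s. 2 * (2 ^ (ds i - d + e) - 1) + 1)" unfolding N_def by (intro sum.cong) auto
    also have "\<dots> = 2 * N e + s" unfolding N_def by (simp only: sum.distrib sum_distrib_left[symmetric]) simp
    finally show ?thesis .
  qed
  have not_rep: "\<not> rep (N (Suc e)) (s - 1)" for e
  proof -
    \<comment> \<open>The exponents of the minimal spike of degree \<open>N (Suc e)\<close>: they
      are positive and only the last two may agree, so fewer than s summands cannot give this
      degree.\<close>
    define es where "es = map (\<lambda>i. ds i - d + Suc e) [1..<Suc s]"
    have len: "length es = s" by (simp add: es_def)
    have nth: "es ! t = ds (Suc t) - d + Suc e" if "t < s" for t
      using that by (simp add: es_def del: upt_Suc)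
    have "std es"
      unfolding std_def len
    proof (intro conjI allI impI)
      show "\<forall>x\<in>set es. 0 < x" by (simp add: es_def)
    next
      fix t assume t: "t + 1 < s"
      have "ds (Suc (Suc t)) \<le> ds (Suc t)"
      proof (cases "Suc t < s - 1")
        case True
        then show ?thesis using assms(4)[rule_format, of "Suc t"] k3 by simp
      next
        case False
        then have st: "Suc t = s - 1" "Suc (Suc t) = s" using t by auto
        show ?thesis unfolding st(2) unfolding st(1) by (rule last)
      qed
      then show "es ! (t + 1) \<le> es ! t" using t by (simp add: nth)
    next
      fix t assume t: "t + 2 < s"
      then have "ds (Suc (Suc t)) < ds (Suc t)" using assms(4)[rule_format, of "Suc t"] k3 by simp
      moreover have "d \<le> ds (Suc (Suc t))" using t by (intro ge) auto
      ultimately show "es ! (t + 1) < es ! t" using t by (simp add: nth)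
    qed
    moreover have "val es = N (Suc e)"
      unfolding es_def N_def by (simp add: sum_list_distinct_conv_sum_set atLeastLessThanSuc_atLeastAtMost o_def del: upt_Suc)
    ultimately show ?thesis using not_rep_std[of es "s - 1"] len s2 by simp
  qed
  have Nn: "N (e0 + d0) = n"
    unfolding dd N_def assms(7) s_def[symmetric] by (rule sum.cong) (use ge in auto)
  have N0: "N 0 = m"
  proof -
    obtain r where r: "s = Suc r" using s2 by (cases s) auto
    have "N 0 = (\<Sum>i=1..r. 2 ^ (ds i - d) - 1) + (2 ^ (ds s - d) - 1)" unfolding N_def r by simp
    also have "\<dots> = (\<Sum>i=1..r. 2 ^ (ds i - d) - 1)" by (simp add: d_def)
    also have "\<dots> = m" unfolding assms(8) k3 dk using r by simp
    finally show ?thesis .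
  qed
  interpret level_degrees k s N by unfold_locales (fact ks s2 N_Suc not_rep)+
  have inst: "compatible_family k s N d0 B \<Y>"
    if "\<Y> \<subseteq> polys_deg s m" "polys_deg s m \<subseteq> ssum (f2span \<Y>) (hit s)" for \<Y>
    by unfold_locales (use assms(2,9) that N0 in auto)
  have part1: "f \<in> ssum (f2span {{gen k d0 d I J y} | I J y. (I,J) \<in> B \<and> y \<in> admissible_set s m}) (hit k)"
    if f: "f \<in> polys_deg k n" "kameko f \<in> hit k" for f
  proof -
    let ?Y = "{{y} | y. y \<in> admissible_set s m}"
    interpret C: compatible_family k s N d0 e0 B ?Y
      by (rule inst) (auto simp: admissible_span, auto simp: admissible_set_def polys_deg_def polys_def)
    have "C.gens = {{gen k d0 d I J y} | I J y. (I,J) \<in> B \<and> y \<in> admissible_set s m}"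
    proof (intro set_eqI iffI)
      fix t assume "t \<in> C.gens"
      then obtain I J Y where t: "t = gen k d0 d I J ` Y" "(I, J) \<in> B" "Y \<in> ?Y"
        unfolding C.gens_def dd by blast
      then obtain y where "Y = {y}" "y \<in> admissible_set s m" by blast
      then show "t \<in> {{gen k d0 d I J y} | I J y. (I,J) \<in> B \<and> y \<in> admissible_set s m}" using t by auto
    next
      fix t assume "t \<in> {{gen k d0 d I J y} | I J y. (I,J) \<in> B \<and> y \<in> admissible_set s m}"
      then obtain I J y where t: "t = gen k d0 d I J ` {y}" "(I, J) \<in> B" "y \<in> admissible_set s m" by auto
      then have "{y} \<in> ?Y" by blast
      then show "t \<in> C.gens" unfolding C.gens_def dd using t by blast
    qed
    then show ?thesis using C.kernel_span[of f] f Nn by simp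
  qed
  let ?V = "{f\<in>polys_deg k n. kameko f \<in> hit k}"
  have part2: "qdim ?V (hit k) \<le> card B * qdim (polys_deg s m) (hit s)"
  proof -
    \<comment> \<open>The whole finite degree-m part generates, so the minimum in
      \<open>qdim\<close> is attained, and a generating set of that size serves as
      \<open>\<Y>\<close>.\<close>
    let ?Q = "\<lambda>c. \<exists>S. finite S \<and> card S = c \<and> S \<subseteq> polys_deg s m \<and> polys_deg s m \<subseteq> ssum (f2span S) (hit s)"
    have "polys_deg s m \<subseteq> ssum (f2span (polys_deg s m)) (hit s)"
    proof
      fix P assume "P \<in> polys_deg s m"
      then have "P \<in> f2span (polys_deg s m)" by (rule f2span_base)
      then show "P \<in> ssum (f2span (polys_deg s m)) (hit s)"
        unfolding ssum_def by (intro CollectI exI[of _ P] exI[of _ "{}"]) (auto simp: hit_def)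
    qed
    then have "?Q (card (polys_deg s m))" using finite_polys_deg by blast
    then have "?Q (qdim (polys_deg s m) (hit s))" unfolding qdim_def by (rule LeastI)
    then obtain \<Y> where Y: "finite \<Y>" "card \<Y> = qdim (polys_deg s m) (hit s)" "\<Y> \<subseteq> polys_deg s m"
      "polys_deg s m \<subseteq> ssum (f2span \<Y>) (hit s)" by blast
    interpret C: compatible_family k s N d0 e0 B \<Y> by (rule inst[OF Y(3,4)])
    have "qdim ?V (hit k) \<le> card C.gens"
      unfolding qdim_def
    proof (rule Least_le, intro exI conjI)
      show "finite C.gens" using C.gens_card[OF Y(1)] by simp
      show "C.gens \<subseteq> ?V" using C.gens_kernel Nn by simp
      show "?V \<subseteq> ssum (f2span C.gens) (hit k)" using C.kernel_span Nn by auto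
    qed simp
    also have "\<dots> \<le> card B * qdim (polys_deg s m) (hit s)" using C.gens_card[OF Y(1)] Y(2) by simp
    finally show ?thesis .
  qed
  show ?thesis unfolding dk unfolding s_def[symmetric]
    using part2 by (intro conjI ballI impI) (rule part1)
qed

end
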